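(* (a) Let $v\in \mathcal{C}^2(\mathbb{H})$ and $q\in\mathbb{H}$. Then, as $r\to 0+$: $$\mathcal{A}_3(v,r)(q)=v(q)+\frac{r^2}{3\pi}\Delta_{\mathbb{H}}v(q)+o(r^2).$$ In particular, if $v(q)=\mathcal{A}_3(v,r)(q)$ for all $r\in(0,r_0)$, for some $r_0>0$, then $\Delta_{\mathbb{H}}v(q)=0$. (b) Let $\mathcal{D}\subset\mathbb{H}$ be open and $v\in\mathcal{C}(\mathcal{D})$. Then the mean value property $\mathcal{A}_3(v,r)(q)= v(q)+o(r^2)$ as $r\to 0$ holds in the viscosity sense at every $q\in\mathcal{D}$ if and only if $v\in\mathcal{C}^\infty(\mathcal{D})$ and $\Delta_{\mathbb{H}}v=0$ in $\mathcal{D}$.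
   Context: $\mathbb{H}=(\mathbb{R}^3,* )$ is the first Heisenberg group with $(x,y,z)*(x',y',z')=(x+x',y+y',z+z'+\frac12(xy'-yx'))$. The Korányi gauge is $|(x,y,z)|_K=((x^2+y^2)^2+16z^2)^{1/4}$, the metric is $d(q,q')=|q^{-1}*q'|_K$, and $B_r(q)=\{q'\in\mathbb{H}: d(q,q')<r\}$. With $X=\partial_x-\frac y2\partial_z$, $Y=\partial_y+\frac x2\partial_z$, set $\Delta_{\mathbb{H}}v=(X^2+Y^2)v$. Define $\mathcal{A}_3(v,r)(q)=\frac{1}{|B_r(q)|}\int_{B_r(q)}v(p)\,dp$ (Lebesgue measure on $\mathbb{R}^3$). Viscosity sense: the property $\mathcal{A}_3(v,r)(q)= v(q)+o(r^2)$ as $r\to0$ holds in the viscosity sense at $q\in\mathcal{D}$ if the following two conditions hold: (i) for every $\phi\in\mathcal{C}^2(\mathcal{D})$ such that $\phi(q)=v(q)$ and $\phi<v$ in $\mathcal{D}\setminus\{q\}$, there holds $\mathcal{A}_3(\phi,r)(q)-\phi(q)\le o(r^2)$ as $r\to0$; (ii) for every $\phi\in\mathcal{C}^2(\mathcal{D})$ such that $\phi(q)=v(q)$ and $\phi>v$ in $\mathcal{D}\setminus\{q\}$, there holds $\mathcal{A}_3(\phi,r)(q)-\phi(q)\ge o(r^2)$ as $r\to0$. *)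

theory Defs
  imports "HOL-Analysis.Analysis" "HOL-Library.Landau_Symbols"
begin

section \<open>The Heisenberg group and the Koranyi metric\<close>

type_synonym heis = "real \<times> real \<times> real"

fun heis_mult :: "heis \<Rightarrow> heis \<Rightarrow> heis" where
  "heis_mult (x, y, z) (x', y', z') =
     (x + x', y + y', z + z' + (1/2) * (x * y' - y * x'))"

fun heis_inv :: "heis \<Rightarrow> heis" where
  "heis_inv (x, y, z) = (- x, - y, - z)"

lemma heis_mult_zero_left: "heis_mult (0, 0, 0) q = q"
  by (cases q) simp

lemma heis_mult_zero_right: "heis_mult q (0, 0, 0) = q"
  by (cases q) simp

lemma heis_mult_inv_left: "heis_mult (heis_inv q) q = (0, 0, 0)"
  by (cases q) simp

lemma heis_mult_inv_right: "heis_mult q (heis_inv q) = (0, 0, 0)"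
  by (cases q) simp

lemma heis_mult_assoc: "heis_mult (heis_mult p q) r = heis_mult p (heis_mult q r)"
  by (cases p; cases q; cases r) (simp add: algebra_simps)

fun koranyi_gauge :: "heis \<Rightarrow> real" where
  "koranyi_gauge (x, y, z) = ((x\<^sup>2 + y\<^sup>2)\<^sup>2 + 16 * z\<^sup>2) powr (1/4)"

definition heis_dist :: "heis \<Rightarrow> heis \<Rightarrow> real" where
  "heis_dist q q' = koranyi_gauge (heis_mult (heis_inv q) q')"

definition heis_ball :: "heis \<Rightarrow> real \<Rightarrow> heis set" where
  "heis_ball q r = {q'. heis_dist q q' < r}"


section \<open>Regularity classes and the horizontal Laplacian\<close>

definition partial_deriv :: "'a::euclidean_space \<Rightarrow> ('a \<Rightarrow> real) \<Rightarrow> 'a \<Rightarrow> real" where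
  "partial_deriv b f p = deriv (\<lambda>t. f (p + t *\<^sub>R b)) 0"

text \<open>
  \<open>Ck_on k f S\<close> is meant for open \<open>S\<close>. The differentiability conjunct guarantees that the
  partial derivatives exist, so that the total operator \<^const>\<open>deriv\<close> does not return a junk
  value; it adds nothing else, since continuous partial derivatives on an open set already
  imply differentiability.
\<close>

primrec Ck_on :: "nat \<Rightarrow> ('a::euclidean_space \<Rightarrow> real) \<Rightarrow> 'a set \<Rightarrow> bool" where
  "Ck_on 0 f S \<longleftrightarrow> continuous_on S f"
| "Ck_on (Suc k) f S \<longleftrightarrow>
     (\<forall>p\<in>S. f differentiable (at p)) \<and> (\<forall>b\<in>Basis. Ck_on k (partial_deriv b f) S)"

definition Cinf_on :: "('a::euclidean_space \<Rightarrow> real) \<Rightarrow> 'a set \<Rightarrow> bool" where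
  "Cinf_on f S \<longleftrightarrow> (\<forall>k. Ck_on k f S)"

definition heis_X :: "(heis \<Rightarrow> real) \<Rightarrow> heis \<Rightarrow> real" where
  "heis_X f = (\<lambda>(x, y, z).
     partial_deriv (1, 0, 0) f (x, y, z) - y / 2 * partial_deriv (0, 0, 1) f (x, y, z))"

definition heis_Y :: "(heis \<Rightarrow> real) \<Rightarrow> heis \<Rightarrow> real" where
  "heis_Y f = (\<lambda>(x, y, z).
     partial_deriv (0, 1, 0) f (x, y, z) + x / 2 * partial_deriv (0, 0, 1) f (x, y, z))"

definition heis_laplacian :: "(heis \<Rightarrow> real) \<Rightarrow> heis \<Rightarrow> real" where
  "heis_laplacian f q = heis_X (heis_X f) q + heis_Y (heis_Y f) q"


section \<open>Averages and the viscosity mean value property\<close>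

definition heis_avg :: "(heis \<Rightarrow> real) \<Rightarrow> real \<Rightarrow> heis \<Rightarrow> real" where
  "heis_avg v r q =
     (LINT p:heis_ball q r|lborel. v p) / measure lborel (heis_ball q r)"

text \<open>
  Functions on an open set \<open>D\<close> are represented by total functions whose values outside \<open>D\<close>
  play no role: \<open>heis_ball q r\<close> is contained in \<open>D\<close> for all small \<open>r\<close>, and only
  the limit \<open>r \<rightarrow> 0+\<close> is considered. An inequality \<open>F r \<le> o(r\<^sup>2)\<close> means
  that \<open>F\<close> is eventually bounded above by some function in \<open>o(r\<^sup>2)\<close>.
\<close>

definition viscosity_mvp_at :: "heis set \<Rightarrow> (heis \<Rightarrow> real) \<Rightarrow> heis \<Rightarrow> bool" where
  "viscosity_mvp_at D v q \<longleftrightarrow>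
     (\<forall>\<phi>. Ck_on 2 \<phi> D \<and> \<phi> q = v q \<and> (\<forall>p\<in>D - {q}. \<phi> p < v p) \<longrightarrow>
        (\<exists>g \<in> o[at_right 0](\<lambda>r::real. r\<^sup>2).
           \<forall>\<^sub>F r in at_right 0. heis_avg \<phi> r q - \<phi> q \<le> g r)) \<and>
     (\<forall>\<phi>. Ck_on 2 \<phi> D \<and> \<phi> q = v q \<and> (\<forall>p\<in>D - {q}. \<phi> p > v p) \<longrightarrow>
        (\<exists>g \<in> o[at_right 0](\<lambda>r::real. r\<^sup>2).
           \<forall>\<^sub>F r in at_right 0. heis_avg \<phi> r q - \<phi> q \<ge> g r))"

end

(* Part (a) is a second-order Taylor expansion along the dilations. For part (b), a mean with the weight
   (x^2 + y^2) (1 - N^4)_+^j, N the Koranyi gauge, differs from the value at the centre by a positive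
   average of the sub-Laplacian, so harmonic functions reproduce under it and sub- and superharmonic ones
   satisfy one-sided inequalities. On a Euclidean ball, where R^2 - |p - q0|^2 is a strictly superharmonic
   barrier, monotone iteration of this mean at one fixed radius yields a smooth fixed point close to given
   polynomial boundary values; since radial averages commute with the sub-Laplacian, averaging the fixed
   point once more makes it exactly harmonic. Comparison of a viscosity solution with these harmonic
   functions shows that it is a local uniform limit of them. Hence it reproduces under the mean for every
   exponent j, that is, it is locally a convolution with arbitrarily smooth kernels, and so it is smooth. *)

theory Submission
  imports Defs
begin

section \<open>Functions of class \<open>C\<^sup>k\<close>\<close>

text \<open>The plain average is used only through its second-order limit, since it does not
  reproduce harmonic functions: (x^2 + y^2)^2 - 32 z^2 is harmonic, vanishes at the origin and has
  negative mean over the unit gauge ball. The weight x^2 + y^2 arises because the horizontal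
  gradient of (1 - N^4)_+^(j+1), paired with that of a function g, is a multiple of the dilation
  derivative of g with this factor plus a rotational derivative, which integrates to zero. The
  operator is degenerate and a sphere may have characteristic points, so boundary values are
  attained only up to an error and on a slightly smaller sphere; for comparison in the sup norm this
  is enough. A fixed point h of the mean M at one radius s is not yet known to be harmonic. Let A be
  the average with density t (1 - N^4)_+^(j+1) over 0 <= t <= s. Up to normalisation the mean value
  formula reads A L h = M h - h, with L the sub-Laplacian, so L (A h) = 0 once A and L commute. That
  is not automatic: L is left invariant, while A moves the argument by right multiplication.\<close>

lemma partial_deriv_eqI:
  assumes "(f has_derivative f') (at p)"
  shows "partial_deriv b f p = f' b"
proof -
  have l: "((\<lambda>t. p + t *\<^sub>R b) has_derivative (\<lambda>t. t *\<^sub>R b)) (at 0)"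
    by (auto intro!: derivative_eq_intros)
  have "((\<lambda>t. f (p + t *\<^sub>R b)) has_derivative (\<lambda>t. f' (t *\<^sub>R b))) (at 0)"
    using diff_chain_at[OF l, of f f'] assms by (simp add: o_def)
  moreover have "f' (t *\<^sub>R b) = f' b * t" for t
    using linear_cmul[OF bounded_linear.linear[OF has_derivative_bounded_linear[OF assms]]]
    by (simp add: mult.commute)
  ultimately have "((\<lambda>t. f (p + t *\<^sub>R b)) has_field_derivative f' b) (at 0)"
    by (simp add: has_field_derivative_def)
  then show ?thesis unfolding partial_deriv_def by (rule DERIV_imp_deriv)
qed

lemma partial_deriv_cong:
  assumes "open S" "p \<in> S" "\<And>q. q \<in> S \<Longrightarrow> f q = g q"
  shows "partial_deriv b f p = partial_deriv b g p"
proof -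
  have "open ((\<lambda>t::real. p + t *\<^sub>R b) -` S)"
    using assms(1) by (intro open_vimage continuous_intros)
  then have "\<forall>\<^sub>F t in nhds 0. p + t *\<^sub>R b \<in> S"
    using assms(2) by (intro eventually_nhds_in_open[of "(\<lambda>t::real. p + t *\<^sub>R b) -` S", simplified]) auto
  then show ?thesis unfolding partial_deriv_def
    by (intro deriv_cong_ev) (auto elim: eventually_mono simp: assms(3))
qed

lemma Ck_on_cong:
  assumes "open S" "Ck_on k f S" "\<And>p. p \<in> S \<Longrightarrow> f p = g p"
  shows "Ck_on k g S"
  using assms(2,3)
proof (induction k arbitrary: f g)
  case 0
  then show ?case using continuous_on_cong by (metis (no_types, lifting) Ck_on.simps(1))
next
  case (Suc k)
  have "g differentiable (at p)" if "p \<in> S" for p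
  proof -
    have "f differentiable (at p)" using Suc.prems(1) that by simp
    then obtain f' where "(f has_derivative f') (at p)" unfolding differentiable_def by blast
    then have "(g has_derivative f') (at p)"
      using has_derivative_transform_within_open[OF _ assms(1) that] Suc.prems(2) by blast
    then show ?thesis unfolding differentiable_def by blast
  qed
  moreover have "Ck_on k (partial_deriv b g) S" if "b \<in> Basis" for b
  proof (rule Suc.IH)
    show "Ck_on k (partial_deriv b f) S" using Suc.prems(1) that by simp
    show "\<And>p. p \<in> S \<Longrightarrow> partial_deriv b f p = partial_deriv b g p"
      using partial_deriv_cong[OF assms(1)] Suc.prems(2) by blast
  qed
  ultimately show ?case by simp
qed

lemma Ck_on_subset: "Ck_on k f S \<Longrightarrow> T \<subseteq> S \<Longrightarrow> Ck_on k f T"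
  by (induction k arbitrary: f) (auto intro: continuous_on_subset)

lemma Ck_on_local:
  assumes "\<And>p. p \<in> S \<Longrightarrow> \<exists>U. open U \<and> p \<in> U \<and> Ck_on k f U"
  shows "Ck_on k f S"
  using assms
proof (induction k arbitrary: f)
  case 0
  have "continuous_on S f"
  proof (intro continuous_at_imp_continuous_on ballI)
    fix p assume "p \<in> S"
    then obtain U where "open U" "p \<in> U" "Ck_on 0 f U" using 0 by blast
    then show "isCont f p" by (simp add: continuous_on_eq_continuous_at)
  qed
  then show ?case by simp
next
  case (Suc k)
  have "\<exists>U. open U \<and> p \<in> U \<and> (\<forall>p\<in>U. f differentiable (at p)) \<and> (\<forall>b\<in>Basis. Ck_on k (partial_deriv b f) U)"
    if "p \<in> S" for p using Suc.prems[OF that] Ck_on.simps(2) by metis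
  note U = this
  have "Ck_on k (partial_deriv b f) S" if "b \<in> Basis" for b
    using U that by (intro Suc.IH) blast
  then show ?case using U Ck_on.simps(2) by blast
qed

lemma Ck_on_partial: "Ck_on (Suc k) f S \<Longrightarrow> b \<in> Basis \<Longrightarrow> Ck_on k (partial_deriv b f) S"
  by simp

lemma Ck_on_SucD: "Ck_on (Suc k) f S \<Longrightarrow> Ck_on k f S"
proof (induction k arbitrary: f)
  case 0
  then show ?case
    by (auto intro!: continuous_at_imp_continuous_on differentiable_imp_continuous_within)
next
  case (Suc k)
  from Suc.prems have "\<forall>p\<in>S. f differentiable (at p)" "\<forall>b\<in>Basis. Ck_on (Suc k) (partial_deriv b f) S"
    using Ck_on.simps(2)[of "Suc k"] by blast+
  then show ?case using Ck_on.simps(2)[of k] Suc.IH by blast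
qed

lemma Ck_on_mono: "Ck_on k f S \<Longrightarrow> j \<le> k \<Longrightarrow> Ck_on j f S"
  by (induction k) (use Ck_on_SucD le_Suc_eq in blast)+

lemma Ck_on_continuous: "Ck_on k f S \<Longrightarrow> continuous_on S f"
  using Ck_on_mono[of k f S 0] by simp

text \<open>Trades the total operator \<open>deriv\<close> for the values of a known Frechet
  derivative. The main closure properties below are inductions through this rule and its converse
  \<open>Ck_on_has_derivative\<close>.\<close>

lemma Ck_on_SucI:
  assumes "open S" "\<And>p. p \<in> S \<Longrightarrow> (f has_derivative f' p) (at p)"
    "\<And>b. b \<in> Basis \<Longrightarrow> Ck_on k (\<lambda>p. f' p b) S"
  shows "Ck_on (Suc k) f S"
proof -
  have "Ck_on k (partial_deriv b f) S" if "b \<in> Basis" for b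
    using partial_deriv_eqI[OF assms(2)] assms(1) by (intro Ck_on_cong[OF _ assms(3)[OF that]]) auto
  moreover have "f differentiable (at p)" if "p \<in> S" for p
    using assms(2)[OF that] unfolding differentiable_def by blast
  ultimately show ?thesis by simp
qed

lemma Ck_on_has_derivative:
  assumes "Ck_on (Suc k) f S" "p \<in> S"
  shows "(f has_derivative (\<lambda>h. \<Sum>b\<in>Basis. (h \<bullet> b) * partial_deriv b f p)) (at p)"
proof -
  obtain f' where f': "(f has_derivative f') (at p)"
    using assms unfolding Ck_on.simps differentiable_def by blast
  interpret bounded_linear f' using f' by (rule has_derivative_bounded_linear)
  have "f' h = (\<Sum>b\<in>Basis. (h \<bullet> b) * partial_deriv b f p)" for h
  proof -
    have "f' h = f' (\<Sum>b\<in>Basis. (h \<bullet> b) *\<^sub>R b)" by (simp add: euclidean_representation)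
    also have "\<dots> = (\<Sum>b\<in>Basis. (h \<bullet> b) * f' b)" by (simp add: sum scaleR)
    finally show ?thesis using partial_deriv_eqI[OF f'] by simp
  qed
  then have "f' = (\<lambda>h. \<Sum>b\<in>Basis. (h \<bullet> b) * partial_deriv b f p)" by (rule ext)
  then show ?thesis using f' by simp
qed

lemma Ck_on_const [simp]: "Ck_on k (\<lambda>_. c) S"
proof (induction k arbitrary: c)
  case (Suc k)
  have "partial_deriv b (\<lambda>_::'a. c) = (\<lambda>_. 0)" for b by (auto simp: partial_deriv_def)
  then show ?case using Suc by simp
qed simp

lemma Ck_on_bounded_linear:
  assumes "bounded_linear f"
  shows "Ck_on k f S"
proof (cases k)
  case 0
  then show ?thesis using assms by (simp add: linear_continuous_on)
next
  case (Suc j)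
  have "Ck_on (Suc j) f UNIV"
    by (rule Ck_on_SucI[where f'="\<lambda>_. f"]) (auto simp: assms bounded_linear_imp_has_derivative)
  then show ?thesis using Suc Ck_on_subset by blast
qed

lemma Ck_on_add:
  assumes "open S" "Ck_on k f S" "Ck_on k g S"
  shows "Ck_on k (\<lambda>p. f p + g p) S"
  using assms(2,3)
proof (induction k arbitrary: f g)
  case (Suc k)
  show ?case
  proof (rule Ck_on_SucI[OF assms(1)])
    show "((\<lambda>p. f p + g p) has_derivative (\<lambda>h. (\<Sum>b\<in>Basis. (h \<bullet> b) * partial_deriv b f p) +
        (\<Sum>b\<in>Basis. (h \<bullet> b) * partial_deriv b g p))) (at p)" if "p \<in> S" for p
      using Ck_on_has_derivative[OF Suc.prems(1) that] Ck_on_has_derivative[OF Suc.prems(2) that]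
      by (rule has_derivative_add)
    show "Ck_on k (\<lambda>p. (\<Sum>c\<in>Basis. (b \<bullet> c) * partial_deriv c f p) +
        (\<Sum>c\<in>Basis. (b \<bullet> c) * partial_deriv c g p)) S" if "b \<in> Basis" for b
      \<comment> \<open>For a basis vector \<open>b\<close> the sums over \<open>Basis\<close>
        collapse to the single term \<open>c = b\<close>.\<close>
      using Suc.IH[of "partial_deriv b f" "partial_deriv b g"] Suc.prems that
      by (simp add: inner_Basis if_distrib[where f="\<lambda>x. x * _"] cong: if_cong)
  qed
qed (auto intro: continuous_intros)

lemma Ck_on_mult:
  assumes "open S" "Ck_on k f S" "Ck_on k g S"
  shows "Ck_on k (\<lambda>p. f p * g p) S"
  using assms(2,3)
proof (induction k arbitrary: f g)
  case (Suc k)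
  show ?case
  proof (rule Ck_on_SucI[OF assms(1)])
    show "((\<lambda>p. f p * g p) has_derivative (\<lambda>h. f p * (\<Sum>b\<in>Basis. (h \<bullet> b) * partial_deriv b g p) +
        (\<Sum>b\<in>Basis. (h \<bullet> b) * partial_deriv b f p) * g p)) (at p)" if "p \<in> S" for p
      using Ck_on_has_derivative[OF Suc.prems(1) that] Ck_on_has_derivative[OF Suc.prems(2) that]
      by (rule has_derivative_mult)
    show "Ck_on k (\<lambda>p. f p * (\<Sum>c\<in>Basis. (b \<bullet> c) * partial_deriv c g p) +
        (\<Sum>c\<in>Basis. (b \<bullet> c) * partial_deriv c f p) * g p) S" if "b \<in> Basis" for b
      using Suc.IH[of f "partial_deriv b g"] Suc.IH[of "partial_deriv b f" g] Suc.prems that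
        Ck_on_SucD[OF Suc.prems(1)]  Ck_on_SucD[OF Suc.prems(2)]
      by (simp add: inner_Basis if_distrib[where f="\<lambda>x. x * _"] Ck_on_add[OF assms(1)] cong: if_cong)
  qed
qed (auto intro: continuous_intros)

lemma Ck_on_sum:
  assumes "open S" "\<And>i. i \<in> I \<Longrightarrow> Ck_on k (f i) S"
  shows "Ck_on k (\<lambda>p. \<Sum>i\<in>I. f i p) S"
  using assms(2) by (induction I rule: infinite_finite_induct) (auto intro: Ck_on_add[OF assms(1)])

lemma Ck_on_uminus: "open S \<Longrightarrow> Ck_on k f S \<Longrightarrow> Ck_on k (\<lambda>p. - f p) S"
  using Ck_on_mult[of S k "\<lambda>_. -1" f] by simp

lemma Ck_on_diff: "open S \<Longrightarrow> Ck_on k f S \<Longrightarrow> Ck_on k g S \<Longrightarrow> Ck_on k (\<lambda>p. f p - g p) S"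
  using Ck_on_add[of S k f "\<lambda>p. - g p"] Ck_on_uminus[of S k g] by simp

lemma Ck_on_power: "open S \<Longrightarrow> Ck_on k f S \<Longrightarrow> Ck_on k (\<lambda>p. f p ^ n) S"
  by (induction n) (auto intro: Ck_on_mult)

lemma Ck_on_inner: "Ck_on k (\<lambda>p. p \<bullet> c) S"
  by (intro Ck_on_bounded_linear bounded_linear_inner_left)

text \<open>\<open>Ck_on\<close> speaks of real-valued functions, so the regularity of the inner map
  is expressed through its components. The chain rule writes each partial derivative as a sum of
  products of functions one order less regular, which is what the induction consumes.\<close>

lemma Ck_on_compose:
  fixes G :: "'a::euclidean_space \<Rightarrow> 'b::euclidean_space"
  assumes "open S" "\<And>c. c \<in> Basis \<Longrightarrow> Ck_on k (\<lambda>p. G p \<bullet> c) S" "G ` S \<subseteq> T" "Ck_on k f T"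
  shows "Ck_on k (\<lambda>p. f (G p)) S"
  using assms(2,4)
proof (induction k arbitrary: f)
  case 0
  have "continuous_on S (\<lambda>p. \<Sum>c\<in>Basis. (G p \<bullet> c) *\<^sub>R c)"
    using 0 by (intro continuous_on_sum continuous_on_scaleR continuous_on_const) auto
  then have "continuous_on S G" by (simp add: euclidean_representation)
  then show ?case using 0 assms(3) by (auto intro: continuous_on_compose2)
next
  case (Suc k)
  define dG where "dG p h = (\<Sum>c\<in>Basis. (\<Sum>b\<in>Basis. (h \<bullet> b) * partial_deriv b (\<lambda>p. G p \<bullet> c) p) *\<^sub>R c)" for p h
  have G': "(G has_derivative dG p) (at p)" if "p \<in> S" for p
  proof -
    have "((\<lambda>p. \<Sum>c\<in>Basis. (G p \<bullet> c) *\<^sub>R c) has_derivative dG p) (at p)"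
      unfolding dG_def
      by (intro has_derivative_sum has_derivative_scaleR_left Ck_on_has_derivative[OF _ that]) (use Suc in auto)
    then show ?thesis by (simp add: euclidean_representation)
  qed
  show ?case
  proof (rule Ck_on_SucI[OF assms(1)])
    show "((\<lambda>p. f (G p)) has_derivative (\<lambda>h. \<Sum>c\<in>Basis. (dG p h \<bullet> c) * partial_deriv c f (G p))) (at p)"
      if "p \<in> S" for p
      using diff_chain_at[OF G'[OF that] Ck_on_has_derivative[OF Suc.prems(2)], of ] assms(3) that
      by (auto simp: o_def)
    show "Ck_on k (\<lambda>p. \<Sum>c\<in>Basis. (dG p b \<bullet> c) * partial_deriv c f (G p)) S" if b: "b \<in> Basis" for b
    proof (rule Ck_on_sum[OF assms(1)])
      fix c :: 'b assume c: "c \<in> Basis"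
      have eq: "(\<lambda>p. dG p b \<bullet> c) = partial_deriv b (\<lambda>p. G p \<bullet> c)"
      proof
        fix p
        have "dG p b \<bullet> c = (\<Sum>d\<in>Basis. (b \<bullet> d) * partial_deriv d (\<lambda>p. G p \<bullet> c) p)"
          unfolding dG_def using c by (rule inner_sum_left_Basis)
        then show "dG p b \<bullet> c = partial_deriv b (\<lambda>p. G p \<bullet> c) p"
          using b by (simp add: inner_Basis if_distrib[where f="\<lambda>x. x * _"] cong: if_cong)
      qed
      have "Ck_on k (\<lambda>p. dG p b \<bullet> c) S"
        unfolding eq by (rule Ck_on_partial[OF Suc.prems(1)[OF c] b])
      moreover have "Ck_on k (\<lambda>p. partial_deriv c f (G p)) S"
        by (rule Suc.IH[OF Ck_on_SucD[OF Suc.prems(1)] Ck_on_partial[OF Suc.prems(2) c]])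
      ultimately show "Ck_on k (\<lambda>p. (dG p b \<bullet> c) * partial_deriv c f (G p)) S"
        by (rule Ck_on_mult[OF assms(1)])
    qed
  qed
qed

section \<open>Polynomials, powers of positive parts, products with compact support\<close>

lemma real_polynomial_function_Ck_on:
  assumes "real_polynomial_function f"
  shows "Ck_on k f UNIV"
  using assms by induction (auto intro: Ck_on_bounded_linear Ck_on_add Ck_on_mult)

lemma has_real_derivative_max0_power:
  fixes x :: real
  shows "((\<lambda>x. max 0 x ^ Suc (Suc n)) has_real_derivative real (Suc (Suc n)) * max 0 x ^ Suc n) (at x)"
proof -
  consider "x > 0" | "x < 0" | "x = 0" by linarith
  then show ?thesis
  proof cases
    case 1
    have "((\<lambda>x. x ^ Suc (Suc n)) has_real_derivative real (Suc (Suc n)) * max 0 x ^ Suc n) (at x)"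
      using DERIV_pow[of "Suc (Suc n)" x] 1 by (simp only: diff_Suc_Suc max.absorb2 less_imp_le) simp
    then show ?thesis
      by (rule has_field_derivative_transform_within_open[of _ _ _ "{0<..}"]) (use 1 in auto)
  next
    case 2
    then have "((\<lambda>x. 0) has_real_derivative real (Suc (Suc n)) * max 0 x ^ Suc n) (at x)"
      by simp
    then show ?thesis
      by (rule has_field_derivative_transform_within_open[of _ _ _ "{..<0}"]) (use 2 in auto)
  next
    case 3
    have "(\<lambda>h::real. max 0 h ^ Suc (Suc n) / h) \<midarrow>0\<rightarrow> 0"
    proof (rule Lim_null_comparison)
      show "\<forall>\<^sub>F h in at (0::real). norm (max 0 h ^ Suc (Suc n) / h) \<le> \<bar>h\<bar> ^ Suc n"
      proof (intro always_eventually allI)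
        fix h :: real
        show "norm (max 0 h ^ Suc (Suc n) / h) \<le> \<bar>h\<bar> ^ Suc n"
        proof (cases "h > 0")
          case False
          then have "norm (max 0 h ^ Suc (Suc n) / h) = 0" by (simp add: max.absorb1)
          then show ?thesis by (simp only: zero_le_power_abs)
        qed (simp add: max.absorb2)
      qed
      have "((\<lambda>h::real. \<bar>h\<bar> ^ Suc n) \<longlongrightarrow> \<bar>0\<bar> ^ Suc n) (at 0)" by (intro tendsto_intros)
      then show "((\<lambda>h::real. \<bar>h\<bar> ^ Suc n) \<longlongrightarrow> 0) (at 0)" by simp
    qed
    then show ?thesis using 3 by (simp add: DERIV_def)
  qed
qed

text \<open>Each differentiation lowers the exponent by one, and exponent one is still continuous;
  hence the condition \<open>k < n\<close>.\<close>

lemma Ck_on_max0_power: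
  assumes "open S" "Ck_on k f S" "k < n"
  shows "Ck_on k (\<lambda>p. max 0 (f p) ^ n) S"
  using assms(2,3)
proof (induction k arbitrary: n)
  case (Suc k)
  then obtain m where n: "n = Suc (Suc m)" by (cases n; cases "n - 1") auto
  show ?case unfolding n
  proof (rule Ck_on_SucI[OF assms(1)])
    show "((\<lambda>p. max 0 (f p) ^ Suc (Suc m)) has_derivative
        (\<lambda>h. (\<Sum>b\<in>Basis. (h \<bullet> b) * partial_deriv b f p) * (real (Suc (Suc m)) * max 0 (f p) ^ Suc m))) (at p)"
      if "p \<in> S" for p
      using has_derivative_compose[OF Ck_on_has_derivative[OF Suc.prems(1) that]
          has_real_derivative_max0_power[of m "f p", unfolded has_field_derivative_def]]
      by (simp add: mult.commute)
    show "Ck_on k (\<lambda>p. (\<Sum>c\<in>Basis. (b \<bullet> c) * partial_deriv c f p) * (real (Suc (Suc m)) * max 0 (f p) ^ Suc m)) S"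
      if "b \<in> Basis" for b
    proof (intro Ck_on_mult assms(1) Ck_on_const)
      show "Ck_on k (\<lambda>p. \<Sum>c\<in>Basis. (b \<bullet> c) * partial_deriv c f p) S"
        using Suc.prems that by (simp add: inner_Basis if_distrib[where f="\<lambda>x. x * _"] cong: if_cong)
      show "Ck_on k (\<lambda>p. max 0 (f p) ^ Suc m) S"
        using Suc.prems n by (intro Suc.IH[OF Ck_on_SucD[OF Suc.prems(1)]]) auto
    qed
  qed
qed (auto intro!: continuous_intros)

text \<open>Lets a weight supported in \<open>C\<close> multiply a function known only on
  \<open>U\<close>: at points of \<open>C\<close> both factors are regular, and off the closed set
  \<open>C\<close> the product is locally zero whatever \<open>f\<close> is there.\<close>

lemma Ck_on_mult_support:
  assumes "closed C" "C \<subseteq> U" "open U" "open V" "Ck_on k w V" "Ck_on k f U" "\<And>p. p \<notin> C \<Longrightarrow> w p = 0"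
  shows "Ck_on k (\<lambda>p. w p * f p) V"
proof (rule Ck_on_local)
  fix p assume p: "p \<in> V"
  show "\<exists>W. open W \<and> p \<in> W \<and> Ck_on k (\<lambda>p. w p * f p) W"
  proof (cases "p \<in> C")
    case True
    then have "Ck_on k (\<lambda>p. w p * f p) (U \<inter> V)"
      using assms by (intro Ck_on_mult) (auto intro: Ck_on_subset)
    then show ?thesis using assms True p by blast
  next
    case False
    have "Ck_on k (\<lambda>p. w p * f p) (- C)"
      using assms by (intro Ck_on_cong[OF _ Ck_on_const[of k 0]]) auto
    then show ?thesis using False assms(1) by blast
  qed
qed

section \<open>Integrals depending on a parameter\<close>

lemma continuous_on_compact_abs_bound:
  fixes f :: "'a::topological_space \<Rightarrow> real"
  assumes "compact C" "continuous_on C f"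
  obtains B where "B \<ge> 0" "\<And>x. x \<in> C \<Longrightarrow> \<bar>f x\<bar> \<le> B"
proof -
  have "bounded (f ` C)" using assms compact_continuous_image compact_imp_bounded by blast
  then obtain B where B: "\<forall>x\<in>f ` C. norm x \<le> B" unfolding bounded_iff by blast
  show thesis by (rule that[of "max 0 B"]) (use B in \<open>auto intro: max.coboundedI2\<close>)
qed

text \<open>Dominated convergence for a continuous parameter, reduced to sequences. The bound is
  required only away from \<open>a\<close>, which suits difference quotients.\<close>

lemma tendsto_integral_dominated:
  fixes s :: "'a::metric_space \<Rightarrow> 'b \<Rightarrow> real"
  assumes "f \<in> borel_measurable M" "\<And>x. x \<in> S \<Longrightarrow> s x \<in> borel_measurable M" "integrable M w"
    "\<And>x b. x \<in> S \<Longrightarrow> x \<noteq> a \<Longrightarrow> \<bar>s x b\<bar> \<le> w b"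
    "\<And>b. ((\<lambda>x. s x b) \<longlongrightarrow> f b) (at a within S)"
  shows "((\<lambda>x. integral\<^sup>L M (s x)) \<longlongrightarrow> integral\<^sup>L M f) (at a within S)"
  unfolding tendsto_at_iff_sequentially o_def
proof (intro allI impI)
  fix X assume X: "\<forall>i. X i \<in> S - {a}" "X \<longlonglongrightarrow> a"
  show "(\<lambda>n. integral\<^sup>L M (s (X n))) \<longlonglongrightarrow> integral\<^sup>L M f"
  proof (rule integral_dominated_convergence[where w=w])
    show "AE b in M. (\<lambda>n. s (X n) b) \<longlonglongrightarrow> f b"
      using assms(5) X unfolding tendsto_at_iff_sequentially o_def by auto
  qed (use assms X in auto)
qed

lemma integrable_bounded_compact:
  fixes f :: "'a::euclidean_space \<Rightarrow> real"
  assumes "compact C" "f \<in> borel_measurable borel" "\<And>x. x \<in> C \<Longrightarrow> \<bar>f x\<bar> \<le> B" "\<And>x. x \<notin> C \<Longrightarrow> f x = 0"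
  shows "integrable lborel f"
  using assms emeasure_compact_finite[OF assms(1)]
  by (intro integrableI_bounded_set[where A=C and B=B]) (auto simp: less_top borel_compact)

lemma borel_measurable_mult_support:
  fixes w f :: "'a::euclidean_space \<Rightarrow> real"
  assumes "compact C" "w \<in> borel_measurable borel" "\<And>x. x \<notin> C \<Longrightarrow> w x = 0" "continuous_on C f"
  shows "(\<lambda>x. w x * f x) \<in> borel_measurable borel"
proof -
  have "(\<lambda>x. indicator C x *\<^sub>R f x) \<in> borel_measurable borel"
    using assms by (intro borel_measurable_continuous_on_indicator) (auto simp: borel_compact)
  then have "(\<lambda>x. w x * (indicator C x *\<^sub>R f x)) \<in> borel_measurable borel"
    using assms(2) by (intro borel_measurable_times)
  moreover have "(\<lambda>x. w x * (indicator C x *\<^sub>R f x)) = (\<lambda>x. w x * f x)"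
    using assms(3) by (fastforce simp: indicator_def)
  ultimately show ?thesis by simp
qed

lemma integrable_mult_support:
  fixes w f :: "'a::euclidean_space \<Rightarrow> real"
  assumes "compact C" "w \<in> borel_measurable borel" "\<And>x. \<bar>w x\<bar> \<le> B" "\<And>x. x \<notin> C \<Longrightarrow> w x = 0"
    "continuous_on C f"
  shows "integrable lborel (\<lambda>x. w x * f x)"
proof -
  obtain M where M: "\<And>x. x \<in> C \<Longrightarrow> \<bar>f x\<bar> \<le> M"
    using continuous_on_compact_abs_bound[OF assms(1,5)] by blast
  show ?thesis
  proof (rule integrable_bounded_compact[OF assms(1)])
    show "\<bar>w x * f x\<bar> \<le> B * M" if "x \<in> C" for x
      unfolding abs_mult using assms(3)[of x] M[OF that] by (intro mult_mono) auto
  qed (use borel_measurable_mult_support assms in auto)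
qed

lemma integral_pos_if_pos_on_open:
  fixes f :: "'a::euclidean_space \<Rightarrow> real"
  assumes i: "integrable lborel f" and nn: "\<And>x. f x \<ge> 0"
    and S: "open S" "S \<noteq> {}" "\<And>x. x \<in> S \<Longrightarrow> f x > 0"
  shows "(\<integral>x. f x \<partial>lborel) > 0"
proof -
  have n: "(\<integral>x. f x \<partial>lborel) \<ge> 0" by (intro integral_nonneg_AE AE_I2 nn)
  have "(\<integral>x. f x \<partial>lborel) \<noteq> 0"
  proof
    assume "(\<integral>x. f x \<partial>lborel) = 0"
    then have "AE x in lborel. f x = 0"
      using integral_nonneg_eq_0_iff_AE[OF i] by (simp add: nn)
    then have "AE x in lborel. x \<notin> S" by (elim AE_mp) (use S(3) in force)
    then have "S \<in> null_sets lborel" using S by (subst (asm) AE_iff_null_sets[symmetric]) auto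
    then have "negligible S" using negligible_iff_null_sets null_sets_completionI by blast
    then show False using open_not_negligible S by blast
  qed
  with n show ?thesis by simp
qed

text \<open>The weight \<open>w\<close> is only bounded, measurable and compactly supported; all
  regularity sits in the integrand. The locale is used both ways round: with a kernel as weight and
  a regular function moved by the parameter, and with a rough function as weight and the moved
  kernel as integrand.\<close>

locale parametric_integral =
  fixes U :: "'a::euclidean_space set" and V :: "('a \<times> 'b::euclidean_space) set"
    and C :: "'b set" and w :: "'b \<Rightarrow> real" and B :: real
  assumes U: "open U" and C: "compact C" and w: "w \<in> borel_measurable borel"
    and B: "\<And>b. \<bar>w b\<bar> \<le> B" and w0: "\<And>b. b \<notin> C \<Longrightarrow> w b = 0"
    and V: "open V" "U \<times> C \<subseteq> V"
begin

lemma bounded_on_cball: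
  assumes "continuous_on V f" "cball q r \<subseteq> U"
  obtains M where "M \<ge> 0" "\<And>p b. p \<in> cball q r \<Longrightarrow> b \<in> C \<Longrightarrow> \<bar>f (p, b)\<bar> \<le> (M::real)"
proof -
  have "compact (cball q r \<times> C)" "continuous_on (cball q r \<times> C) f"
    using assms V C by (auto intro!: compact_Times intro: continuous_on_subset)
  from continuous_on_compact_abs_bound[OF this] obtain M
    where "M \<ge> 0" "\<And>x. x \<in> cball q r \<times> C \<Longrightarrow> \<bar>f x\<bar> \<le> M" by blast
  then show thesis by (intro that[of M]) auto
qed

lemma continuous_section:
  assumes "continuous_on V f" "q \<in> U"
  shows "continuous_on C (\<lambda>b. f (q, b))"
  using assms V by (intro continuous_on_compose2[OF assms(1)] continuous_intros) auto

lemma measurable_section: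
  assumes "continuous_on V f" "q \<in> U"
  shows "(\<lambda>b. w b * f (q, b)) \<in> borel_measurable borel"
  using borel_measurable_mult_support[OF C w w0 continuous_section[OF assms]] by simp

lemma integrable_section:
  assumes "continuous_on V f" "q \<in> U"
  shows "integrable lborel (\<lambda>b. w b * f (q, b))"
  using integrable_mult_support[OF C w B w0 continuous_section[OF assms]] by simp

lemma B_nonneg: "B \<ge> 0" using B abs_ge_zero order_trans by blast

lemma integrable_const: "integrable lborel (\<lambda>b. indicator C b * (k::real))"
proof (rule integrable_bounded_compact[OF C, of _ "\<bar>k\<bar>"])
  have "C \<in> sets borel" using C by (rule borel_compact)
  then show "(\<lambda>b. indicator C b * k) \<in> borel_measurable borel" by measurable
qed auto

lemma continuous_integral:
  assumes "continuous_on V F"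
  shows "continuous_on U (\<lambda>q. \<integral>b. w b * F (q, b) \<partial>lborel)"
proof (intro continuous_at_imp_continuous_on ballI)
  fix q assume q: "q \<in> U"
  then obtain r where r: "r > 0" "cball q r \<subseteq> U" using U open_contains_cball by blast
  obtain M where M: "M \<ge> 0" "\<And>p b. p \<in> cball q r \<Longrightarrow> b \<in> C \<Longrightarrow> \<bar>F (p, b)\<bar> \<le> M"
    using bounded_on_cball[OF assms r(2)] by blast
  have "((\<lambda>p. \<integral>b. w b * F (p, b) \<partial>lborel) \<longlongrightarrow> (\<integral>b. w b * F (q, b) \<partial>lborel)) (at q within cball q r)"
  proof (rule tendsto_integral_dominated[where w="\<lambda>b. indicator C b * (B * M)"])
    show "\<bar>w b * F (p, b)\<bar> \<le> indicator C b * (B * M)" if "p \<in> cball q r" for p b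
      using B[of b] M(2)[OF that, of b] w0[of b] B_nonneg by (cases "b \<in> C") (auto simp: abs_mult intro!: mult_mono)
    show "((\<lambda>p. w b * F (p, b)) \<longlongrightarrow> w b * F (q, b)) (at q within cball q r)" for b
    proof (cases "b \<in> C")
      case True
      have "continuous_on (cball q r) (\<lambda>p. w b * F (p, b))"
        using True V r by (intro continuous_intros continuous_on_compose2[OF assms]) auto
      then show ?thesis using r(1) by (auto simp: continuous_on_def)
    qed (simp add: w0)
  qed (use measurable_section[OF assms] q r integrable_const in auto)
  moreover have "at q within cball q r = at q" using r(1) by (intro at_within_interior) auto
  ultimately show "isCont (\<lambda>q. \<integral>b. w b * F (q, b) \<partial>lborel) q" by (simp add: isCont_def)
qed

lemma has_derivative_integral:
  assumes F: "Ck_on 1 F V" and q: "q \<in> U"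
  shows "((\<lambda>q. \<integral>b. w b * F (q, b) \<partial>lborel) has_derivative
    (\<lambda>h. \<Sum>c\<in>Basis. (h \<bullet> c) * (\<integral>b. w b * partial_deriv (c, 0) F (q, b) \<partial>lborel))) (at q)"
proof -
  obtain r where r: "r > 0" "cball q r \<subseteq> U" using U q open_contains_cball by blast
  have cF: "continuous_on V F" using F Ck_on_continuous by blast
  have cdF: "continuous_on V (partial_deriv (c, 0) F)" if "c \<in> Basis" for c
    using F that by (auto simp: Basis_prod_def)
  have "\<exists>M. M \<ge> 0 \<and> (\<forall>p\<in>cball q r. \<forall>b\<in>C. \<bar>partial_deriv (c, 0) F (p, b)\<bar> \<le> M)" if "c \<in> Basis" for c
    using bounded_on_cball[OF cdF[OF that] r(2)] by metis
  then obtain m where m: "\<And>c. c \<in> Basis \<Longrightarrow> m c \<ge> 0"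
    "\<And>c p b. c \<in> Basis \<Longrightarrow> p \<in> cball q r \<Longrightarrow> b \<in> C \<Longrightarrow> \<bar>partial_deriv (c, 0) F (p, b)\<bar> \<le> m c"
    by metis
  \<comment> \<open>Common Lipschitz constant in \<open>p\<close> of all \<open>F (p, b)\<close>,
    over the closed ball and \<open>b\<close> in \<open>C\<close>.\<close>
  define L where "L = (\<Sum>c\<in>Basis. m c)"
  have L0: "L \<ge> 0" unfolding L_def using m by (intro sum_nonneg)
  define D where "D p b h = (\<Sum>c\<in>Basis. (h \<bullet> c) * partial_deriv (c, 0) F (p, b))" for p b h
  have D: "((\<lambda>p. F (p, b)) has_derivative D p b) (at p)" if "p \<in> U" "b \<in> C" for p b
  proof -
    have l: "((\<lambda>p. (p, b)) has_derivative (\<lambda>h. (h, 0))) (at p)"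
      by (auto intro!: derivative_eq_intros)
    have "(p, b) \<in> V" using V that by auto
    from Ck_on_has_derivative[OF F[unfolded One_nat_def] this] have
      "((\<lambda>p. F (p, b)) has_derivative (\<lambda>h. \<Sum>c\<in>Basis. ((h, 0) \<bullet> c) * partial_deriv c F (p, b))) (at p)"
      using diff_chain_at[OF l] by (auto simp: o_def)
    moreover have "(\<Sum>c\<in>Basis. ((h, 0) \<bullet> c) * partial_deriv c F (p, b)) = D p b h" for h
      unfolding Basis_prod_def D_def
      by (subst sum.union_disjoint) (auto simp: sum.reindex inj_on_def)
    ultimately show ?thesis by simp
  qed
  have Dle: "\<bar>D p b h\<bar> \<le> L * norm h" if "p \<in> cball q r" "b \<in> C" for p b h
  proof -
    have "\<bar>D p b h\<bar> \<le> (\<Sum>c\<in>Basis. \<bar>h \<bullet> c\<bar> * \<bar>partial_deriv (c, 0) F (p, b)\<bar>)"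
      unfolding D_def using sum_abs[of "\<lambda>c. (h \<bullet> c) * partial_deriv (c, 0) F (p, b)"] by (simp add: abs_mult)
    also have "\<dots> \<le> (\<Sum>c\<in>Basis. norm h * m c)"
      using m that by (intro sum_mono mult_mono) (auto simp: Basis_le_norm)
    finally show ?thesis by (simp add: L_def sum_distrib_left mult.commute)
  qed
  have Fle: "\<bar>F (p, b) - F (q, b)\<bar> \<le> L * norm (p - q)" if "p \<in> cball q r" "b \<in> C" for p b
  proof -
    have "norm (F (p, b) - F (q, b)) \<le> L * norm (p - q)"
    proof (rule differentiable_bound[of "cball q r" "\<lambda>p. F (p, b)" "\<lambda>p. D p b"])
      show "((\<lambda>p. F (p, b)) has_derivative D p b) (at p within cball q r)" if "p \<in> cball q r" for p
        using D[of p b] that r \<open>b \<in> C\<close> has_derivative_at_withinI by blast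
      show "onorm (D p b) \<le> L" if "p \<in> cball q r" for p
        using Dle[OF that \<open>b \<in> C\<close>] by (intro onorm_bound) (auto simp: L0 )
    qed (use that r in auto)
    then show ?thesis by simp
  qed
  let ?G = "\<lambda>q. \<integral>b. w b * F (q, b) \<partial>lborel"
  let ?G' = "\<lambda>h. \<Sum>c\<in>Basis. (h \<bullet> c) * (\<integral>b. w b * partial_deriv (c, 0) F (q, b) \<partial>lborel)"
  have G': "?G' h = (\<integral>b. w b * D q b h \<partial>lborel)" for h
  proof -
    have "(\<integral>b. w b * D q b h \<partial>lborel) = (\<integral>b. (\<Sum>c\<in>Basis. (h \<bullet> c) * (w b * partial_deriv (c, 0) F (q, b))) \<partial>lborel)"
      unfolding D_def by (simp add: sum_distrib_left mult.left_commute)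
    also have "\<dots> = ?G' h"
      using integrable_section[OF cdF q] by (subst Bochner_Integration.integral_sum) auto
    finally show ?thesis by simp
  qed
  have iD: "integrable lborel (\<lambda>b. w b * D q b h)" for h
  proof -
    have "integrable lborel (\<lambda>b. \<Sum>c\<in>Basis. (h \<bullet> c) * (w b * partial_deriv (c, 0) F (q, b)))"
      using integrable_section[OF cdF q] by auto
    then show ?thesis unfolding D_def by (simp add: sum_distrib_left mult.left_commute)
  qed
  \<comment> \<open>Remainder quotient of \<open>F\<close> before integration. It tends to 0
    pointwise and is bounded by a constant on \<open>C\<close>, so by dominated convergence the
    remainder quotient of the integral tends to 0.\<close>
  let ?s = "\<lambda>p b. w b * (F (p, b) - F (q, b) - D q b (p - q)) / norm (p - q)"
  have lim: "((\<lambda>p. integral\<^sup>L lborel (?s p)) \<longlongrightarrow> integral\<^sup>L lborel (\<lambda>b::'b. 0)) (at q within cball q r)"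
  proof (rule tendsto_integral_dominated[where w="\<lambda>b. indicator C b * (B * (2 * L))"])
    fix p b assume p: "p \<in> cball q r" "p \<noteq> q"
    show "\<bar>?s p b\<bar> \<le> indicator C b * (B * (2 * L))"
    proof (cases "b \<in> C")
      case True
      have "\<bar>F (p, b) - F (q, b) - D q b (p - q)\<bar> \<le> 2 * L * norm (p - q)"
        using Fle[OF p(1) True] Dle[of q b "p - q"] True r by auto
      then have "\<bar>w b\<bar> * \<bar>F (p, b) - F (q, b) - D q b (p - q)\<bar> \<le> B * (2 * L * norm (p - q))"
        using B[of b] B_nonneg by (intro mult_mono) auto
      then have "\<bar>w b * (F (p, b) - F (q, b) - D q b (p - q))\<bar> \<le> B * (2 * L) * norm (p - q)"
        by (simp only: abs_mult mult.assoc)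
      then show ?thesis using p True by (simp add: divide_le_eq)
    qed (simp add: w0)
  next
    fix b
    show "((\<lambda>p. ?s p b) \<longlongrightarrow> 0) (at q within cball q r)"
    proof (cases "b \<in> C")
      case True
      have "((\<lambda>p. (F (p, b) - F (q, b) - D q b (p - q)) / norm (p - q)) \<longlongrightarrow> 0) (at q within cball q r)"
        using has_derivative_at_withinI[OF D[OF q True], of "cball q r"]
        by (simp add: has_derivative_within divide_inverse mult.commute diff_diff_eq)
      from tendsto_mult_left[OF this, of "w b"] show ?thesis by (simp add: )
    qed (simp add: w0)
  next
    fix p assume "p \<in> cball q r"
    then have "p \<in> U" using r by auto
    have "?s p = (\<lambda>b. (w b * F (p, b) - w b * F (q, b) - w b * D q b (p - q)) / norm (p - q))"
      by (auto simp: algebra_simps)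
    moreover have "\<dots> \<in> borel_measurable lborel"
      using measurable_section[OF cF \<open>p \<in> U\<close>] measurable_section[OF cF q] iD[of "p - q"]
      by (intro borel_measurable_divide borel_measurable_diff) auto
    ultimately show "?s p \<in> borel_measurable lborel" by simp
  qed (use integrable_const in auto)
  have "integral\<^sup>L lborel (?s p) = (?G p - ?G q - ?G' (p - q)) / norm (p - q)" if "p \<in> cball q r" for p
  proof -
    have "p \<in> U" using r that by auto
    have "?s p = (\<lambda>b. (w b * F (p, b) - w b * F (q, b) - w b * D q b (p - q)) / norm (p - q))"
      by (auto simp: algebra_simps)
    then show ?thesis unfolding G'
      using integrable_section[OF cF \<open>p \<in> U\<close>] integrable_section[OF cF q] iD[of "p - q"] by simp
  qed
  then have ev: "\<forall>\<^sub>F p in at q within cball q r. integral\<^sup>L lborel (?s p) = (?G p - ?G q - ?G' (p - q)) / norm (p - q)"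
    unfolding eventually_at_filter by (intro always_eventually allI impI)
  have "((\<lambda>p. (?G p - ?G q - ?G' (p - q)) / norm (p - q)) \<longlongrightarrow> 0) (at q within cball q r)"
    using lim unfolding tendsto_cong[OF ev] by simp
  moreover have "at q within cball q r = at q" using r(1) by (intro at_within_interior) auto
  moreover have "bounded_linear ?G'"
    by (intro bounded_linear_sum bounded_linear_mult_const bounded_linear_inner_left)
  ultimately show ?thesis by (simp add: has_derivative_at_within has_derivative_within divide_inverse mult.commute)
qed

end

lemma Ck_on_parametric_integral:
  assumes "parametric_integral U V C w B" "Ck_on k F V"
  shows "Ck_on k (\<lambda>q. \<integral>b. w b * F (q, b) \<partial>lborel) U"
  using assms(2)
proof (induction k arbitrary: F)
  case 0
  then show ?case using parametric_integral.continuous_integral[OF assms(1)] by simp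
next
  case (Suc k)
  interpret parametric_integral U V C w B by (rule assms(1))
  show ?case
  proof (rule Ck_on_SucI[OF U])
    show "((\<lambda>q. \<integral>b. w b * F (q, b) \<partial>lborel) has_derivative
      (\<lambda>h. \<Sum>c\<in>Basis. (h \<bullet> c) * (\<integral>b. w b * partial_deriv (c, 0) F (q, b) \<partial>lborel))) (at q)" if "q \<in> U" for q
      using that Suc.prems by (intro has_derivative_integral) (auto intro: Ck_on_mono simp del: Ck_on.simps)
    fix b :: 'a assume b: "b \<in> Basis"
    then have "Ck_on k (partial_deriv (b, 0) F) V"
      by (intro Ck_on_partial[OF Suc.prems]) (auto simp: Basis_prod_def)
    from Suc.IH[OF this] b
    show "Ck_on k (\<lambda>q. \<Sum>c\<in>Basis. (b \<bullet> c) * (\<integral>x. w x * partial_deriv (c, 0) F (q, x) \<partial>lborel)) U"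
      by (simp add: inner_Basis if_distrib[where f="\<lambda>x. x * _"] cong: if_cong)
  qed
qed

lemma partial_deriv_parametric_integral:
  assumes "parametric_integral U V C w B" "Ck_on 1 F V" "q \<in> U" "c \<in> Basis"
  shows "partial_deriv c (\<lambda>q. \<integral>b. w b * F (q, b) \<partial>lborel) q = (\<integral>b. w b * partial_deriv (c, 0) F (q, b) \<partial>lborel)"
  using partial_deriv_eqI[OF parametric_integral.has_derivative_integral[OF assms(1-3)], of c] assms(4)
  by (simp add: inner_Basis if_distrib[where f="\<lambda>x. x * _"] cong: if_cong)

text \<open>Translating \<open>f\<close> along \<open>b\<close> leaves its integral unchanged;
  differentiating that constant in the translation parameter, under the integral sign, gives the
  claim.\<close>

lemma integral_partial_deriv_eq_0:
  fixes f :: "'a::euclidean_space \<Rightarrow> real"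
  assumes f: "Ck_on 1 f UNIV" and C: "compact C" "\<And>p. p \<notin> C \<Longrightarrow> f p = 0" and b: "b \<in> Basis"
  shows "(\<integral>p. partial_deriv b f p \<partial>lborel) = 0"
proof -
  obtain R where R: "\<And>p. p \<in> C \<Longrightarrow> norm p \<le> R"
    using compact_imp_bounded[OF C(1)] bounded_iff by metis
  \<comment> \<open>Radius enlarged by 1, so that translations with \<open>t\<close> in (-1, 1)
    along a unit vector keep the support inside.\<close>
  define C' where "C' = cball (0::'a) (R + 1)"
  define F where "F = (\<lambda>(t::real, p). f (p + t *\<^sub>R b))"
  define w where "w = (\<lambda>p. indicator C' p :: real)"
  have F: "Ck_on 1 F UNIV"
    unfolding F_def case_prod_beta
    by (rule Ck_on_compose[OF _ _ _ f]) (auto simp: inner_left_distrib intro!: Ck_on_bounded_linear bounded_linear_intros simp del: Ck_on.simps)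
  have pi: "parametric_integral {-1<..<1::real} (UNIV :: (real \<times> 'a) set) C' w 1"
    by unfold_locales (auto simp: w_def C'_def indicator_def)
  have dF: "partial_deriv (1, 0) F (0, p) = partial_deriv b f p" for p
    unfolding partial_deriv_def F_def by simp
  have df: "partial_deriv b f p = 0" if "p \<notin> C" for p
    using partial_deriv_cong[of "- C" p f "\<lambda>_. 0" b] that C open_Compl[OF compact_imp_closed[OF C(1)]]
    by (simp add: partial_deriv_def)
  have "(\<integral>p. w p * F (t, p) \<partial>lborel) = (\<integral>p. f p \<partial>lborel)" if "t \<in> {-1<..<1}" for t
  proof -
    have "w p * F (t, p) = f (p + t *\<^sub>R b)" for p
    proof (cases "p \<in> C'")
      case False
      have "norm p \<le> norm (p + t *\<^sub>R b) + norm (t *\<^sub>R b)"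
        by (metis add_diff_cancel_right' norm_triangle_ineq4)
      also have "norm (t *\<^sub>R b) \<le> 1" using that b by auto
      finally have "norm (p + t *\<^sub>R b) > R" using False by (auto simp: C'_def)
      then show ?thesis using R C(2) False by (fastforce simp: w_def)
    qed (auto simp: w_def F_def)
    then have "(\<integral>p. w p * F (t, p) \<partial>lborel) = (\<integral>p. f (p + t *\<^sub>R b) \<partial>lborel)" by simp
    also have "\<dots> = (\<integral>p. f p \<partial>distr lborel borel ((+) (t *\<^sub>R b)))"
      using Ck_on_continuous[OF f] by (subst integral_distr) (auto simp: add.commute intro: borel_measurable_continuous_onI)
    finally show ?thesis by (simp add: lborel_distr_plus)
  qed
  then have "partial_deriv 1 (\<lambda>t. \<integral>p. w p * F (t, p) \<partial>lborel) 0 = partial_deriv 1 (\<lambda>_. \<integral>p. f p \<partial>lborel) (0::real)"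
    by (intro partial_deriv_cong[of "{-1<..<1}"]) auto
  then have "0 = (\<integral>p. w p * partial_deriv b f p \<partial>lborel)"
    by (subst (asm) partial_deriv_parametric_integral[OF pi F]) (simp_all add: dF, simp add: partial_deriv_def)
  moreover have "w p * partial_deriv b f p = partial_deriv b f p" for p
    using df[of p] R[of p] by (cases "p \<in> C") (auto simp: w_def C'_def indicator_def)
  ultimately show ?thesis by simp
qed

section \<open>Translations and dilations\<close>

text \<open>The automorphic dilations: the centre has weight two, so that they respect the group law
  and scale the gauge by |t|.\<close>

definition heis_dil :: "real \<Rightarrow> heis \<Rightarrow> heis" where
  "heis_dil t = (\<lambda>(x, y, z). (t * x, t * y, t\<^sup>2 * z))"

lemma heis_dil_simp [simp]: "heis_dil t (x, y, z) = (t * x, t * y, t\<^sup>2 * z)"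
  by (simp add: heis_dil_def)

lemma heis_mult_def: "heis_mult q p = (fst q + fst p, fst (snd q) + fst (snd p),
    snd (snd q) + snd (snd p) + (1/2) * (fst q * fst (snd p) - fst (snd q) * fst p))"
  by (cases q; cases p) simp

lemma heis_dil_def': "heis_dil t p = (t * fst p, t * fst (snd p), t\<^sup>2 * snd (snd p))"
  by (cases p) simp

lemma heis_dil_dil: "heis_dil s (heis_dil t p) = heis_dil (s * t) p"
  by (cases p) (simp add: power_mult_distrib)

lemma heis_dil_0 [simp]: "heis_dil 0 p = (0, 0, 0)"
  and heis_dil_1 [simp]: "heis_dil 1 p = p"
  by (cases p; simp)+

lemma heis_mult_inv_cancel [simp]: "heis_mult (heis_inv q) (heis_mult q p) = p"
  "heis_mult q (heis_mult (heis_inv q) p) = p"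
  by (simp_all add: heis_mult_assoc[symmetric] heis_mult_inv_left heis_mult_inv_right heis_mult_zero_left)

lemma continuous_on_heis_mult [continuous_intros]:
  "continuous_on S f \<Longrightarrow> continuous_on S g \<Longrightarrow> continuous_on S (\<lambda>x. heis_mult (f x) (g x))"
  unfolding heis_mult_def by (intro continuous_intros)

lemma continuous_on_heis_dil [continuous_intros]:
  "continuous_on S f \<Longrightarrow> continuous_on S g \<Longrightarrow> continuous_on S (\<lambda>x. heis_dil (f x) (g x))"
  unfolding heis_dil_def' by (intro continuous_intros)

lemma borel_measurable_heis_mult_dil [measurable]:
  "(\<lambda>p. heis_mult q (heis_dil t p)) \<in> borel_measurable borel"
  by (intro borel_measurable_continuous_onI continuous_intros)

lemma nn_integral_lborel_heis:
  assumes [measurable]: "f \<in> borel_measurable borel"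
  shows "(\<integral>\<^sup>+p. f p \<partial>(lborel :: heis measure)) =
    (\<integral>\<^sup>+x. \<integral>\<^sup>+y. \<integral>\<^sup>+z. f (x, y, z) \<partial>lborel \<partial>lborel \<partial>lborel)"
proof -
  have "(\<integral>\<^sup>+x. \<integral>\<^sup>+p. f (x, p) \<partial>lborel \<partial>lborel) = integral\<^sup>N (lborel \<Otimes>\<^sub>M lborel) f"
    by (rule lborel.nn_integral_fst) (simp add: lborel_prod)
  moreover have "(\<integral>\<^sup>+y. \<integral>\<^sup>+z. f (x, y, z) \<partial>lborel \<partial>lborel) = integral\<^sup>N (lborel \<Otimes>\<^sub>M lborel) (\<lambda>p. f (x, p))" for x
    using lborel.nn_integral_fst[of "\<lambda>p. f (x, p)" lborel] by (simp add: lborel_prod)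
  ultimately show ?thesis by (simp add: lborel_prod)
qed

text \<open>The substitution is upper triangular in the coordinates, so it reduces to three
  one-dimensional affine ones.\<close>

lemma nn_integral_heis_mult_dil:
  assumes [measurable]: "f \<in> borel_measurable borel" and t: "t \<noteq> 0"
  shows "(\<integral>\<^sup>+p. f p \<partial>lborel) = ennreal (t ^ 4) * (\<integral>\<^sup>+p. f (heis_mult q (heis_dil t p)) \<partial>lborel)"
proof -
  obtain a b c where q: "q = (a, b, c)" by (cases q)
  have "(\<integral>\<^sup>+p. f p \<partial>lborel) = (\<integral>\<^sup>+x. \<integral>\<^sup>+y. \<integral>\<^sup>+z. f (x, y, z) \<partial>lborel \<partial>lborel \<partial>lborel)"
    by (rule nn_integral_lborel_heis) simp
  also have "\<dots> = ennreal \<bar>t\<bar> * (\<integral>\<^sup>+x. \<integral>\<^sup>+y. \<integral>\<^sup>+z. f (a + t * x, y, z) \<partial>lborel \<partial>lborel \<partial>lborel)"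
    by (subst nn_integral_real_affine[OF _ t, of _ a]) simp_all
  also have "\<dots> = ennreal \<bar>t\<bar> * (\<integral>\<^sup>+x. ennreal \<bar>t\<bar> * (\<integral>\<^sup>+y. \<integral>\<^sup>+z. f (a + t * x, b + t * y, z) \<partial>lborel \<partial>lborel) \<partial>lborel)"
    by (subst nn_integral_real_affine[OF _ t, of _ b]) simp_all
  also have "\<dots> = ennreal \<bar>t\<bar> * (\<integral>\<^sup>+x. ennreal \<bar>t\<bar> * (\<integral>\<^sup>+y. ennreal \<bar>t\<^sup>2\<bar> *
      (\<integral>\<^sup>+z. f (a + t * x, b + t * y, (c + (1/2) * (a * (t * y) - b * (t * x))) + t\<^sup>2 * z) \<partial>lborel) \<partial>lborel) \<partial>lborel)"
  proof -
    have "(\<integral>\<^sup>+z. f (x', y', z) \<partial>lborel) = ennreal \<bar>t\<^sup>2\<bar> * (\<integral>\<^sup>+z. f (x', y', d + t\<^sup>2 * z) \<partial>lborel)" for x' y' d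
      using t by (intro nn_integral_real_affine) simp_all
    then show ?thesis by (intro arg_cong2[where f="(*)"] refl nn_integral_cong)
  qed
  also have "\<dots> = ennreal \<bar>t\<bar> * (ennreal \<bar>t\<bar> * (ennreal \<bar>t\<^sup>2\<bar> * (\<integral>\<^sup>+x. \<integral>\<^sup>+y. \<integral>\<^sup>+z.
      f (a + t * x, b + t * y, (c + (1/2) * (a * (t * y) - b * (t * x))) + t\<^sup>2 * z) \<partial>lborel \<partial>lborel \<partial>lborel)))"
    by (simp add: nn_integral_cmult)
  also have "(\<integral>\<^sup>+x. \<integral>\<^sup>+y. \<integral>\<^sup>+z.
      f (a + t * x, b + t * y, (c + (1/2) * (a * (t * y) - b * (t * x))) + t\<^sup>2 * z) \<partial>lborel \<partial>lborel \<partial>lborel)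
     = (\<integral>\<^sup>+p. f (heis_mult q (heis_dil t p)) \<partial>lborel)"
    by (subst nn_integral_lborel_heis) (simp_all add: q algebra_simps)
  also have "ennreal \<bar>t\<bar> * (ennreal \<bar>t\<bar> * (ennreal \<bar>t\<^sup>2\<bar> * I)) = ennreal (t ^ 4) * I" for I
  proof -
    have "\<bar>t\<bar> * (\<bar>t\<bar> * \<bar>t\<^sup>2\<bar>) = t ^ 4"
      by (simp add: power4_eq_xxxx power2_eq_square mult.assoc[symmetric] flip: abs_mult)
    then have "ennreal (t ^ 4) = ennreal \<bar>t\<bar> * (ennreal \<bar>t\<bar> * ennreal \<bar>t\<^sup>2\<bar>)"
      using ennreal_mult[of "\<bar>t\<bar>" "\<bar>t\<bar> * \<bar>t\<^sup>2\<bar>"] ennreal_mult[of "\<bar>t\<bar>" "\<bar>t\<^sup>2\<bar>"] by simp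
    then show ?thesis by (simp only: mult.assoc)
  qed
  finally show ?thesis .
qed

lemma lborel_heis_mult_dil:
  assumes t: "t \<noteq> 0"
  shows "(lborel :: heis measure) = density (distr lborel borel (\<lambda>p. heis_mult q (heis_dil t p))) (\<lambda>_. ennreal (t ^ 4))"
proof (rule measure_eqI)
  fix A :: "heis set" assume "A \<in> sets lborel"
  then have [measurable]: "A \<in> sets borel" by simp
  have "emeasure lborel A = (\<integral>\<^sup>+p. indicator A p \<partial>lborel)" by simp
  also have "\<dots> = ennreal (t ^ 4) * (\<integral>\<^sup>+p. indicator A (heis_mult q (heis_dil t p)) \<partial>lborel)"
    by (rule nn_integral_heis_mult_dil[OF _ t]) simp
  also have "(\<integral>\<^sup>+p. indicator A (heis_mult q (heis_dil t p)) \<partial>lborel) =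
      (\<integral>\<^sup>+p. indicator A p \<partial>distr lborel borel (\<lambda>p. heis_mult q (heis_dil t p)))"
    by (rule nn_integral_distr[symmetric]) simp_all
  also have "ennreal (t ^ 4) * \<dots> = emeasure (density (distr lborel borel (\<lambda>p. heis_mult q (heis_dil t p))) (\<lambda>_. ennreal (t ^ 4))) A"
    by (simp add: emeasure_density nn_integral_cmult nn_integral_distr del: nn_integral_indicator)
  finally show "emeasure lborel A = \<dots>" .
qed simp

text \<open>Left translation preserves Lebesgue measure, and the exponent 4 = 1 + 1 + 2 is the
  homogeneous dimension.\<close>

lemma integral_heis_mult_dil:
  fixes f :: "heis \<Rightarrow> real"
  assumes [measurable]: "f \<in> borel_measurable borel" and t: "t \<noteq> 0"
  shows "(\<integral>p. f p \<partial>lborel) = t ^ 4 * (\<integral>p. f (heis_mult q (heis_dil t p)) \<partial>lborel)"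
proof -
  have "(\<integral>p. f p \<partial>lborel) = (\<integral>p. f p \<partial>density (distr lborel borel (\<lambda>p. heis_mult q (heis_dil t p))) (\<lambda>_. ennreal (t ^ 4)))"
    using lborel_heis_mult_dil[OF t, of q] by simp
  also have "\<dots> = t ^ 4 * (\<integral>p. f (heis_mult q (heis_dil t p)) \<partial>lborel)"
    by (subst integral_density) (simp_all add: integral_distr)
  finally show ?thesis .
qed

text \<open>Fourth power of the Koranyi gauge: a polynomial, hence smooth also at the
  origin.\<close>

definition gauge4 :: "heis \<Rightarrow> real" where
  "gauge4 = (\<lambda>(x, y, z). (x\<^sup>2 + y\<^sup>2)\<^sup>2 + 16 * z\<^sup>2)"

lemma gauge4_simp [simp]: "gauge4 (x, y, z) = (x\<^sup>2 + y\<^sup>2)\<^sup>2 + 16 * z\<^sup>2"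
  by (simp add: gauge4_def)

lemma gauge4_def': "gauge4 p = ((fst p)\<^sup>2 + (fst (snd p))\<^sup>2)\<^sup>2 + 16 * (snd (snd p))\<^sup>2"
  by (cases p) simp

lemma gauge4_nonneg: "gauge4 p \<ge> 0" by (cases p) simp

lemma gauge4_dil: "gauge4 (heis_dil t p) = t ^ 4 * gauge4 p"
  by (cases p) (simp add: power_mult_distrib algebra_simps eval_nat_numeral)

lemma continuous_on_gauge4: "continuous_on S gauge4"
  unfolding gauge4_def' [abs_def] by (intro continuous_intros)

lemma koranyi_gauge_less_iff: "0 < r \<Longrightarrow> koranyi_gauge p < r \<longleftrightarrow> gauge4 p < r ^ 4"
proof -
  assume r: "0 < r"
  have "koranyi_gauge p = gauge4 p powr (1/4)" by (cases p) simp
  moreover have "(r ^ 4) powr (1/4) = r"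
  proof -
    have "(r ^ 4) powr (1/4) = (r powr 4) powr (1/4)" using r by (simp only: powr_numeral)
    also have "\<dots> = r" unfolding powr_powr using r by simp
    finally show ?thesis .
  qed
  moreover have "gauge4 p powr (1/4) < (r ^ 4) powr (1/4) \<longleftrightarrow> gauge4 p < r ^ 4"
    using powr_less_mono2[of "1/4" "gauge4 p" "r ^ 4"] powr_mono2[of "1/4" "r ^ 4" "gauge4 p"] gauge4_nonneg[of p] r
    by (cases "gauge4 p < r ^ 4") (simp_all add: not_less)
  ultimately show ?thesis by simp
qed

lemma heis_ball_iff: "0 < r \<Longrightarrow> p \<in> heis_ball q r \<longleftrightarrow> gauge4 (heis_mult (heis_inv q) p) < r ^ 4"
  by (simp add: heis_ball_def heis_dist_def koranyi_gauge_less_iff)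

definition gauge_cball :: "heis set" where "gauge_cball = {p. gauge4 p \<le> 1}"

lemma gauge4_le_1D:
  assumes "gauge4 (x, y, z) \<le> 1"
  shows "x\<^sup>2 + y\<^sup>2 \<le> 1" "\<bar>x\<bar> \<le> 1" "\<bar>y\<bar> \<le> 1" "\<bar>z\<bar> \<le> 1"
proof -
  have "(x\<^sup>2 + y\<^sup>2)\<^sup>2 \<le> 1\<^sup>2" "z\<^sup>2 \<le> 1\<^sup>2"
    using assms zero_le_power2[of z] zero_le_power2[of "x\<^sup>2 + y\<^sup>2"] by (simp_all, linarith+)
  then show "x\<^sup>2 + y\<^sup>2 \<le> 1" "\<bar>z\<bar> \<le> 1" by (auto simp: abs_square_le_1 abs_le_iff)
  then have "x\<^sup>2 \<le> 1" "y\<^sup>2 \<le> 1"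
    using zero_le_power2[of x] zero_le_power2[of y] by (simp_all, linarith+)
  then show "\<bar>x\<bar> \<le> 1" "\<bar>y\<bar> \<le> 1" by (auto simp: abs_square_le_1)
qed

lemma norm_heis_le: "norm (x, y, z) \<le> \<bar>x\<bar> + \<bar>y\<bar> + \<bar>z :: real\<bar>" for x y :: real
  using norm_Pair_le[of x "(y, z)"] norm_Pair_le[of y z] by simp

lemma compact_gauge_cball: "compact gauge_cball"
proof -
  have "closed gauge_cball" unfolding gauge_cball_def
    by (intro closed_Collect_le continuous_on_gauge4 continuous_on_const)
  moreover have "norm p \<le> 3" if "p \<in> gauge_cball" for p
  proof (cases p)
    case (fields x y z)
    then show ?thesis using that gauge4_le_1D[of x y z] norm_heis_le[of x y z] by (simp add: gauge_cball_def)
  qed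
  ultimately show ?thesis by (meson bounded_iff compact_eq_bounded_closed)
qed

text \<open>Bridge from gauge balls to Euclidean balls. Each coordinate contributes at most t, and
  the twist term of the group law at most t times \<open>norm q\<close>; this is the origin of the
  factor \<open>3 + norm q\<close> in all later smallness conditions.\<close>

lemma dist_heis_mult_dil:
  assumes "gauge4 p \<le> 1" "0 \<le> t" "t \<le> 1"
  shows "dist q (heis_mult q (heis_dil t p)) \<le> t * (3 + norm q)"
proof -
  obtain a b c x y z where q: "q = (a, b, c)" and p: "p = (x, y, z)" by (cases q; cases p)
  note h = gauge4_le_1D[OF assms(1)[unfolded p]]
  have ab: "\<bar>a\<bar> \<le> norm q" "\<bar>b\<bar> \<le> norm q"
    using norm_fst_le[of a "(b, c)"] norm_snd_le[of "(b, c)" a] norm_fst_le[of b c] unfolding q by auto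
  have "dist q (heis_mult q (heis_dil t p)) = norm (t * x, t * y, t\<^sup>2 * z + (1/2) * (a * (t * y) - b * (t * x)))"
    unfolding dist_norm norm_minus_commute[of q] by (simp add: q p)
  also have "\<dots> \<le> \<bar>t * x\<bar> + \<bar>t * y\<bar> + \<bar>t\<^sup>2 * z + (1/2) * (a * (t * y) - b * (t * x))\<bar>"
    by (rule norm_heis_le)
  also have "\<bar>t\<^sup>2 * z + (1/2) * (a * (t * y) - b * (t * x))\<bar> \<le> t\<^sup>2 * \<bar>z\<bar> + (1/2) * (\<bar>a\<bar> * (t * \<bar>y\<bar>) + \<bar>b\<bar> * (t * \<bar>x\<bar>))"
  proof -
    have "\<bar>a * (t * y)\<bar> = \<bar>a\<bar> * (t * \<bar>y\<bar>)" "\<bar>b * (t * x)\<bar> = \<bar>b\<bar> * (t * \<bar>x\<bar>)" "\<bar>t\<^sup>2 * z\<bar> = t\<^sup>2 * \<bar>z\<bar>"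
      using assms by (simp_all add: abs_mult)
    moreover have "\<bar>t\<^sup>2 * z + (1/2) * (a * (t * y) - b * (t * x))\<bar> \<le> \<bar>t\<^sup>2 * z\<bar> + (1/2) * (\<bar>a * (t * y)\<bar> + \<bar>b * (t * x)\<bar>)"
      by (rule abs_leI) (simp_all add: abs_if field_simps)
    ultimately show ?thesis by simp
  qed
  also have "\<dots> \<le> t * 1 + (1/2) * (norm q * (t * 1) + norm q * (t * 1))"
  proof -
    have "t\<^sup>2 * \<bar>z\<bar> \<le> t * 1"
      using h(4) assms mult_left_le[of t t] unfolding power2_eq_square by (intro mult_mono) auto
    moreover have "\<bar>a\<bar> * (t * \<bar>y\<bar>) \<le> norm q * (t * 1)"
      by (intro mult_mono ab(1) h(3)) (use assms in auto)
    moreover have "\<bar>b\<bar> * (t * \<bar>x\<bar>) \<le> norm q * (t * 1)"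
      by (intro mult_mono ab(2) h(2)) (use assms in auto)
    ultimately show ?thesis by (intro add_mono mult_left_mono) auto
  qed
  also have "\<bar>t * x\<bar> \<le> t * 1" unfolding abs_mult using h assms by (intro mult_mono) auto
  also have "\<bar>t * y\<bar> \<le> t * 1" unfolding abs_mult using h assms by (intro mult_mono) auto
  finally show ?thesis by (simp add: algebra_simps)
qed

section \<open>Horizontal derivatives\<close>

lemma Basis_heis: "(Basis :: heis set) = {(1, 0, 0), (0, 1, 0), (0, 0, 1)}"
  by (auto simp: Basis_prod_def zero_prod_def)

lemma heis_X_def': "heis_X f = (\<lambda>p. partial_deriv (1, 0, 0) f p - fst (snd p) / 2 * partial_deriv (0, 0, 1) f p)"
  and heis_Y_def': "heis_Y f = (\<lambda>p. partial_deriv (0, 1, 0) f p + fst p / 2 * partial_deriv (0, 0, 1) f p)"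
  by (auto simp: heis_X_def heis_Y_def)

lemma heis_X_eqI:
  assumes "(f has_derivative f') (at p)"
  shows "heis_X f p = f' (1, 0, - fst (snd p) / 2)"
proof -
  interpret bounded_linear f' using assms by (rule has_derivative_bounded_linear)
  have "f' (1, 0, - fst (snd p) / 2) = f' ((1, 0, 0) + (- fst (snd p) / 2) *\<^sub>R (0, 0, 1))" by simp
  also have "\<dots> = f' (1, 0, 0) + (- fst (snd p) / 2) * f' (0, 0, 1)" unfolding add scaleR by simp
  finally show ?thesis by (simp add: heis_X_def' partial_deriv_eqI[OF assms])
qed

lemma heis_Y_eqI:
  assumes "(f has_derivative f') (at p)"
  shows "heis_Y f p = f' (0, 1, fst p / 2)"
proof -
  interpret bounded_linear f' using assms by (rule has_derivative_bounded_linear)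
  have "f' (0, 1, fst p / 2) = f' ((0, 1, 0) + (fst p / 2) *\<^sub>R (0, 0, 1))" by simp
  also have "\<dots> = f' (0, 1, 0) + (fst p / 2) * f' (0, 0, 1)" unfolding add scaleR by simp
  finally show ?thesis by (simp add: heis_Y_def' partial_deriv_eqI[OF assms])
qed

lemma heis_X_cong: "open S \<Longrightarrow> p \<in> S \<Longrightarrow> (\<And>q. q \<in> S \<Longrightarrow> f q = g q) \<Longrightarrow> heis_X f p = heis_X g p"
  and heis_Y_cong: "open S \<Longrightarrow> p \<in> S \<Longrightarrow> (\<And>q. q \<in> S \<Longrightarrow> f q = g q) \<Longrightarrow> heis_Y f p = heis_Y g p"
  unfolding heis_X_def' heis_Y_def' using partial_deriv_cong[of S p f g] by auto

lemma Ck_on_coord [simp]: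
  "Ck_on k (\<lambda>p::heis. fst p) S" "Ck_on k (\<lambda>p::heis. fst (snd p)) S" "Ck_on k (\<lambda>p::heis. snd (snd p)) S"
  by (intro Ck_on_bounded_linear bounded_linear_intros)+

lemma Ck_on_heis_X:
  assumes "open S" "Ck_on (Suc k) f S"
  shows "Ck_on k (heis_X f) S"
  unfolding heis_X_def' divide_inverse using Ck_on_partial[OF assms(2)]
  by (intro Ck_on_diff Ck_on_mult assms(1) Ck_on_coord Ck_on_const) (auto simp: Basis_heis)

lemma Ck_on_heis_Y:
  assumes "open S" "Ck_on (Suc k) f S"
  shows "Ck_on k (heis_Y f) S"
  unfolding heis_Y_def' divide_inverse using Ck_on_partial[OF assms(2)]
  by (intro Ck_on_add Ck_on_mult assms(1) Ck_on_coord Ck_on_const) (auto simp: Basis_heis)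

lemma Ck_on_heis_laplacian:
  assumes "open S" "Ck_on (Suc (Suc k)) f S"
  shows "Ck_on k (heis_laplacian f) S"
  unfolding heis_laplacian_def [abs_def]
  by (intro Ck_on_add Ck_on_heis_X Ck_on_heis_Y assms)

lemma Ck_on_has_derivative_ex:
  assumes "Ck_on (Suc k) f S" "p \<in> S"
  obtains f' where "(f has_derivative f') (at p)"
  using Ck_on_has_derivative[OF assms] by blast

lemma heis_has_derivative:
  assumes "Ck_on (Suc k) f S" "p \<in> S"
  shows "(f has_derivative (\<lambda>h. fst h * partial_deriv (1, 0, 0) f p + fst (snd h) * partial_deriv (0, 1, 0) f p
    + snd (snd h) * partial_deriv (0, 0, 1) f p)) (at p)"
  using Ck_on_has_derivative[OF assms] by (simp add: Basis_heis inner_prod_def add.assoc)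

lemma heis_X_add:
  assumes "Ck_on (Suc k) f S" "Ck_on (Suc j) g S" "p \<in> S"
  shows "heis_X (\<lambda>p. f p + g p) p = heis_X f p + heis_X g p"
    and "heis_Y (\<lambda>p. f p + g p) p = heis_Y f p + heis_Y g p"
proof -
  note f = Ck_on_has_derivative[OF assms(1,3)] and g = Ck_on_has_derivative[OF assms(2,3)]
  show "heis_X (\<lambda>p. f p + g p) p = heis_X f p + heis_X g p"
    unfolding heis_X_eqI[OF f] heis_X_eqI[OF g] heis_X_eqI[OF has_derivative_add[OF f g]] ..
  show "heis_Y (\<lambda>p. f p + g p) p = heis_Y f p + heis_Y g p"
    unfolding heis_Y_eqI[OF f] heis_Y_eqI[OF g] heis_Y_eqI[OF has_derivative_add[OF f g]] ..
qed

lemma heis_X_mult: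
  assumes "Ck_on (Suc k) f S" "Ck_on (Suc j) g S" "p \<in> S"
  shows "heis_X (\<lambda>p. f p * g p) p = f p * heis_X g p + heis_X f p * g p"
    and "heis_Y (\<lambda>p. f p * g p) p = f p * heis_Y g p + heis_Y f p * g p"
proof -
  note f = Ck_on_has_derivative[OF assms(1,3)] and g = Ck_on_has_derivative[OF assms(2,3)]
  show "heis_X (\<lambda>p. f p * g p) p = f p * heis_X g p + heis_X f p * g p"
    unfolding heis_X_eqI[OF f] heis_X_eqI[OF g] heis_X_eqI[OF has_derivative_mult[OF f g]] ..
  show "heis_Y (\<lambda>p. f p * g p) p = f p * heis_Y g p + heis_Y f p * g p"
    unfolding heis_Y_eqI[OF f] heis_Y_eqI[OF g] heis_Y_eqI[OF has_derivative_mult[OF f g]] ..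
qed

lemma heis_XY_const: "heis_X (\<lambda>_. c) p = 0" "heis_Y (\<lambda>_. c) p = 0"
  by (simp_all add: heis_X_def' heis_Y_def' partial_deriv_def)

lemma heis_laplacian_add:
  assumes S: "open S" "Ck_on 2 f S" "Ck_on 2 g S" "p \<in> S"
  shows "heis_laplacian (\<lambda>p. f p + g p) p = heis_laplacian f p + heis_laplacian g p"
proof -
  have f: "Ck_on (Suc 1) f S" and g: "Ck_on (Suc 1) g S" using S by (simp_all add: numeral_2_eq_2)
  have X: "heis_X (heis_X (\<lambda>p. f p + g p)) p = heis_X (\<lambda>p. heis_X f p + heis_X g p) p"
    by (rule heis_X_cong[OF S(1,4)]) (rule heis_X_add[OF f g])
  have Y: "heis_Y (heis_Y (\<lambda>p. f p + g p)) p = heis_Y (\<lambda>p. heis_Y f p + heis_Y g p) p"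
    by (rule heis_Y_cong[OF S(1,4)]) (rule heis_X_add[OF f g])
  have "Ck_on 1 (heis_X f) S" "Ck_on 1 (heis_X g) S" "Ck_on 1 (heis_Y f) S" "Ck_on 1 (heis_Y g) S"
    using S f g by (auto intro: Ck_on_heis_X Ck_on_heis_Y simp del: Ck_on.simps)
  then show ?thesis unfolding heis_laplacian_def X Y
    using heis_X_add[of 0 "heis_X f" S 0 "heis_X g" p] heis_X_add[of 0 "heis_Y f" S 0 "heis_Y g" p] S(4)
    by (simp del: Ck_on.simps)
qed

lemma heis_laplacian_cmult:
  assumes S: "open S" "Ck_on 2 f S" "p \<in> S"
  shows "heis_laplacian (\<lambda>p. c * f p) p = c * heis_laplacian f p"
proof -
  have f: "Ck_on (Suc 1) f S" using S by (simp_all add: numeral_2_eq_2)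
  have XY: "heis_X (\<lambda>p. c * f p) q = c * heis_X f q" "heis_Y (\<lambda>p. c * f p) q = c * heis_Y f q"
    if "Ck_on (Suc 0) f S" "q \<in> S" for f q
    using heis_X_mult[OF Ck_on_const[of "Suc 0" c] that] by (simp_all add: heis_XY_const)
  have f1: "Ck_on (Suc 0) f S" using f by (rule Ck_on_mono) simp
  have X: "heis_X (heis_X (\<lambda>p. c * f p)) p = heis_X (\<lambda>p. c * heis_X f p) p"
    by (rule heis_X_cong[OF S(1,3)]) (rule XY[OF f1])
  have Y: "heis_Y (heis_Y (\<lambda>p. c * f p)) p = heis_Y (\<lambda>p. c * heis_Y f p) p"
    by (rule heis_Y_cong[OF S(1,3)]) (rule XY[OF f1])
  show ?thesis unfolding heis_laplacian_def X Y
    using XY[OF Ck_on_heis_X[OF S(1)] S(3)] XY[OF Ck_on_heis_Y[OF S(1)] S(3)] f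
    by (simp del: Ck_on.simps add: distrib_left)
qed

lemma heis_laplacian_uminus:
  "open S \<Longrightarrow> Ck_on 2 f S \<Longrightarrow> p \<in> S \<Longrightarrow> heis_laplacian (\<lambda>p. - f p) p = - heis_laplacian f p"
  using heis_laplacian_cmult[of S f p "-1"] by simp

lemma heis_laplacian_diff:
  "open S \<Longrightarrow> Ck_on 2 f S \<Longrightarrow> Ck_on 2 g S \<Longrightarrow> p \<in> S \<Longrightarrow>
    heis_laplacian (\<lambda>p. f p - g p) p = heis_laplacian f p - heis_laplacian g p"
  using heis_laplacian_add[of S f "\<lambda>p. - g p" p] heis_laplacian_uminus[of S g p] Ck_on_uminus[of S 2 g]
  by (simp del: Ck_on.simps)

lemma heis_mult_has_derivative:
  "((\<lambda>p. heis_mult q p) has_derivative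
    (\<lambda>h. (fst h, fst (snd h), snd (snd h) + (1/2) * (fst q * fst (snd h) - fst (snd q) * fst h)))) (at p)"
  unfolding heis_mult_def by (auto intro!: derivative_eq_intros)

lemma heis_dil_has_derivative:
  "((\<lambda>p. heis_dil t p) has_derivative heis_dil t) (at p)"
  unfolding heis_dil_def' [abs_def] by (auto intro!: derivative_eq_intros)

lemma Ck_on_heis_compose:
  assumes "open S" "Ck_on k (\<lambda>p. fst (G p)) S" "Ck_on k (\<lambda>p. fst (snd (G p))) S" "Ck_on k (\<lambda>p. snd (snd (G p))) S"
    "G ` S \<subseteq> T" "Ck_on k f T"
  shows "Ck_on k (\<lambda>p. f (G p :: heis)) S"
  using assms(2-4) by (intro Ck_on_compose[OF assms(1) _ assms(5,6)]) (auto simp: Basis_heis inner_prod_def)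

lemma Ck_on_heis_mult_dil:
  assumes "open S" "(\<lambda>p. heis_mult q (heis_dil t p)) ` S \<subseteq> T" "Ck_on k f T"
  shows "Ck_on k (\<lambda>p. f (heis_mult q (heis_dil t p))) S"
proof (rule Ck_on_heis_compose[OF assms(1) _ _ _ assms(2,3)])
qed (unfold heis_mult_def heis_dil_def' fst_conv snd_conv,
    (intro Ck_on_add Ck_on_diff Ck_on_mult Ck_on_const Ck_on_coord assms(1))+)

text \<open>X and Y are left invariant and homogeneous of degree one under the dilations.\<close>

lemma heis_X_mult_dil:
  assumes "Ck_on (Suc k) f S" "heis_mult q (heis_dil t p) \<in> S"
  shows "heis_X (\<lambda>p. f (heis_mult q (heis_dil t p))) p = t * heis_X f (heis_mult q (heis_dil t p))"
    and "heis_Y (\<lambda>p. f (heis_mult q (heis_dil t p))) p = t * heis_Y f (heis_mult q (heis_dil t p))"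
proof -
  note f = heis_has_derivative[OF assms]
  note * = has_derivative_compose[OF has_derivative_compose[OF heis_dil_has_derivative heis_mult_has_derivative] f]
  show "heis_X (\<lambda>p. f (heis_mult q (heis_dil t p))) p = t * heis_X f (heis_mult q (heis_dil t p))"
    unfolding heis_X_eqI[OF f] heis_X_eqI[OF *] by (simp add: heis_mult_def heis_dil_def' field_simps power2_eq_square)
  show "heis_Y (\<lambda>p. f (heis_mult q (heis_dil t p))) p = t * heis_Y f (heis_mult q (heis_dil t p))"
    unfolding heis_Y_eqI[OF f] heis_Y_eqI[OF *] by (simp add: heis_mult_def heis_dil_def' field_simps power2_eq_square)
qed

lemma heis_laplacian_mult_dil:
  assumes S: "open S" "Ck_on 2 f S" "heis_mult q (heis_dil t p) \<in> S"
  shows "heis_laplacian (\<lambda>p. f (heis_mult q (heis_dil t p))) p = t\<^sup>2 * heis_laplacian f (heis_mult q (heis_dil t p))"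
proof -
  define L where "L = (\<lambda>p. heis_mult q (heis_dil t p))"
  have f: "Ck_on (Suc 1) f S" using S by (simp_all add: numeral_2_eq_2)
  have L: "open (L -` S)" "p \<in> L -` S"
    using S by (auto simp: L_def intro!: open_vimage continuous_intros)
  have c1: "Ck_on (Suc 0) (heis_X f) S" "Ck_on (Suc 0) (heis_Y f) S"
    using S(1) f by (auto intro: Ck_on_heis_X Ck_on_heis_Y simp del: Ck_on.simps)
  have c2: "Ck_on (Suc 0) (\<lambda>p. heis_X f (L p)) (L -` S)" "Ck_on (Suc 0) (\<lambda>p. heis_Y f (L p)) (L -` S)"
    unfolding L_def by (rule Ck_on_heis_mult_dil[OF L(1)[unfolded L_def] _ c1(1)] Ck_on_heis_mult_dil[OF L(1)[unfolded L_def] _ c1(2)], blast)+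
  have X: "heis_X (heis_X (\<lambda>p. f (L p))) p = heis_X (\<lambda>p. t * heis_X f (L p)) p"
    using heis_X_mult_dil[OF f] by (intro heis_X_cong[OF L]) (auto simp: L_def)
  have Y: "heis_Y (heis_Y (\<lambda>p. f (L p))) p = heis_Y (\<lambda>p. t * heis_Y f (L p)) p"
    using heis_X_mult_dil[OF f] by (intro heis_Y_cong[OF L]) (auto simp: L_def)
  have "heis_X (\<lambda>p. t * heis_X f (L p)) p = t * heis_X (\<lambda>p. heis_X f (L p)) p"
    "heis_Y (\<lambda>p. t * heis_Y f (L p)) p = t * heis_Y (\<lambda>p. heis_Y f (L p)) p"
    using heis_X_mult[OF Ck_on_const[of "Suc 0" t] c2(1) L(2)] heis_X_mult[OF Ck_on_const[of "Suc 0" t] c2(2) L(2)]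
    by (simp_all add: heis_XY_const)
  moreover have "heis_X (\<lambda>p. heis_X f (L p)) p = t * heis_X (heis_X f) (L p)"
    "heis_Y (\<lambda>p. heis_Y f (L p)) p = t * heis_Y (heis_Y f) (L p)"
    using heis_X_mult_dil(1)[OF c1(1) S(3)] heis_X_mult_dil(2)[OF c1(2) S(3)] by (simp_all add: L_def)
  ultimately have "heis_laplacian (\<lambda>p. f (L p)) p = t\<^sup>2 * heis_laplacian f (L p)"
    unfolding heis_laplacian_def X Y by (simp add: power2_eq_square distrib_left mult.assoc)
  then show ?thesis by (simp add: L_def)
qed

text \<open>Both coefficients vanish at the origin, and along the x-axis the coefficient y/2 of X
  stays zero, as does x/2 along the y-axis; so no first-order or mixed terms survive.\<close>

lemma heis_laplacian_origin:
  "heis_laplacian f (0, 0, 0) = partial_deriv (1, 0, 0) (partial_deriv (1, 0, 0) f) (0, 0, 0)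
     + partial_deriv (0, 1, 0) (partial_deriv (0, 1, 0) f) (0, 0, 0)"
  by (simp add: heis_laplacian_def heis_X_def' heis_Y_def', simp add: partial_deriv_def)

section \<open>Moments of the unit gauge ball\<close>

text \<open>Half the area and half the second moment of a disc of radius \<open>R\<close>. The
  horizontal slices of the gauge ball are discs, and the chord at x has length 2 sqrt (R^2 -
  x^2).\<close>

lemma has_integral_semicircle:
  fixes R :: real assumes R: "R > 0"
  shows "((\<lambda>x. sqrt (R\<^sup>2 - x\<^sup>2)) has_integral (pi * R\<^sup>2 / 2)) {-R..R}"
    and "((\<lambda>x. x\<^sup>2 * sqrt (R\<^sup>2 - x\<^sup>2)) has_integral (pi * R ^ 4 / 8)) {-R..R}"
proof -
  have s: "R\<^sup>2 - x\<^sup>2 > 0" if "x \<in> {-R<..<R}" for x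
  proof -
    have "0 < (R - x) * (R + x)" using that by (intro mult_pos_pos) auto
    then show ?thesis by (simp add: power2_eq_square algebra_simps)
  qed
  have das: "((\<lambda>x. arcsin (x / R)) has_real_derivative inverse (sqrt (R\<^sup>2 - x\<^sup>2))) (at x)" if "x \<in> {-R<..<R}" for x
  proof -
    have "-1 < x / R" "x / R < 1" using that R by (auto simp: field_simps)
    then have "((\<lambda>x. arcsin (x / R)) has_real_derivative inverse (sqrt (1 - (x / R)\<^sup>2)) * (1 / R)) (at x)"
      using R by (auto intro!: derivative_eq_intros)
    moreover have "sqrt (1 - (x / R)\<^sup>2) = sqrt (R\<^sup>2 - x\<^sup>2) / R"
    proof -
      have "1 - (x / R)\<^sup>2 = (R\<^sup>2 - x\<^sup>2) / R\<^sup>2" using R by (simp add: field_simps power_divide)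
      then show ?thesis using R by (simp add: real_sqrt_divide)
    qed
    ultimately show ?thesis using R by (simp add: field_simps)
  qed
  have ds: "((\<lambda>x. sqrt (R\<^sup>2 - x\<^sup>2)) has_real_derivative - x * inverse (sqrt (R\<^sup>2 - x\<^sup>2))) (at x)" if "x \<in> {-R<..<R}" for x
    using s[OF that] by (auto intro!: derivative_eq_intros simp: field_simps)
  have ca: "continuous_on {-R..R} (\<lambda>x. arcsin (x / R))"
    using R by (intro continuous_on_arcsin continuous_intros) (auto simp: field_simps)
  \<comment> \<open>Explicit antiderivative, continuous on the closed interval but differentiated
    only inside, where the root and the arcsine are smooth; hence the interior form of the
    fundamental theorem.\<close>
  let ?F = "\<lambda>x. (x * sqrt (R\<^sup>2 - x\<^sup>2) + R\<^sup>2 * arcsin (x / R)) / 2"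
  have "((\<lambda>x. sqrt (R\<^sup>2 - x\<^sup>2)) has_integral (?F R - ?F (-R))) {-R..R}"
  proof (rule fundamental_theorem_of_calculus_interior)
    show "continuous_on {-R..R} ?F" by (intro continuous_intros ca) auto
    fix x assume x: "x \<in> {-R<..<R}"
    define S where "S = sqrt (R\<^sup>2 - x\<^sup>2)"
    have S: "S > 0" "S * S = R\<^sup>2 - x\<^sup>2" using s[OF x] by (auto simp: S_def)
    have "(?F has_real_derivative (1 * S + x * (- x * inverse S) + R\<^sup>2 * inverse S) / 2) (at x)"
      by (rule DERIV_cong[OF DERIV_cdivide[OF DERIV_add[OF DERIV_mult[OF DERIV_ident ds[OF x]] DERIV_cmult[OF das[OF x]]]]])
        (simp add: S_def)
    moreover have "(1 * S + x * (- x * inverse S) + R\<^sup>2 * inverse S) / 2 = S"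
    proof -
      have "S + x * (- x * inverse S) + R\<^sup>2 * inverse S = S + (S * S) * inverse S"
        unfolding S(2) by (simp add: algebra_simps power2_eq_square)
      then show ?thesis using S(1) by simp
    qed
    ultimately have "(?F has_real_derivative S) (at x)" by (simp only:)
    then show "(?F has_vector_derivative sqrt (R\<^sup>2 - x\<^sup>2)) (at x)"
      unfolding has_real_derivative_iff_has_vector_derivative S_def .
  qed (use R in auto)
  then show "((\<lambda>x. sqrt (R\<^sup>2 - x\<^sup>2)) has_integral (pi * R\<^sup>2 / 2)) {-R..R}"
    using R by (simp add: arcsin_1 arcsin_minus_1 field_simps)
  let ?G = "\<lambda>x. (R ^ 4 * arcsin (x / R) - x * sqrt (R\<^sup>2 - x\<^sup>2) * (R\<^sup>2 - 2 * x\<^sup>2)) / 8"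
  have "((\<lambda>x. x\<^sup>2 * sqrt (R\<^sup>2 - x\<^sup>2)) has_integral (?G R - ?G (-R))) {-R..R}"
  proof (rule fundamental_theorem_of_calculus_interior)
    show "continuous_on {-R..R} ?G" by (intro continuous_intros ca) auto
    fix x assume x: "x \<in> {-R<..<R}"
    define S where "S = sqrt (R\<^sup>2 - x\<^sup>2)"
    have S: "S > 0" "S * S = R\<^sup>2 - x\<^sup>2" using s[OF x] by (auto simp: S_def)
    let ?d = "(R ^ 4 * inverse S - ((1 * S + x * (- x * inverse S)) * (R\<^sup>2 - 2 * x\<^sup>2) + x * S * (- 4 * x))) / 8"
    have dq: "((\<lambda>x. R\<^sup>2 - 2 * x\<^sup>2) has_real_derivative - 4 * x) (at x)"
      by (auto intro!: derivative_eq_intros)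
    have "(?G has_real_derivative ?d) (at x)"
      by (rule DERIV_cong[OF DERIV_cdivide[OF DERIV_diff[OF DERIV_cmult[OF das[OF x]]
            DERIV_mult[OF DERIV_mult[OF DERIV_ident ds[OF x]] dq]]]])
        (simp add: S_def algebra_simps)
    moreover have "?d = x\<^sup>2 * S"
    proof -
      have "?d * S = (R ^ 4 * (inverse S * S) - ((S * S - x * x * (inverse S * S)) * (R\<^sup>2 - 2 * x\<^sup>2) + x * (S * S) * (- 4 * x))) / 8"
        by (simp add: algebra_simps)
      also have "\<dots> = (R ^ 4 - ((R\<^sup>2 - x\<^sup>2 - x * x) * (R\<^sup>2 - 2 * x\<^sup>2) + x * (R\<^sup>2 - x\<^sup>2) * (- 4 * x))) / 8"
        using S by simp
      also have "\<dots> = x\<^sup>2 * (R\<^sup>2 - x\<^sup>2)" by (simp add: power2_eq_square power4_eq_xxxx field_simps)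
      also have "\<dots> = x\<^sup>2 * S * S" using S(2) by (simp add: mult.assoc)
      finally show ?thesis using S(1) by simp
    qed
    ultimately have "(?G has_real_derivative x\<^sup>2 * S) (at x)" by (simp only:)
    then show "(?G has_vector_derivative x\<^sup>2 * sqrt (R\<^sup>2 - x\<^sup>2)) (at x)"
      unfolding has_real_derivative_iff_has_vector_derivative S_def .
  qed (use R in auto)
  then show "((\<lambda>x. x\<^sup>2 * sqrt (R\<^sup>2 - x\<^sup>2)) has_integral (pi * R ^ 4 / 8)) {-R..R}"
    using R by (simp add: arcsin_1 arcsin_minus_1 field_simps)
qed

definition gauge_ball :: "heis set" where "gauge_ball = {p. gauge4 p < 1}"

lemma open_gauge_ball: "open gauge_ball"
  unfolding gauge_ball_def by (intro open_Collect_less continuous_on_gauge4 continuous_on_const)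

lemma gauge_ball_subset: "gauge_ball \<subseteq> gauge_cball" by (auto simp: gauge_ball_def gauge_cball_def)

lemma sets_gauge_ball [measurable]: "gauge_ball \<in> sets borel" using open_gauge_ball by simp

text \<open>Two further orders of integration: z outermost serves slicing by horizontal discs and
  the reflection in z, y outermost serves the exchange of x and y.\<close>

lemma nn_integral_lborel_heis':
  assumes [measurable]: "f \<in> borel_measurable borel"
  shows "(\<integral>\<^sup>+p. f p \<partial>(lborel :: heis measure)) =
    (\<integral>\<^sup>+z. \<integral>\<^sup>+x. \<integral>\<^sup>+y. f (x, y, z) \<partial>lborel \<partial>lborel \<partial>lborel)"
    "(\<integral>\<^sup>+p. f p \<partial>(lborel :: heis measure)) =
    (\<integral>\<^sup>+y. \<integral>\<^sup>+x. \<integral>\<^sup>+z. f (x, y, z) \<partial>lborel \<partial>lborel \<partial>lborel)"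
proof -
  have "(\<integral>\<^sup>+p. f p \<partial>(lborel :: heis measure)) = (\<integral>\<^sup>+x. \<integral>\<^sup>+y. \<integral>\<^sup>+z. f (x, y, z) \<partial>lborel \<partial>lborel \<partial>lborel)"
    by (rule nn_integral_lborel_heis) simp
  also have "\<dots> = (\<integral>\<^sup>+x. \<integral>\<^sup>+z. \<integral>\<^sup>+y. f (x, y, z) \<partial>lborel \<partial>lborel \<partial>lborel)"
    by (intro nn_integral_cong lborel_pair.Fubini') simp
  also have "\<dots> = (\<integral>\<^sup>+z. \<integral>\<^sup>+x. \<integral>\<^sup>+y. f (x, y, z) \<partial>lborel \<partial>lborel \<partial>lborel)"
    by (intro lborel_pair.Fubini') simp
  finally show "(\<integral>\<^sup>+p. f p \<partial>(lborel :: heis measure)) =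
    (\<integral>\<^sup>+z. \<integral>\<^sup>+x. \<integral>\<^sup>+y. f (x, y, z) \<partial>lborel \<partial>lborel \<partial>lborel)" .
  have "(\<integral>\<^sup>+p. f p \<partial>(lborel :: heis measure)) = (\<integral>\<^sup>+x. \<integral>\<^sup>+y. \<integral>\<^sup>+z. f (x, y, z) \<partial>lborel \<partial>lborel \<partial>lborel)"
    by (rule nn_integral_lborel_heis) simp
  also have "\<dots> = (\<integral>\<^sup>+y. \<integral>\<^sup>+x. \<integral>\<^sup>+z. f (x, y, z) \<partial>lborel \<partial>lborel \<partial>lborel)"
    by (intro lborel_pair.Fubini') simp
  finally show "(\<integral>\<^sup>+p. f p \<partial>(lborel :: heis measure)) =
    (\<integral>\<^sup>+y. \<integral>\<^sup>+x. \<integral>\<^sup>+z. f (x, y, z) \<partial>lborel \<partial>lborel \<partial>lborel)" .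
qed

lemma integral_heis_bij:
  fixes f :: "heis \<Rightarrow> real"
  assumes [measurable]: "f \<in> borel_measurable borel" "T \<in> borel_measurable borel"
    and nn: "\<And>g. g \<in> borel_measurable borel \<Longrightarrow> (\<integral>\<^sup>+p. g p \<partial>lborel) = (\<integral>\<^sup>+p. g (T p) \<partial>lborel)"
  shows "(\<integral>p. f (T p) \<partial>lborel) = (\<integral>p. f p \<partial>lborel)"
proof -
  have "distr lborel borel T = lborel"
  proof (rule measure_eqI)
    fix A assume "A \<in> sets (distr lborel borel T)"
    then have [measurable]: "A \<in> sets borel" by simp
    have "emeasure (distr lborel borel T) A = (\<integral>\<^sup>+p. indicator A p \<partial>distr lborel borel T)" by simp
    also have "\<dots> = (\<integral>\<^sup>+p. indicator A (T p) \<partial>lborel)" by (rule nn_integral_distr) simp_all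
    also have "\<dots> = (\<integral>\<^sup>+p. indicator A p \<partial>lborel)" by (rule nn[symmetric]) simp
    finally show "emeasure (distr lborel borel T) A = emeasure lborel A" by simp
  qed simp
  then show ?thesis using integral_distr[of T lborel borel f] by simp
qed

lemma integral_heis_reflect:
  fixes f :: "heis \<Rightarrow> real"
  assumes [measurable]: "f \<in> borel_measurable borel"
  shows "(\<integral>p. f (- fst p, fst (snd p), snd (snd p)) \<partial>lborel) = (\<integral>p. f p \<partial>lborel)"
    and "(\<integral>p. f (fst p, fst (snd p), - snd (snd p)) \<partial>lborel) = (\<integral>p. f p \<partial>lborel)"
    and "(\<integral>p. f (fst (snd p), fst p, snd (snd p)) \<partial>lborel) = (\<integral>p. f p \<partial>lborel)"
proof -
  have m: "(\<lambda>p::heis. (- fst p, fst (snd p), snd (snd p))) \<in> borel_measurable borel"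
    "(\<lambda>p::heis. (fst p, fst (snd p), - snd (snd p))) \<in> borel_measurable borel"
    "(\<lambda>p::heis. (fst (snd p), fst p, snd (snd p))) \<in> borel_measurable borel"
    by (intro borel_measurable_continuous_onI continuous_intros)+
  show "(\<integral>p. f (- fst p, fst (snd p), snd (snd p)) \<partial>lborel) = (\<integral>p. f p \<partial>lborel)"
  proof (rule integral_heis_bij[OF assms m(1)])
    fix g :: "heis \<Rightarrow> ennreal" assume g[measurable]: "g \<in> borel_measurable borel"
    show "(\<integral>\<^sup>+p. g p \<partial>lborel) = (\<integral>\<^sup>+p. g (- fst p, fst (snd p), snd (snd p)) \<partial>lborel)"
      unfolding nn_integral_lborel_heis[OF g]
      by (subst nn_integral_lborel_heis[OF measurable_compose[OF m(1) g]], subst nn_integral_real_affine[where c="-1" and t=0]) simp_all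
  qed
  show "(\<integral>p. f (fst p, fst (snd p), - snd (snd p)) \<partial>lborel) = (\<integral>p. f p \<partial>lborel)"
  proof (rule integral_heis_bij[OF assms m(2)])
    fix g :: "heis \<Rightarrow> ennreal" assume g[measurable]: "g \<in> borel_measurable borel"
    show "(\<integral>\<^sup>+p. g p \<partial>lborel) = (\<integral>\<^sup>+p. g (fst p, fst (snd p), - snd (snd p)) \<partial>lborel)"
      unfolding nn_integral_lborel_heis'(1)[OF g]
      by (subst nn_integral_lborel_heis'(1)[OF measurable_compose[OF m(2) g]], subst nn_integral_real_affine[where c="-1" and t=0]) simp_all
  qed
  show "(\<integral>p. f (fst (snd p), fst p, snd (snd p)) \<partial>lborel) = (\<integral>p. f p \<partial>lborel)"
  proof (rule integral_heis_bij[OF assms m(3)])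
    fix g :: "heis \<Rightarrow> ennreal" assume g[measurable]: "g \<in> borel_measurable borel"
    show "(\<integral>\<^sup>+p. g p \<partial>lborel) = (\<integral>\<^sup>+p. g (fst (snd p), fst p, snd (snd p)) \<partial>lborel)"
      unfolding nn_integral_lborel_heis'(2)[OF g]
      by (subst nn_integral_lborel_heis[OF measurable_compose[OF m(3) g]]) simp_all
  qed
qed

lemma nn_integral_has_integral_indicator:
  fixes f :: "'a::euclidean_space \<Rightarrow> real"
  assumes "f \<in> borel_measurable borel" "A \<in> sets borel" "\<And>x. 0 \<le> f x" "(f has_integral I) A"
  shows "(\<integral>\<^sup>+x. ennreal (indicator A x * f x) \<partial>lborel) = ennreal I"
proof (rule nn_integral_has_integral_lborel)
  have "(\<lambda>x. if x \<in> A then f x else 0) = (\<lambda>x. indicator A x * f x)" by (auto simp: indicator_def)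
  then show "((\<lambda>x. indicator A x * f x) has_integral I) UNIV"
    using assms(4) has_integral_restrict_UNIV[of A f I] by simp
qed (use assms in auto)

text \<open>The slice at height z with 16 z^2 < 1 is a disc of radius (1 - 16 z^2)^(1/4).
  Integrating \<open>w\<close> over a disc of radius R gives 2 \<open>I R\<close>, and the heights
  fill the interval (-1/4, 1/4).\<close>

lemma nn_integral_gauge_ball_moment:
  fixes w :: "real \<Rightarrow> real"
  assumes [measurable]: "w \<in> borel_measurable borel" and w0: "\<And>x. w x \<ge> 0"
    and w: "\<And>R. R > 0 \<Longrightarrow> ((\<lambda>x. w x * sqrt (R\<^sup>2 - x\<^sup>2)) has_integral I R) {-R..R}"
    and J: "((\<lambda>z. 2 * I (sqrt (sqrt (1 - 16 * z\<^sup>2)))) has_integral J) {-1/4<..<1/4}"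
    and [measurable]: "(\<lambda>z. 2 * I (sqrt (sqrt (1 - 16 * z\<^sup>2)))) \<in> borel_measurable borel" and I0: "\<And>R. I R \<ge> 0"
  shows "(\<integral>\<^sup>+p. ennreal (indicator gauge_ball p * w (fst p)) \<partial>lborel) = ennreal J"
proof -
  have fm: "(\<lambda>p. ennreal (indicator gauge_ball p * w (fst p))) \<in> borel_measurable borel"
  proof -
    have "(\<lambda>p::heis. fst p) \<in> borel_measurable borel"
      by (intro borel_measurable_continuous_onI continuous_intros)
    from measurable_compose[OF this assms(1)] have [measurable]: "(\<lambda>p::heis. w (fst p)) \<in> borel_measurable borel" .
    show ?thesis by measurable
  qed
  have 1: "(\<integral>\<^sup>+y. ennreal (indicator gauge_ball (x, y, z) * w x) \<partial>lborel) =
      ennreal (indicator {-R..R} x * (2 * (w x * sqrt (R\<^sup>2 - x\<^sup>2))))"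
    if z: "16 * z\<^sup>2 < 1" and R: "R = sqrt (sqrt (1 - 16 * z\<^sup>2))" for x z R
  proof -
    have R2: "R > 0" "R\<^sup>2 = sqrt (1 - 16 * z\<^sup>2)" using z by (auto simp: R)
    have iff: "(x, y, z) \<in> gauge_ball \<longleftrightarrow> y\<^sup>2 < R\<^sup>2 - x\<^sup>2" for y
    proof -
      have "(x, y, z) \<in> gauge_ball \<longleftrightarrow> (x\<^sup>2 + y\<^sup>2)\<^sup>2 < 1 - 16 * z\<^sup>2" by (auto simp: gauge_ball_def)
      also have "\<dots> \<longleftrightarrow> x\<^sup>2 + y\<^sup>2 < sqrt (1 - 16 * z\<^sup>2)"
      proof -
        have "sqrt ((x\<^sup>2 + y\<^sup>2)\<^sup>2) = x\<^sup>2 + y\<^sup>2" by simp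
        then show ?thesis using real_sqrt_less_iff[of "(x\<^sup>2 + y\<^sup>2)\<^sup>2" "1 - 16 * z\<^sup>2"] by metis
      qed
      finally show ?thesis using R2 by auto
    qed
    show ?thesis
    proof (cases "R\<^sup>2 - x\<^sup>2 > 0")
      case True
      let ?s = "sqrt (R\<^sup>2 - x\<^sup>2)"
      have "y\<^sup>2 < R\<^sup>2 - x\<^sup>2 \<longleftrightarrow> y \<in> {-?s<..<?s}" for y
        using real_sqrt_less_iff[of "y\<^sup>2" "R\<^sup>2 - x\<^sup>2"] by (auto simp: abs_less_iff)
      then have "(\<integral>\<^sup>+y. ennreal (indicator gauge_ball (x, y, z) * w x) \<partial>lborel) =
          (\<integral>\<^sup>+y. ennreal (w x) * indicator {-?s<..<?s} y \<partial>lborel)"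
        by (intro nn_integral_cong) (auto simp: iff indicator_def)
      also have "\<dots> = ennreal (w x) * ennreal (2 * ?s)"
        using True by (subst nn_integral_cmult) simp_all
      also have "\<dots> = ennreal (w x * (2 * ?s))"
        using True w0[of x] by (intro ennreal_mult[symmetric]) auto
      also have "w x * (2 * ?s) = indicator {-R..R} x * (2 * (w x * ?s))"
      proof -
        have "\<bar>x\<bar> \<le> \<bar>R\<bar>" using True abs_le_square_iff[of x R] by linarith
        then have "x \<in> {-R..R}" using R2(1) by auto
        then show ?thesis by simp
      qed
      finally show ?thesis .
    next
      case False
      then have "indicator gauge_ball (x, y, z) = (0::real)" for y
      proof -
        have "\<not> y\<^sup>2 < R\<^sup>2 - x\<^sup>2" using zero_le_power2[of y] False by linarith
        then show ?thesis by (simp add: iff)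
      qed
      \<comment> \<open>At x = R and x = -R the closed interval still counts the point while the
        chord is empty; both sides agree because the root is 0 there.\<close>
      moreover have "x \<in> {-R..R} \<Longrightarrow> R\<^sup>2 - x\<^sup>2 = 0"
        using False abs_le_square_iff[of x R] R2(1) by (simp add: abs_le_iff)
      ultimately show ?thesis by (auto simp: indicator_def)
    qed
  qed
  have 2: "(\<integral>\<^sup>+x. \<integral>\<^sup>+y. ennreal (indicator gauge_ball (x, y, z) * w x) \<partial>lborel \<partial>lborel) =
      ennreal (indicator {-1/4<..<1/4} z * (2 * I (sqrt (sqrt (1 - 16 * z\<^sup>2)))))" for z
  proof (cases "z \<in> {-1/4<..<1/4}")
    case True
    then have "\<bar>4 * z\<bar> < 1" by auto
    then have z: "16 * z\<^sup>2 < 1" using abs_square_less_1[of "4 * z"] by (simp add: power_mult_distrib)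
    define R where "R = sqrt (sqrt (1 - 16 * z\<^sup>2))"
    have "R > 0" using z by (simp add: R_def)
    \<comment> \<open>\<open>sqrt\<close> of a negative number is negative. The absolute value makes
      the integrand nonnegative on the whole line and changes nothing on the interval.\<close>
    have "(\<integral>\<^sup>+x. ennreal (indicator {-R..R} x * (2 * (w x * sqrt (R\<^sup>2 - x\<^sup>2)))) \<partial>lborel) =
        (\<integral>\<^sup>+x. ennreal (indicator {-R..R} x * (2 * (w x * sqrt \<bar>R\<^sup>2 - x\<^sup>2\<bar>))) \<partial>lborel)"
      by (intro nn_integral_cong) (auto simp: indicator_def abs_le_square_iff[symmetric] abs_le_iff power2_le_iff_abs_le)
    also have "\<dots> = ennreal (2 * I R)"
    proof (rule nn_integral_has_integral_indicator)
      have "((\<lambda>x. 2 * (w x * sqrt (R\<^sup>2 - x\<^sup>2))) has_integral 2 * I R) {-R..R}"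
        using w[OF \<open>R > 0\<close>] by (rule has_integral_mult_right)
      then show "((\<lambda>x. 2 * (w x * sqrt \<bar>R\<^sup>2 - x\<^sup>2\<bar>)) has_integral 2 * I R) {-R..R}"
        by (rule has_integral_eq[rotated]) (auto simp: abs_le_square_iff[symmetric] abs_le_iff)
    qed (use w0 in auto)
    finally show ?thesis using True by (simp add: 1[OF z R_def] R_def)
  next
    case False
    then have "\<not> \<bar>4 * z\<bar> < 1" by auto
    then have "\<not> 16 * z\<^sup>2 < 1" using abs_square_less_1[of "4 * z"] by (simp add: power_mult_distrib)
    then have "(x, y, z) \<notin> gauge_ball" for x y using zero_le_power2[of "x\<^sup>2 + y\<^sup>2"] by (simp add: gauge_ball_def, linarith)
    then show ?thesis using False by simp
  qed
  show ?thesis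
    unfolding nn_integral_lborel_heis'(1)[OF fm] fst_conv 2
    by (rule nn_integral_has_integral_indicator[OF _ _ _ J]) (use I0 in auto)
qed

text \<open>With R^4 = 1 - 16 z^2 the outer integrand is a multiple of R^2 for the volume, again a
  semicircle, and of R^4 for the second moment, a polynomial. The moment in y follows by exchanging
  coordinates.\<close>

lemma gauge_ball_integral:
  shows "(\<integral>p. indicator gauge_ball p \<partial>lborel) = pi\<^sup>2 / 8"
    and "(\<integral>p. indicator gauge_ball p * (fst p)\<^sup>2 \<partial>lborel) = pi / 12"
    and "(\<integral>p. indicator gauge_ball p * (fst (snd p))\<^sup>2 \<partial>lborel) = pi / 12"
proof -
  have u: "1 - 16 * z\<^sup>2 > 0" if "z \<in> {-1/4<..<1/4}" for z :: real
  proof -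
    have "0 < (1 - 4 * z) * (1 + 4 * z)" using that by (intro mult_pos_pos) auto
    then show ?thesis by (simp add: power2_eq_square algebra_simps)
  qed
  have J1: "((\<lambda>z. 2 * (pi * (sqrt (sqrt (1 - 16 * z\<^sup>2)))\<^sup>2 / 2)) has_integral (pi\<^sup>2 / 8)) {-1/4<..<1/4}"
  proof -
    \<comment> \<open>pi sqrt (1 - 16 z^2) is 4 pi times the semicircle of radius 1/4, so the area
      formula is used a second time.\<close>
    have "((\<lambda>z. (4 * pi) * sqrt ((1/4)\<^sup>2 - z\<^sup>2)) has_integral ((4 * pi) * (pi * (1/4)\<^sup>2 / 2))) {-(1/4)..1/4}"
      by (intro has_integral_mult_right has_integral_semicircle) simp
    then have "((\<lambda>z. (4 * pi) * sqrt ((1/4)\<^sup>2 - z\<^sup>2)) has_integral (pi\<^sup>2 / 8)) {-1/4<..<1/4}"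
      unfolding box_real[symmetric] has_integral_open_interval by (simp add: power2_eq_square)
    then show ?thesis
    proof (rule has_integral_eq[rotated])
      fix z :: real assume z: "z \<in> {-1/4<..<1/4}"
      have "sqrt ((1/4)\<^sup>2 - z\<^sup>2) = sqrt ((1 - 16 * z\<^sup>2) / 4\<^sup>2)" by (simp add: field_simps)
      also have "\<dots> = sqrt (1 - 16 * z\<^sup>2) / 4" by (simp only: real_sqrt_divide real_sqrt_abs abs_numeral)
      finally show "(4 * pi) * sqrt ((1/4)\<^sup>2 - z\<^sup>2) = 2 * (pi * (sqrt (sqrt (1 - 16 * z\<^sup>2)))\<^sup>2 / 2)"
        using u[OF z] by simp
    qed
  qed
  have J2: "((\<lambda>z. 2 * (pi * (sqrt (sqrt (1 - 16 * z\<^sup>2))) ^ 4 / 8)) has_integral (pi / 12)) {-1/4<..<1/4}"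
  proof -
    let ?F = "\<lambda>z::real. pi / 4 * (z - 16 / 3 * z ^ 3)"
    have "((\<lambda>z. pi / 4 * (1 - 16 * z\<^sup>2)) has_integral (?F (1/4) - ?F (-(1/4)))) {-(1/4)..1/4}"
      by (rule fundamental_theorem_of_calculus)
        (auto simp: has_real_derivative_iff_has_vector_derivative[symmetric] intro!: derivative_eq_intros)
    then have "((\<lambda>z. pi / 4 * (1 - 16 * z\<^sup>2)) has_integral (pi / 12)) {-1/4<..<1/4}"
      unfolding box_real[symmetric] has_integral_open_interval by (simp add: power3_eq_cube)
    then show ?thesis
    proof (rule has_integral_eq[rotated])
      fix z :: real assume z: "z \<in> {-1/4<..<1/4}"
      have "(sqrt (sqrt (1 - 16 * z\<^sup>2))) ^ 4 = ((sqrt (sqrt (1 - 16 * z\<^sup>2)))\<^sup>2)\<^sup>2" by simp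
      also have "\<dots> = 1 - 16 * z\<^sup>2" using u[OF z] by simp
      finally show "pi / 4 * (1 - 16 * z\<^sup>2) = 2 * (pi * (sqrt (sqrt (1 - 16 * z\<^sup>2))) ^ 4 / 8)" by simp
    qed
  qed
  have "(\<integral>\<^sup>+p. ennreal (indicator gauge_ball p * 1) \<partial>lborel) = ennreal (pi\<^sup>2 / 8)"
    using has_integral_semicircle(1)
    by (intro nn_integral_gauge_ball_moment[where w="\<lambda>_. 1" and I="\<lambda>R. pi * R\<^sup>2 / 2", OF _ _ _ J1]) auto
  then show "(\<integral>p. indicator gauge_ball p \<partial>lborel) = pi\<^sup>2 / 8"
    by (intro integral_eq_nn_integral[THEN trans]) auto
  have "(\<integral>\<^sup>+p. ennreal (indicator gauge_ball p * (fst p)\<^sup>2) \<partial>lborel) = ennreal (pi / 12)"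
    using has_integral_semicircle(2)
    by (intro nn_integral_gauge_ball_moment[where w="\<lambda>x. x\<^sup>2" and I="\<lambda>R. pi * R ^ 4 / 8", OF _ _ _ J2]) auto
  moreover have m: "(\<lambda>p::heis. indicator gauge_ball p * (fst p)\<^sup>2 :: real) \<in> borel_measurable borel"
  proof -
    have [measurable]: "(\<lambda>p::heis. (fst p)\<^sup>2) \<in> borel_measurable borel"
      by (intro borel_measurable_continuous_onI continuous_intros)
    show ?thesis by measurable
  qed
  ultimately show x: "(\<integral>p. indicator gauge_ball p * (fst p)\<^sup>2 \<partial>lborel) = pi / 12"
    by (intro integral_eq_nn_integral[THEN trans]) auto
  have "indicator gauge_ball (fst (snd p), fst p, snd (snd p)) = (indicator gauge_ball p :: real)" for p
    by (auto simp: indicator_def gauge_ball_def gauge4_def' add.commute)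
  then show "(\<integral>p. indicator gauge_ball p * (fst (snd p))\<^sup>2 \<partial>lborel) = pi / 12"
    using integral_heis_reflect(3)[OF m] x by simp
qed

lemma gauge_ball_odd_integral:
  fixes f :: "heis \<Rightarrow> real"
  assumes "continuous_on UNIV f"
    "(\<forall>x y z. f (- x, y, z) = - f (x, y, z)) \<or> (\<forall>x y z. f (x, y, - z) = - f (x, y, z)) \<or> (\<forall>x y z. f (x, - y, z) = - f (x, y, z))"
  shows "(\<integral>p. indicator gauge_ball p * f p \<partial>lborel) = 0"
proof -
  have fm: "f \<in> borel_measurable borel" using assms(1) by (rule borel_measurable_continuous_onI)
  have *: "(\<integral>p. indicator gauge_ball p * f p \<partial>lborel) = 0"
    if "f \<in> borel_measurable borel" "\<And>x y z. f (- x, y, z) = - f (x, y, z)" for f :: "heis \<Rightarrow> real"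
  proof -
    have "(\<lambda>p. indicator gauge_ball p * f p) \<in> borel_measurable borel" using that(1) by measurable
    moreover have "indicator gauge_ball (- fst p, fst (snd p), snd (snd p)) * f (- fst p, fst (snd p), snd (snd p))
        = - (indicator gauge_ball p * f p)" for p
      using that(2)[of "fst p" "fst (snd p)" "snd (snd p)"] by (simp add: indicator_def gauge_ball_def gauge4_def')
    ultimately show ?thesis using integral_heis_reflect(1)[of "\<lambda>p. indicator gauge_ball p * f p"] by simp
  qed
  consider "\<forall>x y z. f (- x, y, z) = - f (x, y, z)" | "\<forall>x y z. f (x, y, - z) = - f (x, y, z)" | "\<forall>x y z. f (x, - y, z) = - f (x, y, z)"
    using assms(2) by blast
  then show ?thesis
  proof cases
    case 1 then show ?thesis by (intro * fm) auto
  next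
    case 2
    have "(\<lambda>p. indicator gauge_ball p * f p) \<in> borel_measurable borel" using fm by measurable
    moreover have "indicator gauge_ball (fst p, fst (snd p), - snd (snd p)) * f (fst p, fst (snd p), - snd (snd p))
        = - (indicator gauge_ball p * f p)" for p
      using 2[rule_format, of "fst p" "fst (snd p)" "snd (snd p)"] by (simp add: indicator_def gauge_ball_def gauge4_def')
    ultimately show ?thesis using integral_heis_reflect(2)[of "\<lambda>p. indicator gauge_ball p * f p"] by simp
  next
    case 3
    \<comment> \<open>A function odd in y becomes odd in x after exchanging the two coordinates,
      which preserves the ball.\<close>
    have m: "(\<lambda>p. indicator gauge_ball p * f p) \<in> borel_measurable borel" using fm by measurable
    have "(\<lambda>p::heis. (fst (snd p), fst p, snd (snd p))) \<in> borel_measurable borel"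
      by (intro borel_measurable_continuous_onI continuous_intros)
    from measurable_compose[OF this fm] have "(\<lambda>p::heis. f (fst (snd p), fst p, snd (snd p))) \<in> borel_measurable borel" .
    then have "(\<integral>p. indicator gauge_ball p * f (fst (snd p), fst p, snd (snd p)) \<partial>lborel) = 0"
      using 3 by (intro *) auto
    moreover have "indicator gauge_ball (fst (snd p), fst p, snd (snd p)) = (indicator gauge_ball p :: real)" for p
      by (auto simp: indicator_def gauge_ball_def gauge4_def' add.commute)
    ultimately show ?thesis using integral_heis_reflect(3)[OF m] by simp
  qed
qed

section \<open>Averages over gauge balls\<close>

lemma open_heis_mult_dil_vimage: "open D \<Longrightarrow> open ((\<lambda>p. heis_mult q (heis_dil t p)) -` D)"
  by (intro open_vimage continuous_intros)

lemma heis_ball_eq: "0 < r \<Longrightarrow> heis_ball q r = (\<lambda>p. heis_mult q (heis_dil r p)) ` gauge_ball"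
proof (intro set_eqI iffI)
  fix p assume r: "0 < r" and p: "p \<in> heis_ball q r"
  let ?x = "heis_dil (1 / r) (heis_mult (heis_inv q) p)"
  have "heis_mult q (heis_dil r ?x) = p" using r by (simp add: heis_dil_dil)
  moreover have "?x \<in> gauge_ball"
    using p r by (simp add: heis_ball_iff gauge_ball_def gauge4_dil power_divide divide_less_eq)
  ultimately show "p \<in> (\<lambda>p. heis_mult q (heis_dil r p)) ` gauge_ball" by (metis imageI)
next
  fix p assume "0 < r" "p \<in> (\<lambda>p. heis_mult q (heis_dil r p)) ` gauge_ball"
  then obtain x where x: "p = heis_mult q (heis_dil r x)" "gauge4 x < 1" "0 < r" by (auto simp: gauge_ball_def)
  then have "r ^ 4 * gauge4 x < r ^ 4" by simp
  then show "p \<in> heis_ball q r" by (simp only: x heis_ball_iff[OF x(3)] heis_mult_inv_cancel gauge4_dil)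
qed

lemma heis_ball_subset_cball:
  assumes "0 < r" "r \<le> 1"
  shows "heis_ball q r \<subseteq> cball q (r * (3 + norm q))"
  using assms dist_heis_mult_dil[of _ r q] by (auto simp: heis_ball_eq gauge_ball_def)

lemma open_heis_ball: "0 < r \<Longrightarrow> open (heis_ball q r)"
proof -
  assume r: "0 < r"
  have "heis_ball q r = {p. gauge4 (heis_mult (heis_inv q) p) < r ^ 4}" using heis_ball_iff[OF r, of _ q] by blast
  also have "open \<dots>"
    by (intro open_Collect_less continuous_on_compose2[OF continuous_on_gauge4[of UNIV]] continuous_intros) auto
  finally show ?thesis .
qed

lemma eventually_at_right_mult_less:
  fixes c e :: real assumes "c > 0" "e > 0"
  shows "\<forall>\<^sub>F r in at_right 0. 0 < r \<and> r \<le> 1 \<and> r * c < e"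
proof -
  have "\<forall>\<^sub>F r in at_right (0::real). r \<in> {0<..<min 1 (e / c)}"
    using assms by (intro eventually_at_right_real) simp
  then show ?thesis using assms by (auto elim!: eventually_mono simp: field_simps)
qed

text \<open>The intermediate closed Euclidean ball supplies the compactness that makes a function
  continuous on \<open>D\<close> integrable over the gauge ball.\<close>

lemma eventually_heis_ball_subset:
  assumes "open D" "q \<in> D"
  shows "\<forall>\<^sub>F r in at_right 0. 0 < r \<and> r \<le> 1 \<and> (\<exists>e. cball q e \<subseteq> D \<and> heis_ball q r \<subseteq> cball q e)"
proof -
  obtain e where e: "e > 0" "cball q e \<subseteq> D" using assms open_contains_cball by blast
  have "3 + norm q > 0" using norm_ge_zero[of q] by linarith
  from eventually_at_right_mult_less[OF this e(1)] show ?thesis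
  proof (rule eventually_mono)
    fix r assume r: "0 < r \<and> r \<le> 1 \<and> r * (3 + norm q) < e"
    then have "heis_ball q r \<subseteq> cball q e"
      using heis_ball_subset_cball[of r q] subset_cball[of "r * (3 + norm q)" e q] by auto
    then show "0 < r \<and> r \<le> 1 \<and> (\<exists>e. cball q e \<subseteq> D \<and> heis_ball q r \<subseteq> cball q e)" using r e by blast
  qed
qed

lemma integrable_heis_ball:
  fixes f :: "heis \<Rightarrow> real"
  assumes "continuous_on (cball q e) f" "heis_ball q r \<subseteq> cball q e" "0 < r"
  shows "set_integrable lborel (heis_ball q r) f"
proof -
  have "set_integrable lborel (cball q e) f"
    unfolding set_integrable_def by (rule borel_integrable_compact) (use assms in auto)
  then show ?thesis by (rule set_integrable_subset) (use assms open_heis_ball in auto)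
qed

text \<open>Translation and dilation carry the ball to the fixed unit ball, so the radius survives
  only in the integrand. Measurability is recorded alongside because \<open>f\<close> is controlled
  on \<open>cball q e\<close> only.\<close>

lemma heis_avg_eq:
  assumes "continuous_on (cball q e) f" "heis_ball q r \<subseteq> cball q e" "0 < r"
  shows "heis_avg f r q = (\<integral>p. indicator gauge_ball p * f (heis_mult q (heis_dil r p)) \<partial>lborel) / (pi\<^sup>2 / 8)"
    and "(\<lambda>p. indicator gauge_ball p * f (heis_mult q (heis_dil r p))) \<in> borel_measurable borel"
proof -
  have s: "heis_ball q r \<in> sets borel" using open_heis_ball[OF assms(3)] by simp
  have i: "indicator (heis_ball q r) (heis_mult q (heis_dil r p)) = (indicator gauge_ball p :: real)" for p
    using assms(3) by (auto simp: indicator_def heis_ball_iff gauge_ball_def gauge4_dil mult_less_cancel_left1)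
  have m: "(\<lambda>p. indicator (heis_ball q r) p *\<^sub>R f p) \<in> borel_measurable borel"
    by (rule borel_measurable_continuous_on_indicator[OF s]) (use assms continuous_on_subset in blast)
  from integral_heis_mult_dil[OF m, of r q] assms(3)
  have 1: "(LINT p:heis_ball q r|lborel. f p) = r ^ 4 * (\<integral>p. indicator gauge_ball p * f (heis_mult q (heis_dil r p)) \<partial>lborel)"
    by (simp add: set_lebesgue_integral_def i)
  have "measure lborel (heis_ball q r) = (\<integral>p. indicator (heis_ball q r) p \<partial>lborel)" using s by simp
  also have "\<dots> = r ^ 4 * (\<integral>p. indicator gauge_ball p \<partial>lborel)"
    using integral_heis_mult_dil[of "indicator (heis_ball q r)" r q] s assms(3) by (simp add: i)
  finally have 2: "measure lborel (heis_ball q r) = r ^ 4 * (pi\<^sup>2 / 8)" unfolding gauge_ball_integral .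
  show "heis_avg f r q = (\<integral>p. indicator gauge_ball p * f (heis_mult q (heis_dil r p)) \<partial>lborel) / (pi\<^sup>2 / 8)"
    unfolding heis_avg_def 1 2 using assms(3) by simp
  from measurable_compose[OF borel_measurable_heis_mult_dil m, of q r]
  show "(\<lambda>p. indicator gauge_ball p * f (heis_mult q (heis_dil r p))) \<in> borel_measurable borel"
    by (simp add: i)
qed

lemma heis_avg_mono:
  assumes "continuous_on (cball q e) f" "continuous_on (cball q e) g" "heis_ball q r \<subseteq> cball q e" "0 < r"
    "\<And>p. p \<in> heis_ball q r \<Longrightarrow> f p \<le> g p"
  shows "heis_avg f r q \<le> heis_avg g r q"
  unfolding heis_avg_def
  using assms integrable_heis_ball[of q e _ r]
  by (intro divide_right_mono set_integral_mono) auto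

text \<open>The coordinate \<open>z\<close> has weight two under dilations, so only its first derivative enters at second
  order.\<close>

lemma heis_taylor:
  assumes U: "open U" "(0, 0, 0) \<in> U" and g: "Ck_on 2 g U"
  defines "D1 \<equiv> partial_deriv (1, 0, 0)" and "D2 \<equiv> partial_deriv (0, 1, 0)" and "D3 \<equiv> partial_deriv (0, 0, 1)"
  defines "R \<equiv> \<lambda>t p. g (heis_dil t p) - g (0, 0, 0) - t * (fst p * D1 g (0, 0, 0) + fst (snd p) * D2 g (0, 0, 0))"
  obtains C d where "d > 0" "\<And>t p. gauge4 p \<le> 1 \<Longrightarrow> 0 < t \<Longrightarrow> t < d \<Longrightarrow> \<bar>R t p\<bar> \<le> C * t\<^sup>2"
    "\<And>p. gauge4 p \<le> 1 \<Longrightarrow> ((\<lambda>t. R t p / t\<^sup>2) \<longlongrightarrow>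
      ((fst p)\<^sup>2 * D1 (D1 g) (0, 0, 0) + fst p * fst (snd p) * (D2 (D1 g) (0, 0, 0) + D1 (D2 g) (0, 0, 0))
       + (fst (snd p))\<^sup>2 * D2 (D2 g) (0, 0, 0)) / 2 + snd (snd p) * D3 g (0, 0, 0)) (at_right 0)"
proof -
  let ?o = "(0, 0, 0) :: heis"
  have g1: "Ck_on (Suc 1) g U" using g by (simp add: numeral_2_eq_2)
  have D: "Ck_on 1 (D1 g) U" "Ck_on 1 (D2 g) U" "Ck_on 1 (D3 g) U"
    unfolding D1_def D2_def D3_def by (intro Ck_on_partial[OF g1]; simp add: Basis_heis)+
  obtain e0 where e0: "e0 > 0" "cball ?o e0 \<subseteq> U" using U open_contains_cball by blast
  obtain K where K: "K \<ge> 0" "\<And>p. p \<in> cball ?o e0 \<Longrightarrow> \<bar>D3 g p\<bar> \<le> K"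
    using continuous_on_compact_abs_bound[OF compact_cball continuous_on_subset[OF Ck_on_continuous[OF D(3)] e0(2)]]
    by blast
  \<comment> \<open>Growth at the single point 0 is what matters: differentiability there bounds
    increments from 0 linearly.\<close>
  have lip: "\<exists>L e. L \<ge> 0 \<and> e > 0 \<and> (\<forall>p. norm p \<le> e \<longrightarrow> \<bar>h p - h ?o\<bar> \<le> L * norm p)" if h: "Ck_on 1 h U" for h
  proof -
    obtain h' where h': "(h has_derivative h') (at ?o)"
      using Ck_on_has_derivative_ex[OF h[unfolded One_nat_def] U(2)] by blast
    then interpret bounded_linear h' by (rule has_derivative_bounded_linear)
    obtain B where B: "\<And>x. norm (h' x) \<le> norm x * B" using bounded by blast
    from h' obtain d where d: "d > 0" "\<And>y. norm (y - ?o) < d \<Longrightarrow> norm (h y - h ?o - h' (y - ?o)) \<le> 1 * norm (y - ?o)"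
      unfolding has_derivative_at_alt using zero_less_one by metis
    have "\<bar>h p - h ?o\<bar> \<le> (\<bar>B\<bar> + 1) * norm p" if "norm p \<le> d / 2" for p
    proof -
      have p0: "p - ?o = p" by (cases p) simp
      have "norm p < d" using that d(1) by linarith
      then have "\<bar>h p - h ?o - h' p\<bar> \<le> norm p" using d(2)[of p] p0 by simp
      moreover have "\<bar>h' p\<bar> \<le> norm p * \<bar>B\<bar>" using B[of p] by (metis abs_ge_self dual_order.trans mult_left_mono norm_ge_zero real_norm_def)
      ultimately show ?thesis by (simp add: algebra_simps)
    qed
    then show ?thesis using d(1) by (intro exI[of _ "\<bar>B\<bar> + 1"] exI[of _ "d / 2"]) auto
  qed
  obtain L1 e1 where L1: "L1 \<ge> 0" "e1 > 0" "\<And>p. norm p \<le> e1 \<Longrightarrow> \<bar>D1 g p - D1 g ?o\<bar> \<le> L1 * norm p"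
    using lip[OF D(1)] by metis
  obtain L2 e2 where L2: "L2 \<ge> 0" "e2 > 0" "\<And>p. norm p \<le> e2 \<Longrightarrow> \<bar>D2 g p - D2 g ?o\<bar> \<le> L2 * norm p"
    using lip[OF D(2)] by metis
  define d where "d = min 1 (min e0 (min e1 e2) / 3)"
  have d: "d > 0" using e0 L1 L2 by (auto simp: d_def)
  have near: "norm (heis_dil t p) \<le> 3 * t" "norm (heis_dil t p) \<le> e0" "norm (heis_dil t p) \<le> e1"
     "norm (heis_dil t p) \<le> e2" "heis_dil t p \<in> U"
    if "gauge4 p \<le> 1" "0 \<le> t" "t < d" for t p
  proof -
    have "norm (heis_dil t p) \<le> t * (3 + norm ?o)"
      using dist_heis_mult_dil[OF that(1,2), of ?o] that(3) 
      by (simp add: d_def heis_mult_zero_left dist_norm) (metis diff_zero norm_minus_commute zero_prod_def)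
    then show 1: "norm (heis_dil t p) \<le> 3 * t" by (simp add: norm_Pair)
    have "3 * t \<le> min e0 (min e1 e2)" using that(3) by (simp add: d_def)
    then show "norm (heis_dil t p) \<le> e0" "norm (heis_dil t p) \<le> e1" "norm (heis_dil t p) \<le> e2"
      using 1 by auto
    then have "heis_dil t p \<in> cball ?o e0" by (simp add: zero_prod_def[symmetric])
    then show "heis_dil t p \<in> U" using e0(2) by blast
  qed
  \<comment> \<open>Derivative of \<open>g\<close> along the dilation curve through
    \<open>p\<close>. The last term carries a factor t because z has weight two.\<close>
  define \<psi> where "\<psi> t p = fst p * D1 g (heis_dil t p) + fst (snd p) * D2 g (heis_dil t p)
      + 2 * t * snd (snd p) * D3 g (heis_dil t p)" for t p
  have dil': "((\<lambda>t. heis_dil t p) has_derivative (\<lambda>s. (s * fst p, s * fst (snd p), s * (2 * t * snd (snd p))))) (at t)" for t p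
    unfolding heis_dil_def' by (auto intro!: derivative_eq_intros simp: algebra_simps)
  have dg: "((\<lambda>t. g (heis_dil t p)) has_real_derivative \<psi> t p) (at t)" if "heis_dil t p \<in> U" for t p
    unfolding has_field_derivative_def
    by (rule has_derivative_eq_rhs[OF has_derivative_compose[OF dil' heis_has_derivative[OF g1 that]]])
      (simp add: fun_eq_iff \<psi>_def D1_def D2_def D3_def algebra_simps)
  have dR: "((\<lambda>t. R t p) has_real_derivative \<psi> t p - \<psi> 0 p) (at t)" if "heis_dil t p \<in> U" for t p
    unfolding R_def using dg[OF that] by (auto intro!: derivative_eq_intros simp: \<psi>_def)
  have R0: "R 0 p = 0" for p by (simp add: R_def)
  define C where "C = 3 * L1 + 3 * L2 + 2 * K"
  have \<psi>: "\<bar>\<psi> t p - \<psi> 0 p\<bar> \<le> C * t" if "gauge4 p \<le> 1" "0 \<le> t" "t < d" for t p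
  proof -
    note n = near[OF that]
    have co: "\<bar>fst p\<bar> \<le> 1" "\<bar>fst (snd p)\<bar> \<le> 1" "\<bar>snd (snd p)\<bar> \<le> 1"
      using gauge4_le_1D[of "fst p" "fst (snd p)" "snd (snd p)"] that(1) by auto
    have "\<bar>D1 g (heis_dil t p) - D1 g ?o\<bar> \<le> L1 * (3 * t)"
      using L1(3)[OF n(3)] mult_left_mono[OF n(1) L1(1)] by linarith
    then have 1: "\<bar>fst p * (D1 g (heis_dil t p) - D1 g ?o)\<bar> \<le> 1 * (L1 * (3 * t))"
      unfolding abs_mult using co by (intro mult_mono) auto
    have "\<bar>D2 g (heis_dil t p) - D2 g ?o\<bar> \<le> L2 * (3 * t)"
      using L2(3)[OF n(4)] mult_left_mono[OF n(1) L2(1)] by linarith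
    then have 2: "\<bar>fst (snd p) * (D2 g (heis_dil t p) - D2 g ?o)\<bar> \<le> 1 * (L2 * (3 * t))"
      unfolding abs_mult using co by (intro mult_mono) auto
    have "\<bar>D3 g (heis_dil t p)\<bar> \<le> K" using n(2) by (intro K(2)) (simp add: zero_prod_def[symmetric])
    then have "\<bar>snd (snd p)\<bar> * \<bar>D3 g (heis_dil t p)\<bar> \<le> 1 * K"
      using co K(1) by (intro mult_mono) auto
    then have "(2 * t) * \<bar>snd (snd p) * D3 g (heis_dil t p)\<bar> \<le> (2 * t) * K"
      unfolding abs_mult using that by (intro mult_left_mono) auto
    then have 3: "\<bar>2 * t * snd (snd p) * D3 g (heis_dil t p)\<bar> \<le> 2 * t * K"
      using that by (simp add: abs_mult mult.assoc)
    have "\<psi> t p - \<psi> 0 p = fst p * (D1 g (heis_dil t p) - D1 g ?o)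
       + fst (snd p) * (D2 g (heis_dil t p) - D2 g ?o) + 2 * t * snd (snd p) * D3 g (heis_dil t p)"
      by (simp add: \<psi>_def algebra_simps)
    also have "\<bar>\<dots>\<bar> \<le> 1 * (L1 * (3 * t)) + 1 * (L2 * (3 * t)) + 2 * t * K"
      using 1 2 3 by linarith
    finally show ?thesis by (simp add: C_def algebra_simps)
  qed
  have C0: "C \<ge> 0" using L1 L2 K by (simp add: C_def)
  show thesis
  proof (rule that[OF d])
    fix t p assume p: "gauge4 p \<le> 1" and t: "0 < t" "t < d"
    \<comment> \<open>Mean value theorem: \<open>R\<close> vanishes at 0 and its derivative
      \<open>\<psi> t p - \<psi> 0 p\<close> is O(t) uniformly over the ball, so \<open>R\<close> is
      O(t^2) uniformly.\<close>
    have "\<exists>z. 0 < z \<and> z < t \<and> R t p - R 0 p = (t - 0) * (\<psi> z p - \<psi> 0 p)"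
      by (rule MVT2[OF t(1)]) (use dR near(5)[OF p] t in auto)
    then obtain z where z: "0 < z" "z < t" "R t p = t * (\<psi> z p - \<psi> 0 p)" using R0 by auto
    have "\<bar>\<psi> z p - \<psi> 0 p\<bar> \<le> C * t" using \<psi>[OF p, of z] z t mult_left_mono[of z t C] C0 by force
    then have "\<bar>t\<bar> * \<bar>\<psi> z p - \<psi> 0 p\<bar> \<le> \<bar>t\<bar> * (C * t)" by (intro mult_left_mono) auto
    then show "\<bar>R t p\<bar> \<le> C * t\<^sup>2" using t unfolding z(3) abs_mult by (simp add: power2_eq_square mult_ac)
  next
    fix p assume p: "gauge4 p \<le> 1"
    let ?L = "(fst p)\<^sup>2 * D1 (D1 g) ?o + fst p * fst (snd p) * (D2 (D1 g) ?o + D1 (D2 g) ?o)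
       + (fst (snd p))\<^sup>2 * D2 (D2 g) ?o + 2 * (snd (snd p) * D3 g ?o)"
    have dh: "((\<lambda>t. h (heis_dil t p)) has_real_derivative fst p * D1 h ?o + fst (snd p) * D2 h ?o) (at 0)"
      if "Ck_on 1 h U" for h
      unfolding has_field_derivative_def
      by (rule has_derivative_eq_rhs[OF has_derivative_compose[OF dil'[of p 0] heis_has_derivative[of 0 h U "heis_dil 0 p"]]])
        (use that U(2) in \<open>simp_all del: Ck_on.simps add: fun_eq_iff D1_def D2_def D3_def algebra_simps\<close>)
    have lim3: "(\<lambda>t. D3 g (heis_dil t p)) \<midarrow>0\<rightarrow> D3 g ?o"
    proof -
      have "isCont (\<lambda>t. heis_dil t p) 0" using has_derivative_continuous[OF dil'[of p 0]] by simp
      moreover have "isCont (D3 g) (heis_dil 0 p)"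
        using Ck_on_continuous[OF D(3)] U by (simp add: continuous_on_eq_continuous_at)
      ultimately have "isCont (\<lambda>t. D3 g (heis_dil t p)) 0" by (rule isCont_o2)
      then show ?thesis by (simp add: isCont_def)
    qed
    have "((\<lambda>t. (\<psi> t p - \<psi> 0 p) / t) \<longlongrightarrow> ?L) (at 0)"
    proof -
      have a: "(\<lambda>t. (D1 g (heis_dil t p) - D1 g ?o) / t) \<midarrow>0\<rightarrow> fst p * D1 (D1 g) ?o + fst (snd p) * D2 (D1 g) ?o"
        using dh[OF D(1)] by (simp add: has_field_derivative_iff)
      have b: "(\<lambda>t. (D2 g (heis_dil t p) - D2 g ?o) / t) \<midarrow>0\<rightarrow> fst p * D1 (D2 g) ?o + fst (snd p) * D2 (D2 g) ?o"
        using dh[OF D(2)] by (simp add: has_field_derivative_iff)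
      have "(\<lambda>t. fst p * ((D1 g (heis_dil t p) - D1 g ?o) / t) + fst (snd p) * ((D2 g (heis_dil t p) - D2 g ?o) / t)
         + 2 * snd (snd p) * D3 g (heis_dil t p)) \<midarrow>0\<rightarrow>
         fst p * (fst p * D1 (D1 g) ?o + fst (snd p) * D2 (D1 g) ?o) +
         fst (snd p) * (fst p * D1 (D2 g) ?o + fst (snd p) * D2 (D2 g) ?o) + 2 * snd (snd p) * D3 g ?o"
        by (intro tendsto_intros a b lim3)
      moreover have "\<forall>\<^sub>F t in at 0. fst p * ((D1 g (heis_dil t p) - D1 g ?o) / t) + fst (snd p) * ((D2 g (heis_dil t p) - D2 g ?o) / t)
         + 2 * snd (snd p) * D3 g (heis_dil t p) = (\<psi> t p - \<psi> 0 p) / t"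
        unfolding eventually_at_filter by (intro always_eventually) (simp add: \<psi>_def field_simps)
      ultimately have "((\<lambda>t. (\<psi> t p - \<psi> 0 p) / t) \<longlongrightarrow> fst p * (fst p * D1 (D1 g) ?o + fst (snd p) * D2 (D1 g) ?o) +
         fst (snd p) * (fst p * D1 (D2 g) ?o + fst (snd p) * D2 (D2 g) ?o) + 2 * snd (snd p) * D3 g ?o) (at 0)"
        by (rule Lim_transform_eventually)
      then show ?thesis by (simp add: algebra_simps power2_eq_square)
    qed
    then have "((\<lambda>t. (\<psi> t p - \<psi> 0 p) / t) \<longlongrightarrow> ?L) (at_right 0)"
      by (rule tendsto_within_subset) simp
    then have "((\<lambda>t. (\<psi> t p - \<psi> 0 p) / t / 2) \<longlongrightarrow> ?L / 2) (at_right 0)"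
      by (intro tendsto_divide tendsto_const) auto
    then have lim: "((\<lambda>t. (\<psi> t p - \<psi> 0 p) / (2 * t)) \<longlongrightarrow> ?L / 2) (at_right 0)" by (simp add: mult.commute)
    have "\<forall>\<^sub>F t in at_right 0. 0 < t \<and> t < d" using d by (auto simp: eventually_at_right_field)
    then have ev: "\<forall>\<^sub>F t in at_right 0. ((\<lambda>t. R t p) has_real_derivative \<psi> t p - \<psi> 0 p) (at t)"
      by (rule eventually_mono) (use dR near(5)[OF p] in auto)
    have Rlim: "((\<lambda>t. R t p) \<longlongrightarrow> 0) (at_right 0)"
    proof -
      have "isCont (\<lambda>t. R t p) 0" using DERIV_isCont[OF dR[of 0 p]] U by simp
      then have "(\<lambda>t. R t p) \<midarrow>0\<rightarrow> 0" using R0 by (simp add: isCont_def)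
      then show ?thesis by (rule tendsto_within_subset) simp
    qed
    \<comment> \<open>One application of L'Hopital reduces the quotient to half the difference
      quotient of \<open>\<psi>\<close> at 0, whose limit has just been found.\<close>
    have "((\<lambda>t. R t p / t\<^sup>2) \<longlongrightarrow> ?L / 2) (at_right 0)"
    proof (rule lhopital_right_0[OF Rlim _ _ _ ev _ lim])
      show "((\<lambda>t::real. t\<^sup>2) \<longlongrightarrow> 0) (at_right 0)" by (rule tendsto_eq_intros refl | simp)+
      show "\<forall>\<^sub>F t in at_right (0::real). t\<^sup>2 \<noteq> 0" "\<forall>\<^sub>F t in at_right (0::real). 2 * t \<noteq> 0"
        by (auto simp: eventually_at_filter)
      show "\<forall>\<^sub>F t in at_right (0::real). ((\<lambda>t. t\<^sup>2) has_real_derivative 2 * t) (at t)"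
        by (intro always_eventually allI) (auto intro!: derivative_eq_intros)
    qed
    then show "((\<lambda>t. R t p / t\<^sup>2) \<longlongrightarrow>
      ((fst p)\<^sup>2 * D1 (D1 g) ?o + fst p * fst (snd p) * (D2 (D1 g) ?o + D1 (D2 g) ?o)
       + (fst (snd p))\<^sup>2 * D2 (D2 g) ?o) / 2 + snd (snd p) * D3 g ?o) (at_right 0)"
      by (simp add: add_divide_distrib)
  qed
qed

lemma at_right_eq_Ioo: "0 < d \<Longrightarrow> at_right (0::real) = at 0 within {0<..<d}"
  by (rule at_within_nhd[of 0 "{..<d}"]) auto

text \<open>Over the unit ball the remainder of \<open>heis_taylor\<close>, divided by r^2, is
  bounded and converges pointwise. The linear, xy and z terms are odd and integrate to zero; each
  square contributes pi/12 over the volume pi^2/8, and the factor 1/2 leaves 1/(3 pi). The local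
  form is needed because test functions are regular on \<open>D\<close> only.\<close>

lemma heis_avg_tendsto:
  assumes D: "open D" "q \<in> D" and v: "Ck_on 2 v D"
  shows "((\<lambda>r. (heis_avg v r q - v q) / r\<^sup>2) \<longlongrightarrow> heis_laplacian v q / (3 * pi)) (at_right 0)"
proof -
  let ?o = "(0, 0, 0) :: heis"
  \<comment> \<open>Pulling back to the origin makes the sub-Laplacian a sum of two pure second
    derivatives. The dilation by 1 is kept so that the lemmas on
    \<open>heis_mult q (heis_dil t p)\<close> cover plain left translation.\<close>
  define U where "U = (\<lambda>p. heis_mult q (heis_dil 1 p)) -` D"
  define g where "g = (\<lambda>p. v (heis_mult q (heis_dil 1 p)))"
  have U: "open U" "?o \<in> U" using D open_heis_mult_dil_vimage[OF D(1), of q 1] by (simp_all add: U_def heis_mult_zero_right)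
  have g: "Ck_on 2 g U" unfolding g_def by (rule Ck_on_heis_mult_dil[OF U(1) _ v]) (auto simp: U_def)
  have go: "g ?o = v q" by (simp add: g_def heis_mult_zero_right)
  define lin where "lin p = fst p * partial_deriv (1, 0, 0) g ?o + fst (snd p) * partial_deriv (0, 1, 0) g ?o" for p :: heis
  define R where "R t p = g (heis_dil t p) - g ?o - t * lin p" for t p
  define a where "a = partial_deriv (1, 0, 0) (partial_deriv (1, 0, 0) g) ?o"
  define b where "b = partial_deriv (0, 1, 0) (partial_deriv (1, 0, 0) g) ?o + partial_deriv (1, 0, 0) (partial_deriv (0, 1, 0) g) ?o"
  define c where "c = partial_deriv (0, 1, 0) (partial_deriv (0, 1, 0) g) ?o"
  define e where "e = partial_deriv (0, 0, 1) g ?o"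
  obtain C d where d: "d > 0" and C: "\<And>t p. gauge4 p \<le> 1 \<Longrightarrow> 0 < t \<Longrightarrow> t < d \<Longrightarrow> \<bar>R t p\<bar> \<le> C * t\<^sup>2"
    and lim: "\<And>p. gauge4 p \<le> 1 \<Longrightarrow> ((\<lambda>t. R t p / t\<^sup>2) \<longlongrightarrow>
      ((fst p)\<^sup>2 * a + fst p * fst (snd p) * b + (fst (snd p))\<^sup>2 * c) / 2 + snd (snd p) * e) (at_right 0)"
  proof (rule heis_taylor[OF U g])
    fix C d
    assume "0 < d"
      "\<And>t p. gauge4 p \<le> 1 \<Longrightarrow> 0 < t \<Longrightarrow> t < d \<Longrightarrow> \<bar>g (heis_dil t p) - g ?o - t * (fst p * partial_deriv (1, 0, 0) g ?o
        + fst (snd p) * partial_deriv (0, 1, 0) g ?o)\<bar> \<le> C * t\<^sup>2"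
      "\<And>p. gauge4 p \<le> 1 \<Longrightarrow> ((\<lambda>t. (g (heis_dil t p) - g ?o - t * (fst p * partial_deriv (1, 0, 0) g ?o
        + fst (snd p) * partial_deriv (0, 1, 0) g ?o)) / t\<^sup>2) \<longlongrightarrow>
        ((fst p)\<^sup>2 * partial_deriv (1, 0, 0) (partial_deriv (1, 0, 0) g) ?o + fst p * fst (snd p) *
        (partial_deriv (0, 1, 0) (partial_deriv (1, 0, 0) g) ?o + partial_deriv (1, 0, 0) (partial_deriv (0, 1, 0) g) ?o)
        + (fst (snd p))\<^sup>2 * partial_deriv (0, 1, 0) (partial_deriv (0, 1, 0) g) ?o) / 2
        + snd (snd p) * partial_deriv (0, 0, 1) g ?o) (at_right 0)"
    then show thesis
      by (rule that[unfolded R_def lin_def a_def b_def c_def e_def])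
  qed
  let ?Q = "\<lambda>p. ((fst p)\<^sup>2 * a + fst p * fst (snd p) * b + (fst (snd p))\<^sup>2 * c) / 2 + snd (snd p) * e"
  have int: "integrable lborel (\<lambda>p. indicator gauge_ball p * f p)" if "continuous_on UNIV f" for f :: "heis \<Rightarrow> real"
    by (rule integrable_mult_support[OF compact_gauge_cball, of _ 1])
      (use gauge_ball_subset continuous_on_subset[OF that] in \<open>auto simp: indicator_def\<close>)
  have lin0: "(\<integral>p. indicator gauge_ball p * lin p \<partial>lborel) = 0"
  proof -
    have "(\<integral>p. indicator gauge_ball p * fst p \<partial>lborel) = 0" "(\<integral>p. indicator gauge_ball p * fst (snd p) \<partial>lborel) = 0"
      by (intro gauge_ball_odd_integral continuous_intros; simp)+
    moreover have "(\<lambda>p. indicator gauge_ball p * lin p) = (\<lambda>p. (indicator gauge_ball p * fst p) * partial_deriv (1, 0, 0) g ?o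
        + (indicator gauge_ball p * fst (snd p)) * partial_deriv (0, 1, 0) g ?o)"
      by (auto simp: lin_def algebra_simps)
    ultimately show ?thesis
      by (simp add: int continuous_intros)
  qed
  have Q: "(\<integral>p. indicator gauge_ball p * ?Q p \<partial>lborel) = (a + c) * pi / 24"
  proof -
    have "(\<integral>p. indicator gauge_ball p * (fst p * fst (snd p)) \<partial>lborel) = 0" "(\<integral>p. indicator gauge_ball p * snd (snd p) \<partial>lborel) = 0"
      by (intro gauge_ball_odd_integral continuous_intros; simp)+
    moreover have "(\<lambda>p. indicator gauge_ball p * ?Q p) = (\<lambda>p. (indicator gauge_ball p * (fst p)\<^sup>2) * (a / 2)
        + (indicator gauge_ball p * (fst p * fst (snd p))) * (b / 2) + (indicator gauge_ball p * (fst (snd p))\<^sup>2) * (c / 2)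
        + (indicator gauge_ball p * snd (snd p)) * e)"
      by (auto simp: field_simps)
    ultimately show ?thesis
      by (simp add: int continuous_intros gauge_ball_integral) (simp add: field_simps)
  qed
  have "\<forall>\<^sub>F r in at_right 0. 0 < r \<and> r < d" using d by (auto simp: eventually_at_right_field)
  with eventually_heis_ball_subset[OF D]
  have ev: "\<forall>\<^sub>F r in at_right 0. (\<lambda>p. indicator gauge_ball p * (R r p / r\<^sup>2)) \<in> borel_measurable borel \<and>
    (heis_avg v r q - v q) / r\<^sup>2 = (\<integral>p. indicator gauge_ball p * (R r p / r\<^sup>2) \<partial>lborel) / (pi\<^sup>2 / 8)"
  proof eventually_elim
    case (elim r)
    then obtain e where r: "0 < r" "r < d" "cball q e \<subseteq> D" "heis_ball q r \<subseteq> cball q e" by blast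
    have cv: "continuous_on (cball q e) v" using Ck_on_continuous[OF v] r continuous_on_subset by blast
    have gd: "g (heis_dil r p) = v (heis_mult q (heis_dil r p))" for p by (simp add: g_def)
    note avg = heis_avg_eq[OF cv r(4,1), folded gd]
    have "(\<lambda>p. indicator gauge_ball p * lin p) \<in> borel_measurable borel"
      using int[of lin] by (simp add: lin_def continuous_intros)
    then have "(\<lambda>p. (indicator gauge_ball p * g (heis_dil r p) - indicator gauge_ball p * g ?o - r * (indicator gauge_ball p * lin p)) / r\<^sup>2) \<in> borel_measurable borel"
      using avg(2) by simp
    moreover have Req: "(\<lambda>p. (indicator gauge_ball p * g (heis_dil r p) - indicator gauge_ball p * g ?o - r * (indicator gauge_ball p * lin p)) / r\<^sup>2) = (\<lambda>p. indicator gauge_ball p * (R r p / r\<^sup>2))"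
      by (auto simp: R_def algebra_simps)
    ultimately have m: "(\<lambda>p. indicator gauge_ball p * (R r p / r\<^sup>2)) \<in> borel_measurable borel" by simp
    have i1: "integrable lborel (\<lambda>p. indicator gauge_ball p * (R r p / r\<^sup>2))"
    proof (rule integrable_bounded_compact[OF compact_gauge_cball m, of C])
      fix p assume "p \<in> gauge_cball"
      then have C': "\<bar>R r p / r\<^sup>2\<bar> \<le> C" using C[of p r] r by (simp add: gauge_cball_def divide_le_eq abs_divide)
      then show "\<bar>indicator gauge_ball p * (R r p / r\<^sup>2)\<bar> \<le> C"
        using order_trans[OF abs_ge_zero C'] by (auto simp: indicator_def)
    qed (use gauge_ball_subset in \<open>auto simp: indicator_def split: if_splits\<close>)
    have "(\<integral>p. indicator gauge_ball p * g (heis_dil r p) \<partial>lborel) =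
      (\<integral>p. r\<^sup>2 * (indicator gauge_ball p * (R r p / r\<^sup>2)) + indicator gauge_ball p * g ?o + r * (indicator gauge_ball p * lin p) \<partial>lborel)"
    proof (intro Bochner_Integration.integral_cong refl)
      fix p
      have e: "r\<^sup>2 * (indicator gauge_ball p * (R r p / r\<^sup>2)) = indicator gauge_ball p * R r p" using r by simp
      show "indicator gauge_ball p * g (heis_dil r p) = r\<^sup>2 * (indicator gauge_ball p * (R r p / r\<^sup>2)) + indicator gauge_ball p * g ?o + r * (indicator gauge_ball p * lin p)"
        unfolding e by (simp add: R_def algebra_simps)
    qed
    also have "\<dots> = r\<^sup>2 * (\<integral>p. indicator gauge_ball p * (R r p / r\<^sup>2) \<partial>lborel) + pi\<^sup>2 / 8 * g ?o"
    proof -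
      have A: "integrable lborel (\<lambda>p. r\<^sup>2 * (indicator gauge_ball p * (R r p / r\<^sup>2)))" using i1 by (rule integrable_mult_right)
      have B: "integrable lborel (\<lambda>p::heis. indicator gauge_ball p * g ?o)" by (rule int) (rule continuous_on_const)
      have "integrable lborel (\<lambda>p. indicator gauge_ball p * lin p)" unfolding lin_def by (intro int continuous_intros)
      then have C: "integrable lborel (\<lambda>p. r * (indicator gauge_ball p * lin p))" by (rule integrable_mult_right)
      show ?thesis
        unfolding Bochner_Integration.integral_add[OF Bochner_Integration.integrable_add[OF A B] C]
          Bochner_Integration.integral_add[OF A B]
        by (simp only: integral_mult_right_zero integral_mult_left_zero lin0 gauge_ball_integral(1) mult_zero_right add_0_right)
    qed
    finally have "(heis_avg v r q - v q) / r\<^sup>2 = (\<integral>p. indicator gauge_ball p * (R r p / r\<^sup>2) \<partial>lborel) / (pi\<^sup>2 / 8)"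
      unfolding avg(1) go using r by (simp add: field_simps)
    with m show ?case by simp
  qed
  then obtain d' where d': "d' > 0" "\<And>r. 0 < r \<Longrightarrow> r < d' \<Longrightarrow> (\<lambda>p. indicator gauge_ball p * (R r p / r\<^sup>2)) \<in> borel_measurable borel"
    by (auto simp: eventually_at_right_field)
  define d1 where "d1 = min d d'"
  have d1: "d1 > 0" using d d' by (simp add: d1_def)
  have "((\<lambda>r. \<integral>p. indicator gauge_ball p * (R r p / r\<^sup>2) \<partial>lborel) \<longlongrightarrow> (\<integral>p. indicator gauge_ball p * ?Q p \<partial>lborel)) (at 0 within {0<..<d1})"
  proof (rule tendsto_integral_dominated[where w="\<lambda>p. indicator gauge_ball p * C"])
    show "\<bar>indicator gauge_ball p * (R r p / r\<^sup>2)\<bar> \<le> indicator gauge_ball p * C" if "r \<in> {0<..<d1}" for r p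
      using C[of p r] that by (auto simp: indicator_def gauge_ball_def d1_def divide_le_eq abs_divide)
    show "((\<lambda>r. indicator gauge_ball p * (R r p / r\<^sup>2)) \<longlongrightarrow> indicator gauge_ball p * ?Q p) (at 0 within {0<..<d1})" for p
    proof (cases "p \<in> gauge_ball")
      case True
      then have "((\<lambda>r. R r p / r\<^sup>2) \<longlongrightarrow> ?Q p) (at 0 within {0<..<d1})"
        using lim[of p] at_right_eq_Ioo[OF d1] by (simp add: gauge_ball_def)
      then show ?thesis using True by simp
    qed simp
    have "continuous_on UNIV ?Q" by (intro continuous_intros) auto
    from int[OF this] show "(\<lambda>p. indicator gauge_ball p * ?Q p) \<in> borel_measurable lborel" by blast
  qed (use d' int[of "\<lambda>_. C"] in \<open>auto simp: d1_def\<close>)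
  then have "((\<lambda>r. (\<integral>p. indicator gauge_ball p * (R r p / r\<^sup>2) \<partial>lborel) / (pi\<^sup>2 / 8)) \<longlongrightarrow> (a + c) * pi / 24 / (pi\<^sup>2 / 8)) (at_right 0)"
    unfolding Q at_right_eq_Ioo[OF d1] by (intro tendsto_divide tendsto_const) auto
  moreover have "(a + c) * pi / 24 / (pi\<^sup>2 / 8) = heis_laplacian v q / (3 * pi)"
  proof -
    have "heis_laplacian g ?o = 1\<^sup>2 * heis_laplacian v (heis_mult q (heis_dil 1 ?o))"
      unfolding g_def by (rule heis_laplacian_mult_dil[OF D(1) v]) (use D in \<open>simp add: heis_mult_zero_right\<close>)
    then have "a + c = heis_laplacian v q"
      by (simp add: heis_laplacian_origin a_def c_def heis_mult_zero_right)
    then show ?thesis by (simp add: field_simps power2_eq_square)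
  qed
  moreover have "\<forall>\<^sub>F r in at_right 0. (\<integral>p. indicator gauge_ball p * (R r p / r\<^sup>2) \<partial>lborel) / (pi\<^sup>2 / 8) = (heis_avg v r q - v q) / r\<^sup>2"
    using ev by eventually_elim simp
  ultimately show ?thesis by (simp add: Lim_transform_eventually)
qed

section \<open>Mean values with radial kernels\<close>

definition kbump :: "nat \<Rightarrow> heis \<Rightarrow> real" where "kbump j p = max 0 (1 - gauge4 p) ^ j"

text \<open>Minus the horizontal gradient of \<open>kbump (Suc j)\<close>, paired with that of g,
  equals this weight times the dilation derivative of g plus a rotational term; that fixes the
  factor \<open>4 * real (Suc j)\<close>. The weight is not normalised, so means are compared with
  its integral.\<close>

definition kmean :: "nat \<Rightarrow> heis \<Rightarrow> real" where
  "kmean j p = 4 * real (Suc j) * ((fst p)\<^sup>2 + (fst (snd p))\<^sup>2) * kbump j p"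

lemma Ck_on_gauge4: "Ck_on k gauge4 S"
proof -
  have "Ck_on k gauge4 UNIV" unfolding gauge4_def' [abs_def]
    by (intro Ck_on_add Ck_on_mult Ck_on_power Ck_on_coord Ck_on_const open_UNIV)
  then show ?thesis by (rule Ck_on_subset) simp
qed

lemma Ck_on_kbump: "k < j \<Longrightarrow> Ck_on k (kbump j) UNIV"
  unfolding kbump_def [abs_def]
  by (intro Ck_on_max0_power Ck_on_diff Ck_on_const Ck_on_gauge4 open_UNIV)

lemma Ck_on_kmean: "k < j \<Longrightarrow> Ck_on k (kmean j) UNIV"
  unfolding kmean_def [abs_def]
  by (intro Ck_on_mult Ck_on_add Ck_on_power Ck_on_coord Ck_on_const Ck_on_kbump open_UNIV)

lemma kbump_nonneg: "kbump j p \<ge> 0" and kmean_nonneg: "kmean j p \<ge> 0"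
  by (auto simp: kbump_def kmean_def)

lemma kbump_outside: "0 < j \<Longrightarrow> p \<notin> gauge_cball \<Longrightarrow> kbump j p = 0" and kmean_outside: "0 < j \<Longrightarrow> p \<notin> gauge_cball \<Longrightarrow> kmean j p = 0"
  by (auto simp: kbump_def kmean_def gauge_cball_def)

lemma kbump_le_1: "kbump j p \<le> 1"
  unfolding kbump_def using gauge4_nonneg[of p] by (intro power_le_one) auto

lemma kmean_le: "0 < j \<Longrightarrow> kmean j p \<le> 4 * real (Suc j)"
proof (cases "p \<in> gauge_cball")
  case True
  then have "(fst p)\<^sup>2 + (fst (snd p))\<^sup>2 \<le> 1" using gauge4_le_1D[of "fst p" "fst (snd p)" "snd (snd p)"] by (simp add: gauge_cball_def)
  then have "((fst p)\<^sup>2 + (fst (snd p))\<^sup>2) * kbump j p \<le> 1 * 1"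
    using kbump_le_1 kbump_nonneg by (intro mult_mono) auto
  then show ?thesis unfolding kmean_def mult.assoc by (intro mult_left_mono) (auto simp: mult.assoc)
qed (simp add: kmean_outside)

lemma kbump_measurable [measurable]: "kbump j \<in> borel_measurable borel"
  unfolding kbump_def [abs_def] by (intro borel_measurable_continuous_onI continuous_intros continuous_on_gauge4)

lemma kmean_measurable [measurable]: "kmean j \<in> borel_measurable borel"
  unfolding kmean_def [abs_def] kbump_def by (intro borel_measurable_continuous_onI continuous_intros continuous_on_gauge4)

lemma kbump_abs_le: "\<bar>kbump j p\<bar> \<le> 1" using kbump_le_1 kbump_nonneg by (simp add: abs_of_nonneg)

lemma kmean_abs_le: "0 < j \<Longrightarrow> \<bar>kmean j p\<bar> \<le> 4 * real (Suc j)"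
  using kmean_le kmean_nonneg by (simp add: abs_of_nonneg)

lemma gauge4_has_derivative:
  "(gauge4 has_derivative (\<lambda>h. 4 * ((fst p)\<^sup>2 + (fst (snd p))\<^sup>2) * (fst p * fst h + fst (snd p) * fst (snd h))
     + 32 * snd (snd p) * snd (snd h))) (at p)"
  unfolding gauge4_def' [abs_def] by (auto intro!: derivative_eq_intros simp: algebra_simps)

lemma kbump_has_derivative:
  assumes "2 \<le> j"
  shows "(kbump j has_derivative (\<lambda>h. - (real j * kbump (j - 1) p) *
     (4 * ((fst p)\<^sup>2 + (fst (snd p))\<^sup>2) * (fst p * fst h + fst (snd p) * fst (snd h)) + 32 * snd (snd p) * snd (snd h)))) (at p)"
proof -
  obtain m where j: "j = Suc (Suc m)" using assms by (metis One_nat_def Suc_1 Suc_le_D Suc_le_mono)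
  have "((\<lambda>p. 1 - gauge4 p) has_derivative (\<lambda>h. - (4 * ((fst p)\<^sup>2 + (fst (snd p))\<^sup>2) * (fst p * fst h + fst (snd p) * fst (snd h))
     + 32 * snd (snd p) * snd (snd h)))) (at p)"
    by (rule has_derivative_eq_rhs[OF has_derivative_diff[OF has_derivative_const gauge4_has_derivative]]) simp
  from has_derivative_compose[OF this has_real_derivative_max0_power[of m "1 - gauge4 p", unfolded has_field_derivative_def]]
  show ?thesis unfolding kbump_def [abs_def] j
    by (rule has_derivative_eq_rhs) (simp add: fun_eq_iff algebra_simps)
qed

lemma heis_X_kbump:
  assumes "2 \<le> j"
  shows "heis_X (kbump j) (x, y, z) = - (real j * kbump (j - 1) (x, y, z)) * (4 * (x\<^sup>2 + y\<^sup>2) * x - 16 * y * z)"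
    and "heis_Y (kbump j) (x, y, z) = - (real j * kbump (j - 1) (x, y, z)) * (4 * (x\<^sup>2 + y\<^sup>2) * y + 16 * x * z)"
  unfolding heis_X_eqI[OF kbump_has_derivative[OF assms]] heis_Y_eqI[OF kbump_has_derivative[OF assms]]
  by (simp_all add: algebra_simps)

section \<open>Integration by parts for horizontal, rotation and dilation fields\<close>

lemma partial_deriv_outside:
  assumes "compact C" "\<And>p. p \<notin> C \<Longrightarrow> f p = 0" "p \<notin> C"
  shows "partial_deriv b f p = 0"
  using partial_deriv_cong[of "- C" p f "\<lambda>_. 0" b] assms open_Compl[OF compact_imp_closed[OF assms(1)]]
  by (simp add: partial_deriv_def)

lemma integrable_Ck_compact:
  fixes f :: "'a::euclidean_space \<Rightarrow> real"
  assumes "continuous_on UNIV f" "compact C" "\<And>p. p \<notin> C \<Longrightarrow> f p = 0"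
  shows "integrable lborel f"
proof -
  obtain B where "\<And>p. p \<in> C \<Longrightarrow> \<bar>f p\<bar> \<le> B"
    using continuous_on_compact_abs_bound[OF assms(2) continuous_on_subset[OF assms(1) subset_UNIV]] by blast
  then show ?thesis using assms by (intro integrable_bounded_compact[OF assms(2)]) (auto intro: borel_measurable_continuous_onI)
qed

lemma integrable_partial_deriv:
  fixes f :: "'a::euclidean_space \<Rightarrow> real"
  assumes "Ck_on 1 f UNIV" "compact C" "\<And>p. p \<notin> C \<Longrightarrow> f p = 0" "b \<in> Basis"
  shows "integrable lborel (partial_deriv b f)"
  using assms partial_deriv_outside[OF assms(2,3)]
  by (intro integrable_Ck_compact[OF _ assms(2)]) auto

lemma partial_deriv_mult:
  assumes "Ck_on (Suc k) f S" "Ck_on (Suc l) g S" "p \<in> S"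
  shows "partial_deriv b (\<lambda>p. f p * g p) p = f p * partial_deriv b g p + partial_deriv b f p * g p"
proof -
  obtain f' where f: "(f has_derivative f') (at p)" using Ck_on_has_derivative_ex[OF assms(1,3)] .
  obtain g' where g: "(g has_derivative g') (at p)" using Ck_on_has_derivative_ex[OF assms(2,3)] .
  show ?thesis
    unfolding partial_deriv_eqI[OF has_derivative_mult[OF f g]] partial_deriv_eqI[OF f] partial_deriv_eqI[OF g] by simp
qed

text \<open>X and Y are divergence free: the coefficient of the z-derivative does not depend on z,
  so it may be moved inside, and X f and Y f become combinations of pure partial derivatives of
  compactly supported functions.\<close>

lemma integral_heis_XY:
  assumes f: "Ck_on 1 f UNIV" "compact C" "\<And>p. p \<notin> C \<Longrightarrow> f p = 0"
  shows "(\<integral>p. heis_X f p \<partial>lborel) = 0" "integrable lborel (heis_X f)"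
    "(\<integral>p. heis_Y f p \<partial>lborel) = 0" "integrable lborel (heis_Y f)"
proof -
  have *: "Ck_on 1 (\<lambda>p. u p * f p) UNIV" "\<And>p. p \<notin> C \<Longrightarrow> u p * f p = 0" if "Ck_on 1 u UNIV" for u
    using that f by (auto intro!: Ck_on_mult simp del: Ck_on.simps)
  have y: "Ck_on 1 (\<lambda>p::heis. fst (snd p) / 2) UNIV" and x: "Ck_on 1 (\<lambda>p::heis. fst p / 2) UNIV"
    unfolding divide_inverse by (intro Ck_on_mult Ck_on_coord Ck_on_const open_UNIV)+
  have dy: "partial_deriv (0, 0, 1) (\<lambda>p::heis. fst (snd p) / 2) p = 0"
    and dx: "partial_deriv (0, 0, 1) (\<lambda>p::heis. fst p / 2) p = 0" for p
    by (simp_all add: partial_deriv_def)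
  have X: "heis_X f = (\<lambda>p. partial_deriv (1, 0, 0) f p - partial_deriv (0, 0, 1) (\<lambda>p. fst (snd p) / 2 * f p) p)"
    using partial_deriv_mult[OF y[unfolded One_nat_def] f(1)[unfolded One_nat_def], of _ "(0, 0, 1)"] by (auto simp: heis_X_def' dy)
  have Y: "heis_Y f = (\<lambda>p. partial_deriv (0, 1, 0) f p + partial_deriv (0, 0, 1) (\<lambda>p. fst p / 2 * f p) p)"
    using partial_deriv_mult[OF x[unfolded One_nat_def] f(1)[unfolded One_nat_def], of _ "(0, 0, 1)"] by (auto simp: heis_Y_def' dx)
  have b: "(1, 0, 0) \<in> (Basis :: heis set)" "(0, 1, 0) \<in> (Basis :: heis set)" "(0, 0, 1) \<in> (Basis :: heis set)"
    by (auto simp: Basis_heis)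
  show "integrable lborel (heis_X f)" "integrable lborel (heis_Y f)"
    unfolding X Y using *[OF x] *[OF y] b f
    by (intro Bochner_Integration.integrable_diff Bochner_Integration.integrable_add integrable_partial_deriv[OF _ f(2)]; simp del: Ck_on.simps)+
  have i: "(\<integral>p. partial_deriv c h p \<partial>lborel) = 0 \<and> integrable lborel (partial_deriv c h)"
    if "Ck_on 1 h UNIV" "\<And>p. p \<notin> C \<Longrightarrow> h p = 0" "c \<in> Basis" for h c
    using integral_partial_deriv_eq_0[OF that(1) f(2) that(2,3)] integrable_partial_deriv[OF that(1) f(2) that(2,3)] by blast
  show "(\<integral>p. heis_X f p \<partial>lborel) = 0"
    unfolding X using i[OF f(1) f(3) b(1)] i[OF *[OF y] b(3)] by simp
  show "(\<integral>p. heis_Y f p \<partial>lborel) = 0"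
    unfolding Y using i[OF f(1) f(3) b(2)] i[OF *[OF x] b(3)] by simp
qed

lemma closed_gauge_cball: "closed gauge_cball" using compact_gauge_cball by (rule compact_imp_closed)

definition heis_rot :: "(heis \<Rightarrow> real) \<Rightarrow> heis \<Rightarrow> real" where
  "heis_rot f p = fst p * partial_deriv (0, 1, 0) f p - fst (snd p) * partial_deriv (1, 0, 0) f p"

lemma Ck_on_heis_rot:
  assumes "open S" "Ck_on (Suc k) f S"
  shows "Ck_on k (heis_rot f) S"
  unfolding heis_rot_def [abs_def] using Ck_on_partial[OF assms(2)]
  by (intro Ck_on_diff Ck_on_mult assms(1) Ck_on_coord) (auto simp: Basis_heis)

text \<open>Rotations about the \<open>z\<close>-axis preserve Lebesgue measure; this is the infinitesimal form.\<close>

lemma integral_heis_rot: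
  assumes w: "Ck_on 1 w UNIV" "\<And>p. p \<notin> gauge_cball \<Longrightarrow> w p = 0" "\<And>p. heis_rot w p = 0"
    and g: "open U" "gauge_cball \<subseteq> U" "Ck_on 1 g U"
  shows "(\<integral>p. w p * heis_rot g p \<partial>lborel) = 0"
proof -
  have b: "(1, 0, 0) \<in> (Basis :: heis set)" "(0, 1, 0) \<in> (Basis :: heis set)"
    by (auto simp: Basis_heis)
  define F where "F u p = u p * (w p * g p)" for u p
  have wg: "Ck_on 1 (\<lambda>p. w p * g p) UNIV"
    by (rule Ck_on_mult_support[OF closed_gauge_cball g(2,1) open_UNIV w(1) g(3) w(2)])
  have F1: "Ck_on 1 (F u) UNIV" if "Ck_on 1 u UNIV" for u
    unfolding F_def [abs_def] by (rule Ck_on_mult[OF open_UNIV that wg])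
  have F0: "F u p = 0" if "p \<notin> gauge_cball" for u p using w(2)[OF that] by (simp add: F_def)
  have x: "Ck_on 1 (fst :: heis \<Rightarrow> real) UNIV" and y: "Ck_on 1 (\<lambda>p::heis. fst (snd p)) UNIV"
    using Ck_on_coord by (simp_all del: Ck_on.simps)
  \<comment> \<open>The rotation field is divergence free, so
    \<open>w p * heis_rot g p + g p * heis_rot w p\<close> is a divergence with compact support; the
    second term is zero by hypothesis.\<close>
  have "(\<integral>p. partial_deriv (0, 1, 0) (F fst) p - partial_deriv (1, 0, 0) (F (\<lambda>p. fst (snd p))) p \<partial>lborel) = 0"
    using integral_partial_deriv_eq_0[OF F1[OF x] compact_gauge_cball F0 b(2)] integral_partial_deriv_eq_0[OF F1[OF y] compact_gauge_cball F0 b(1)]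
      integrable_partial_deriv[OF F1[OF x] compact_gauge_cball F0 b(2)] integrable_partial_deriv[OF F1[OF y] compact_gauge_cball F0 b(1)]
    by simp
  moreover have "partial_deriv (0, 1, 0) (F fst) p - partial_deriv (1, 0, 0) (F (\<lambda>p. fst (snd p))) p = w p * heis_rot g p" for p
  proof (cases "p \<in> gauge_cball")
    case True
    then have p: "p \<in> U" using g by auto
    note S = Ck_on_subset[OF _ subset_UNIV, of "Suc 0" _ U]
    have w': "Ck_on (Suc 0) w U" using w(1) by (intro S) simp
    have wg': "Ck_on (Suc 0) (\<lambda>p. w p * g p) U" using wg by (intro S) simp
    have g': "Ck_on (Suc 0) g U" using g(3) by simp
    have d: "partial_deriv (0, 1, 0) (fst :: heis \<Rightarrow> real) p = 0" "partial_deriv (1, 0, 0) (\<lambda>p::heis. fst (snd p)) p = 0"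
      by (simp_all add: partial_deriv_def)
    have "partial_deriv (0, 1, 0) (F fst) p = fst p * (w p * partial_deriv (0, 1, 0) g p + partial_deriv (0, 1, 0) w p * g p)"
      unfolding F_def [abs_def]
      by (subst partial_deriv_mult[OF Ck_on_coord(1)[of "Suc 0" U] wg' p]) (simp add: d partial_deriv_mult[OF w' g' p])
    moreover have "partial_deriv (1, 0, 0) (F (\<lambda>p. fst (snd p))) p = fst (snd p) * (w p * partial_deriv (1, 0, 0) g p + partial_deriv (1, 0, 0) w p * g p)"
      unfolding F_def [abs_def]
      by (subst partial_deriv_mult[OF Ck_on_coord(2)[of "Suc 0" U] wg' p]) (simp add: d partial_deriv_mult[OF w' g' p])
    ultimately have "partial_deriv (0, 1, 0) (F fst) p - partial_deriv (1, 0, 0) (F (\<lambda>p. fst (snd p))) p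
       = w p * heis_rot g p + g p * heis_rot w p"
      by (simp add: heis_rot_def algebra_simps)
    then show ?thesis using w(3) by simp
  next
    case False
    then show ?thesis using partial_deriv_outside[OF compact_gauge_cball F0 False] w(2) by simp
  qed
  ultimately show ?thesis by simp
qed

lemma heis_rot_kbump:
  assumes "2 \<le> j"
  shows "heis_rot (kbump j) p = 0" "heis_rot (\<lambda>p. snd (snd p) * kbump j p) p = 0"
proof -
  note d = kbump_has_derivative[OF assms, of p]
  show "heis_rot (kbump j) p = 0"
    unfolding heis_rot_def partial_deriv_eqI[OF d] by (simp add: algebra_simps)
  have "(snd o snd has_derivative (\<lambda>h. snd (snd h))) (at p)" unfolding o_def by (auto intro!: derivative_eq_intros)
  from has_derivative_mult[OF this[unfolded o_def] d] show "heis_rot (\<lambda>p. snd (snd p) * kbump j p) p = 0"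
    unfolding heis_rot_def by (simp add: partial_deriv_eqI algebra_simps)
qed

text \<open>Multiplying by z preserves rotation invariance. This disposes of the rotational term in
  the identity behind \<open>key_identity\<close> and again in
  \<open>integral_heis_comm\<close>.\<close>

lemma integral_z_kbump_rot:
  assumes j: "2 \<le> j" and U: "open U" "gauge_cball \<subseteq> U" and g: "Ck_on 1 g U" "continuous_on gauge_cball (heis_rot g)"
  defines "V \<equiv> \<lambda>p. snd (snd p) * kbump j p"
  shows "(\<integral>p. V p * heis_rot g p \<partial>lborel) = 0" "integrable lborel (\<lambda>p. V p * heis_rot g p)"
proof -
  have V: "Ck_on 1 V UNIV"
    unfolding V_def using j by (auto simp del: Ck_on.simps intro!: Ck_on_kbump Ck_on_mult)
  have V0: "V p = 0" if "p \<notin> gauge_cball" for p using that j by (simp add: V_def kbump_outside)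
  show "(\<integral>p. V p * heis_rot g p \<partial>lborel) = 0"
    by (rule integral_heis_rot[OF V V0 _ U g(1)]) (assumption, unfold V_def, rule heis_rot_kbump(2)[OF j])
  show "integrable lborel (\<lambda>p. V p * heis_rot g p)"
  proof (rule integrable_mult_support[OF compact_gauge_cball _ _ V0 g(2)])
    show "V \<in> borel_measurable borel" using Ck_on_continuous[OF V] by (rule borel_measurable_continuous_onI)
    show "\<bar>V p\<bar> \<le> 1" for p
    proof (cases "p \<in> gauge_cball")
      case True
      then have "\<bar>snd (snd p)\<bar> \<le> 1" using gauge4_le_1D[of "fst p" "fst (snd p)" "snd (snd p)"] by (simp add: gauge_cball_def)
      then show ?thesis unfolding V_def abs_mult using kbump_abs_le by (intro mult_le_one) auto
    qed (simp add: V0)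
  qed
qed

text \<open>The generator of the dilations, that is, the derivative of
  \<open>f (heis_dil t p)\<close> at t = 1; the factor 2 is the weight of z.\<close>

definition heis_Z :: "(heis \<Rightarrow> real) \<Rightarrow> heis \<Rightarrow> real" where
  "heis_Z f p = fst p * partial_deriv (1, 0, 0) f p + fst (snd p) * partial_deriv (0, 1, 0) f p
    + 2 * snd (snd p) * partial_deriv (0, 0, 1) f p"

lemma Ck_on_heis_Z:
  assumes "open S" "Ck_on (Suc k) f S"
  shows "Ck_on k (heis_Z f) S"
  unfolding heis_Z_def [abs_def] using Ck_on_partial[OF assms(2)]
  by (intro Ck_on_add Ck_on_mult assms(1) Ck_on_coord Ck_on_const) (auto simp: Basis_heis)

text \<open>With \<open>W = kbump (Suc j)\<close> one has \<open>W \<Delta>g = X (W X g) + Y (W Y g) + kmean j Z g + 16 (j + 1) z (kbump j) \<Theta> g\<close>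
  for the dilation field \<open>Z\<close> and the rotation field \<open>\<Theta>\<close>; all terms but two integrate to zero.\<close>

lemma key_identity:
  assumes j: "2 \<le> j" and U: "open U" "gauge_cball \<subseteq> U" and g: "Ck_on 2 g U"
  shows "(\<integral>p. kmean j p * heis_Z g p \<partial>lborel) = (\<integral>p. kbump (Suc j) p * heis_laplacian g p \<partial>lborel)"
proof -
  define W where "W = kbump (Suc j)"
  have j2: "2 \<le> Suc j" using j by simp
  have W: "Ck_on 1 W UNIV" "\<And>p. p \<notin> gauge_cball \<Longrightarrow> W p = 0"
    using j by (auto simp: W_def kbump_outside simp del: Ck_on.simps intro!: Ck_on_kbump)
  have g2: "Ck_on (Suc 1) g U" using g by (simp add: numeral_2_eq_2)
  have g1: "Ck_on 1 g U" using Ck_on_SucD[OF g2] .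
  have X: "Ck_on 1 (heis_X g) U" "Ck_on 1 (heis_Y g) U" using U g2 by (auto intro: Ck_on_heis_X Ck_on_heis_Y simp del: Ck_on.simps)
  define F1 where "F1 p = W p * heis_X g p" for p
  define F2 where "F2 p = W p * heis_Y g p" for p
  have F: "Ck_on 1 F1 UNIV" "Ck_on 1 F2 UNIV"
    unfolding F1_def [abs_def] F2_def [abs_def]
    by (rule Ck_on_mult_support[OF closed_gauge_cball U(2,1) open_UNIV W(1) _ W(2)], rule X, assumption)+
  have F0: "F1 p = 0" "F2 p = 0" if "p \<notin> gauge_cball" for p using W(2)[OF that] by (simp_all add: F1_def F2_def)
  define V where "V p = snd (snd p) * kbump j p" for p
  have V0: "V p = 0" if "p \<notin> gauge_cball" for p using that j by (simp add: V_def kbump_outside)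
  have cont: "continuous_on gauge_cball (heis_Z g)" "continuous_on gauge_cball (heis_laplacian g)" "continuous_on gauge_cball (heis_rot g)"
    by (rule continuous_on_subset[OF Ck_on_continuous U(2)],
        rule Ck_on_heis_Z[OF U(1) g2] Ck_on_heis_laplacian[OF U(1) g2[unfolded One_nat_def]] Ck_on_heis_rot[OF U(1) g2])+
  have iK: "integrable lborel (\<lambda>p. kmean j p * heis_Z g p)"
    using j by (intro integrable_mult_support[OF compact_gauge_cball _ kmean_abs_le] cont) (auto simp: kmean_outside)
  note V = integral_z_kbump_rot[OF j U g1 cont(3), folded V_def]
  have pt: "W p * heis_laplacian g p = heis_X F1 p + heis_Y F2 p + kmean j p * heis_Z g p + 16 * real (Suc j) * (V p * heis_rot g p)" for p
  proof (cases "p \<in> gauge_cball")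
    case True
    then have p: "p \<in> U" using U by auto
    obtain x y z where xyz: "p = (x, y, z)" by (cases p)
    have WU: "Ck_on (Suc 0) W U" using Ck_on_subset[OF W(1), of U] by simp
    have XU: "Ck_on (Suc 0) (heis_X g) U" "Ck_on (Suc 0) (heis_Y g) U" using X by simp_all
    have "heis_X F1 p = W p * heis_X (heis_X g) p + heis_X W p * heis_X g p"
      unfolding F1_def [abs_def] by (rule heis_X_mult[OF WU XU(1) p])
    moreover have "heis_Y F2 p = W p * heis_Y (heis_Y g) p + heis_Y W p * heis_Y g p"
      unfolding F2_def [abs_def] by (rule heis_X_mult[OF WU XU(2) p])
    \<comment> \<open>Pairing the gradients produces x X g + y Y g, where the z-derivatives cancel,
      and x Y g - y X g, which is the rotational derivative plus (x^2 + y^2)/2 times the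
      z-derivative. The latter, carrying the factor 16 z, supplies the z-part of
      \<open>heis_Z g\<close>.\<close>
    moreover have "heis_X W p * heis_X g p + heis_Y W p * heis_Y g p
        + kmean j p * heis_Z g p + 16 * real (Suc j) * (V p * heis_rot g p) = 0"
    proof -
      define k where "k = kbump j (x, y, z)"
      have "heis_X W p = - (real (Suc j) * k) * (4 * (x\<^sup>2 + y\<^sup>2) * x - 16 * y * z)"
         "heis_Y W p = - (real (Suc j) * k) * (4 * (x\<^sup>2 + y\<^sup>2) * y + 16 * x * z)"
        unfolding W_def xyz heis_X_kbump[OF j2] k_def by simp_all
      moreover have "kmean j p = 4 * real (Suc j) * (x\<^sup>2 + y\<^sup>2) * k" "V p = z * k"
        by (simp_all add: kmean_def V_def xyz k_def)
      moreover obtain a b c where "partial_deriv (1, 0, 0) g p = a" "partial_deriv (0, 1, 0) g p = b" "partial_deriv (0, 0, 1) g p = c"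
        by blast
      then have "heis_X g p = a - y / 2 * c" "heis_Y g p = b + x / 2 * c" "heis_Z g p = x * a + y * b + 2 * z * c"
        "heis_rot g p = x * b - y * a"
        by (simp_all add: heis_X_def' heis_Y_def' heis_Z_def heis_rot_def xyz)
      ultimately show ?thesis by (simp only:) (simp add: algebra_simps power2_eq_square)
    qed
    ultimately show ?thesis by (simp add: heis_laplacian_def algebra_simps)
  next
    case False
    have "heis_X F1 p = 0" "heis_Y F2 p = 0"
      using partial_deriv_outside[OF compact_gauge_cball F0(1) False] partial_deriv_outside[OF compact_gauge_cball F0(2) False]
      by (simp_all add: heis_X_def' heis_Y_def')
    then show ?thesis using False j W(2) V0 by (simp add: kmean_outside)
  qed
  have "(\<integral>p. W p * heis_laplacian g p \<partial>lborel) = (\<integral>p. kmean j p * heis_Z g p \<partial>lborel)"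
    unfolding pt using integral_heis_XY[OF F(1) compact_gauge_cball F0(1)] integral_heis_XY[OF F(2) compact_gauge_cball F0(2)] iK V
    by simp
  then show ?thesis by (simp add: W_def)
qed

text \<open>Negative \<open>t\<close> occur because means are differentiated in \<open>t\<close> at
  0. Dilation by -1 preserves the gauge, which reduces them to |t|.\<close>

lemma heis_mult_dil_in_ball:
  assumes "p \<in> gauge_cball" "\<bar>t\<bar> < 1" "\<bar>t\<bar> * (3 + norm q) < e"
  shows "heis_mult q (heis_dil t p) \<in> ball q e"
proof -
  obtain p' where p': "gauge4 p' \<le> 1" "heis_dil t p = heis_dil \<bar>t\<bar> p'"
  proof (cases "t \<ge> 0")
    case True
    then show thesis using assms(1) by (intro that[of p]) (auto simp: gauge_cball_def)
  next
    case False
    then have "gauge4 (heis_dil (-1) p) \<le> 1" "heis_dil t p = heis_dil \<bar>t\<bar> (heis_dil (-1) p)"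
      using assms(1) by (auto simp: gauge_cball_def gauge4_dil heis_dil_dil)
    then show thesis by (rule that)
  qed
  have "dist q (heis_mult q (heis_dil t p)) \<le> \<bar>t\<bar> * (3 + norm q)"
    unfolding p'(2) using assms by (intro dist_heis_mult_dil[OF p'(1)]) auto
  then show ?thesis using assms(3) by simp
qed

section \<open>The mean value formula as a function of the radius\<close>

lemma heis_Z_eqI:
  assumes "(f has_derivative f') (at p)"
  shows "heis_Z f p = f' (fst p, fst (snd p), 2 * snd (snd p))"
proof -
  interpret bounded_linear f' using assms by (rule has_derivative_bounded_linear)
  have "f' (fst p, fst (snd p), 2 * snd (snd p)) =
    f' (fst p *\<^sub>R (1, 0, 0) + fst (snd p) *\<^sub>R (0, 1, 0) + (2 * snd (snd p)) *\<^sub>R (0, 0, 1))" by simp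
  also have "\<dots> = fst p * f' (1, 0, 0) + fst (snd p) * f' (0, 1, 0) + 2 * snd (snd p) * f' (0, 0, 1)"
    unfolding add scaleR by simp
  finally show ?thesis by (simp add: heis_Z_def partial_deriv_eqI[OF assms])
qed

lemma Ck_on_heis_mult_dil_joint:
  assumes "open V" "Ck_on k h D" "\<And>q t p. (q, t, p) \<in> V \<Longrightarrow> heis_mult q (heis_dil t p) \<in> D"
  shows "Ck_on k (\<lambda>(q, t, p). h (heis_mult q (heis_dil t p))) V"
proof -
  have l: "Ck_on k (\<lambda>x::heis \<times> real \<times> heis. fst (fst x)) V" "Ck_on k (\<lambda>x::heis \<times> real \<times> heis. fst (snd (fst x))) V"
    "Ck_on k (\<lambda>x::heis \<times> real \<times> heis. snd (snd (fst x))) V" "Ck_on k (\<lambda>x::heis \<times> real \<times> heis. fst (snd x)) V"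
    "Ck_on k (\<lambda>x::heis \<times> real \<times> heis. fst (snd (snd x))) V" "Ck_on k (\<lambda>x::heis \<times> real \<times> heis. fst (snd (snd (snd x)))) V"
    "Ck_on k (\<lambda>x::heis \<times> real \<times> heis. snd (snd (snd (snd x)))) V"
    by (intro Ck_on_bounded_linear bounded_linear_intros)+
  have "Ck_on k (\<lambda>x. h (heis_mult (fst x) (heis_dil (fst (snd x)) (snd (snd x))))) V"
  proof (rule Ck_on_heis_compose[OF assms(1) _ _ _ _ assms(2)])
    show "(\<lambda>x. heis_mult (fst x) (heis_dil (fst (snd x)) (snd (snd x)))) ` V \<subseteq> D" using assms(3) by auto
  qed (unfold heis_mult_def heis_dil_def' fst_conv snd_conv,
    (intro Ck_on_add Ck_on_diff Ck_on_mult Ck_on_power Ck_on_const l assms(1))+)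
  moreover have "(\<lambda>x. h (heis_mult (fst x) (heis_dil (fst (snd x)) (snd (snd x))))) = (\<lambda>(q, t, p). h (heis_mult q (heis_dil t p)))"
    by auto
  ultimately show ?thesis by (simp only:)
qed

text \<open>For g the function \<open>h\<close> composed with \<open>heis_mult q\<close> and
  \<open>heis_dil t\<close>, the t-derivative of the integrand is 1/t times \<open>heis_Z g\<close>.
  By \<open>key_identity\<close> this integrates to the sub-Laplacian of g, which is t^2 times that
  of \<open>h\<close> at the moved point; a factor t remains. At t = 0 mere differentiability is
  claimed, for continuity up to that end point.\<close>

lemma mean_value_deriv:
  assumes j: "2 \<le> j" and D: "open D" "ball q e \<subseteq> D" and h: "Ck_on 2 h D"
    and t: "\<bar>t\<bar> < 1" "\<bar>t\<bar> * (3 + norm q) < e" 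
  shows "\<exists>M'. ((\<lambda>t. \<integral>p. kmean j p * h (heis_mult q (heis_dil t p)) \<partial>lborel) has_real_derivative M') (at t) \<and>
    (t \<noteq> 0 \<longrightarrow> M' = t * (\<integral>p. kbump (Suc j) p * heis_laplacian h (heis_mult q (heis_dil t p)) \<partial>lborel))"
proof -
  define F where "F = (\<lambda>(t, p). h (heis_mult q (heis_dil t p)))"
  define U where "U = {t. \<bar>t\<bar> < 1 \<and> \<bar>t\<bar> * (3 + norm q) < e}"
  define V where "V = (\<lambda>(t, p). heis_mult q (heis_dil t p)) -` D"
  have h1: "Ck_on (Suc 1) h D" using h by (simp add: numeral_2_eq_2)
  have U: "open U" unfolding U_def by (intro open_Collect_conj open_Collect_less continuous_intros)
  have tU: "t \<in> U" using t by (simp add: U_def)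
  have V: "open V" unfolding V_def case_prod_beta by (intro open_vimage D continuous_intros)
  have UV: "U \<times> gauge_cball \<subseteq> V"
  proof (rule subsetI)
    fix x assume "x \<in> U \<times> gauge_cball"
    then have "snd x \<in> gauge_cball" "\<bar>fst x\<bar> < 1" "\<bar>fst x\<bar> * (3 + norm q) < e" by (auto simp: U_def)
    from heis_mult_dil_in_ball[OF this] show "x \<in> V" using D(2) by (auto simp: V_def case_prod_beta)
  qed
  have F: "Ck_on 2 F V"
  proof -
    have "Ck_on 2 (\<lambda>x. (\<lambda>(q, t, p). h (heis_mult q (heis_dil t p))) (q, x)) V"
    proof (rule Ck_on_compose[OF V, where f="\<lambda>(q, t, p). h (heis_mult q (heis_dil t p))" and G="\<lambda>x. (q, x)"
          and T="(\<lambda>(q, t, p). heis_mult q (heis_dil t p)) -` D"])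
      show "Ck_on 2 (\<lambda>(q, t, p). h (heis_mult q (heis_dil t p))) ((\<lambda>(q, t, p). heis_mult q (heis_dil t p)) -` D)"
        by (rule Ck_on_heis_mult_dil_joint[OF _ h]) (auto simp: case_prod_beta intro!: open_vimage D continuous_intros)
      fix c :: "heis \<times> real \<times> heis" assume c: "c \<in> Basis"
      have "(\<lambda>x. (q, x) \<bullet> c) = (\<lambda>x. q \<bullet> fst c + x \<bullet> snd c)" by (auto simp: inner_prod_def)
      then show "Ck_on 2 (\<lambda>x. (q, x) \<bullet> c) V" using V by (simp only:) (intro Ck_on_add Ck_on_const Ck_on_inner)
    qed (auto simp: V_def)
    then show ?thesis by (simp add: F_def)
  qed
  have F1: "Ck_on 1 F V" using F by (rule Ck_on_mono) simp
  have pi: "parametric_integral U V gauge_cball (kmean j) (4 * real (Suc j))"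
    using j U V UV by unfold_locales (auto simp: compact_gauge_cball kmean_outside kmean_abs_le simp del: of_nat_Suc)
  have "((\<lambda>t. \<integral>p. kmean j p * F (t, p) \<partial>lborel) has_derivative
      (\<lambda>s. s * (\<integral>p. kmean j p * partial_deriv (1, 0) F (t, p) \<partial>lborel))) (at t)"
    using parametric_integral.has_derivative_integral[OF pi F1 tU] by simp
  then have d: "((\<lambda>t. \<integral>p. kmean j p * F (t, p) \<partial>lborel) has_real_derivative
      (\<integral>p. kmean j p * partial_deriv (1, 0) F (t, p) \<partial>lborel)) (at t)"
    unfolding has_field_derivative_def by (rule has_derivative_eq_rhs) (simp add: fun_eq_iff mult.commute)
  have "(\<integral>p. kmean j p * partial_deriv (1, 0) F (t, p) \<partial>lborel) =
     t * (\<integral>p. kbump (Suc j) p * heis_laplacian h (heis_mult q (heis_dil t p)) \<partial>lborel)" if t0: "t \<noteq> 0"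
  proof -
    define W where "W = (\<lambda>p. heis_mult q (heis_dil t p)) -` D"
    define g where "g p = h (heis_mult q (heis_dil t p))" for p
    have W: "open W" "gauge_cball \<subseteq> W"
    proof -
      show "open W" using open_heis_mult_dil_vimage[OF D(1)] by (simp add: W_def)
      have "p \<in> W" if "p \<in> gauge_cball" for p
        using heis_mult_dil_in_ball[OF that t] D(2) by (auto simp: W_def)
      then show "gauge_cball \<subseteq> W" by blast
    qed
    have g: "Ck_on 2 g W" unfolding g_def [abs_def]
      by (rule Ck_on_heis_mult_dil[OF W(1) _ h]) (auto simp: W_def)
    have "kmean j p * partial_deriv (1, 0) F (t, p) = (1 / t) * (kmean j p * heis_Z g p)" for p
    proof (cases "p \<in> gauge_cball")
      case True
      then have "heis_mult q (heis_dil t p) \<in> D" using W by (auto simp: W_def)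
      then obtain h' where h': "(h has_derivative h') (at (heis_mult q (heis_dil t p)))"
        using Ck_on_has_derivative_ex[OF h1] by blast
      define A where "A h = (fst h, fst (snd h), snd (snd h) + (1/2) * (fst q * fst (snd h) - fst (snd q) * fst h))" for h :: heis
      interpret h': bounded_linear h' using h' by (rule has_derivative_bounded_linear)
      have dil': "((\<lambda>t. heis_dil t p) has_derivative (\<lambda>s. (s * fst p, s * fst (snd p), s * (2 * t * snd (snd p))))) (at t)"
        unfolding heis_dil_def' by (auto intro!: derivative_eq_intros simp: algebra_simps)
      have m: "((\<lambda>p. heis_mult q p) has_derivative A) (at P)" for P
        using heis_mult_has_derivative[of q P] by (simp add: A_def [abs_def])
      have "((\<lambda>t. h (heis_mult q (heis_dil t p))) has_derivative
          (\<lambda>s. h' (A (s * fst p, s * fst (snd p), s * (2 * t * snd (snd p)))))) (at t)"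
        by (rule has_derivative_compose[OF has_derivative_compose[OF dil' m] h'])
      from partial_deriv_eqI[OF this, of 1]
      have "partial_deriv (1, 0) F (t, p) = h' (A (fst p, fst (snd p), 2 * t * snd (snd p)))"
        by (simp add: partial_deriv_def F_def)
      moreover have "(g has_derivative (\<lambda>s. h' (A (heis_dil t s)))) (at p)"
        unfolding g_def [abs_def]
        by (rule has_derivative_compose[OF has_derivative_compose[OF heis_dil_has_derivative m] h'])
      from heis_Z_eqI[OF this] have "heis_Z g p = h' (A (heis_dil t (fst p, fst (snd p), 2 * snd (snd p))))" .
      moreover have "A (heis_dil t (fst p, fst (snd p), 2 * snd (snd p))) = t *\<^sub>R A (fst p, fst (snd p), 2 * t * snd (snd p))"
        by (simp add: A_def algebra_simps power2_eq_square)
      ultimately have "heis_Z g p = t * partial_deriv (1, 0) F (t, p)"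
        by (simp add: h'.scaleR)
      then show ?thesis using t0 by simp
    next
      case False
      then show ?thesis using j by (simp add: kmean_outside)
    qed
    then have "(\<integral>p. kmean j p * partial_deriv (1, 0) F (t, p) \<partial>lborel) = (1 / t) * (\<integral>p. kmean j p * heis_Z g p \<partial>lborel)"
      by simp
    also have "\<dots> = (1 / t) * (\<integral>p. kbump (Suc j) p * heis_laplacian g p \<partial>lborel)"
      by (simp only: key_identity[OF j W g])
    also have "(\<lambda>p. kbump (Suc j) p * heis_laplacian g p) = (\<lambda>p. t\<^sup>2 * (kbump (Suc j) p * heis_laplacian h (heis_mult q (heis_dil t p))))"
    proof
      fix p
      show "kbump (Suc j) p * heis_laplacian g p = t\<^sup>2 * (kbump (Suc j) p * heis_laplacian h (heis_mult q (heis_dil t p)))"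
      proof (cases "p \<in> gauge_cball")
        case True
        then have "heis_mult q (heis_dil t p) \<in> D" using W by (auto simp: W_def)
        from heis_laplacian_mult_dil[OF D(1) h this] show ?thesis by (simp add: g_def [abs_def])
      qed (simp add: kbump_outside)
    qed
    finally show ?thesis using t0 by (simp add: power2_eq_square)
  qed
  then show ?thesis using d by (auto simp: F_def)
qed

text \<open>Fundamental theorem of calculus in \<open>t\<close>: at t = 0 the kernel mean is its
  mass times \<open>h q\<close>. Since t \<open>kbump (Suc j)\<close> is nonnegative here, a sign of
  the sub-Laplacian passes to the difference.\<close>

lemma mean_value_has_integral:
  assumes j: "2 \<le> j" and D: "open D" "ball q e \<subseteq> D" and h: "Ck_on 2 h D"
    and s: "0 \<le> s" "s < 1" "s * (3 + norm q) < e"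
  shows "((\<lambda>t. t * (\<integral>p. kbump (Suc j) p * heis_laplacian h (heis_mult q (heis_dil t p)) \<partial>lborel))
    has_integral ((\<integral>p. kmean j p * h (heis_mult q (heis_dil s p)) \<partial>lborel) - (\<integral>p. kmean j p \<partial>lborel) * h q)) {0..s}"
proof -
  define M where "M t = (\<integral>p. kmean j p * h (heis_mult q (heis_dil t p)) \<partial>lborel)" for t
  have t: "\<bar>t\<bar> < 1" "\<bar>t\<bar> * (3 + norm q) < e" if "t \<in> {0..s}" for t
  proof -
    have "t * (3 + norm q) \<le> s * (3 + norm q)" using that by (intro mult_right_mono) auto
    then show "\<bar>t\<bar> < 1" "\<bar>t\<bar> * (3 + norm q) < e" using s that by auto
  qed
  note M' = mean_value_deriv[OF j D h t, folded M_def]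
  have M0: "M 0 = (\<integral>p. kmean j p \<partial>lborel) * h q" by (simp add: M_def heis_mult_zero_right)
  have "((\<lambda>t. t * (\<integral>p. kbump (Suc j) p * heis_laplacian h (heis_mult q (heis_dil t p)) \<partial>lborel))
    has_integral (M s - M 0)) {0..s}"
  proof (rule fundamental_theorem_of_calculus_interior[OF s(1)])
    show "continuous_on {0..s} M"
      using M' DERIV_isCont by (intro continuous_at_imp_continuous_on ballI) blast
    show "(M has_vector_derivative t * (\<integral>p. kbump (Suc j) p * heis_laplacian h (heis_mult q (heis_dil t p)) \<partial>lborel)) (at t)"
      if "t \<in> {0<..<s}" for t
      using M'[of t] that by (auto simp: has_real_derivative_iff_has_vector_derivative[symmetric])
  qed
  then show ?thesis by (simp add: M0) (simp add: M_def)
qed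

text \<open>The mass that normalises kernel means. The weight vanishes on the z-axis, so positivity
  is tested on an open set away from it.\<close>

lemma kmean_integral_pos:
  assumes j: "0 < j" shows "(\<integral>p. kmean j p \<partial>lborel) > 0"
proof (rule integral_pos_if_pos_on_open[of _ "{p. gauge4 p < 1} \<inter> {p. fst p > 0}"])
  show "integrable lborel (kmean j)"
    using integrable_mult_support[OF compact_gauge_cball kmean_measurable kmean_abs_le[OF j] kmean_outside[OF j] continuous_on_const[of _ 1]] by simp
  show "open ({p. gauge4 p < 1} \<inter> {p::heis. fst p > 0})"
    by (intro open_Int open_Collect_less continuous_on_gauge4 continuous_intros)
  have "(1/2, 0, 0) \<in> {p. gauge4 p < 1} \<inter> {p::heis. fst p > 0}" by (simp add: power_divide)
  then show "{p. gauge4 p < 1} \<inter> {p::heis. fst p > 0} \<noteq> {}" by blast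
  fix p assume p: "p \<in> {p. gauge4 p < 1} \<inter> {p. fst p > 0}"
  have "(fst p)\<^sup>2 + (fst (snd p))\<^sup>2 > 0" using p by (intro add_pos_nonneg) auto
  then show "kmean j p > 0" using p unfolding kmean_def kbump_def by (intro mult_pos_pos) auto
qed (rule kmean_nonneg)

section \<open>Averaging commutes with the sub-Laplacian\<close>

abbreviation heis_T :: "(heis \<Rightarrow> real) \<Rightarrow> heis \<Rightarrow> real" where
  "heis_T \<equiv> partial_deriv (0, 0, 1)"

lemma Ck_on_heis_T:
  assumes "open S" "Ck_on (Suc k) f S"
  shows "Ck_on k (heis_T f) S"
  using Ck_on_partial[OF assms(2)] by (simp add: Basis_heis)

text \<open>The difference of the sub-Laplacians built from right- and left-invariant fields. Both its
  terms are integrals of rotational derivatives, so it vanishes against radial weights; hence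
  averaging with a radial weight commutes with the sub-Laplacian.\<close>

definition heis_comm :: "(heis \<Rightarrow> real) \<Rightarrow> heis \<Rightarrow> real" where
  "heis_comm f p = fst (snd p) * (heis_X (heis_T f) p + heis_T (heis_X f) p)
     - fst p * (heis_Y (heis_T f) p + heis_T (heis_Y f) p)
     + ((fst p)\<^sup>2 + (fst (snd p))\<^sup>2) * heis_T (heis_T f) p"

lemma integral_heis_comm:
  assumes j: "2 \<le> j" and U: "open U" "gauge_cball \<subseteq> U" and g: "Ck_on 2 g U"
  shows "(\<integral>p. kbump (Suc j) p * heis_comm g p \<partial>lborel) = 0"
proof -
  define W where "W = kbump (Suc j)"
  define V where "V p = snd (snd p) * kbump j p" for p
  have j2: "2 \<le> Suc j" using j by simp
  have W: "Ck_on 1 W UNIV" "\<And>p. p \<notin> gauge_cball \<Longrightarrow> W p = 0"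
    using j by (auto simp: W_def kbump_outside simp del: Ck_on.simps intro!: Ck_on_kbump)
  have V0: "V p = 0" if "p \<notin> gauge_cball" for p using that j by (simp add: V_def kbump_outside)
  have g2: "Ck_on (Suc 1) g U" using g by (simp add: numeral_2_eq_2)
  have g1: "Ck_on 1 g U" using Ck_on_SucD[OF g2] .
  have gT: "Ck_on 1 (heis_T g) U" by (rule Ck_on_heis_T[OF U(1) g2])
  have gR: "Ck_on 1 (heis_rot g) U" by (rule Ck_on_heis_rot[OF U(1) g2])
  define F where "F p = W p * heis_rot g p" for p
  have F: "Ck_on 1 F UNIV"
    unfolding F_def [abs_def] by (rule Ck_on_mult_support[OF closed_gauge_cball U(2,1) open_UNIV W(1) gR W(2)])
  have F0: "\<And>p. p \<notin> gauge_cball \<Longrightarrow> F p = 0" by (simp add: F_def W)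
  have b: "(0, 0, 1) \<in> (Basis :: heis set)" by (auto simp: Basis_heis)
  have "continuous_on U (heis_rot (heis_T g))"
    using Ck_on_heis_rot[OF U(1) gT[unfolded One_nat_def]] by simp
  then have cT: "continuous_on gauge_cball (heis_rot (heis_T g))" using U(2) continuous_on_subset by blast
  have iT: "integrable lborel (\<lambda>p. W p * heis_rot (heis_T g) p)"
    unfolding W_def by (rule integrable_mult_support[OF compact_gauge_cball kbump_measurable kbump_abs_le _ cT])
      (simp add: kbump_outside)
  have cR: "continuous_on gauge_cball (heis_rot g)" using Ck_on_continuous[OF gR] U(2) continuous_on_subset by blast
  note V = integral_z_kbump_rot[OF j U g1 cR, folded V_def]
  have iF: "(\<integral>p. heis_T F p \<partial>lborel) = 0" "integrable lborel (heis_T F)"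
    using integral_partial_deriv_eq_0[OF F compact_gauge_cball F0 b] integrable_partial_deriv[OF F compact_gauge_cball F0 b] by auto
  \<comment> \<open>As operators, \<open>heis_comm\<close> is minus the sum of the two compositions
    of \<open>heis_rot\<close> and \<open>heis_T\<close>. Moving \<open>heis_T\<close> off
    \<open>heis_rot g\<close> by the product rule costs the z-derivative of \<open>W\<close>, the
    source of the constant 32 and of \<open>V\<close>.\<close>
  have "W p * heis_comm g p = - (W p * heis_rot (heis_T g) p) - heis_T F p - 32 * real (Suc j) * (V p * heis_rot g p)" for p
  proof (cases "p \<in> gauge_cball")
    case True
    then have p: "p \<in> U" using U by auto
    have WU: "Ck_on (Suc 0) W U" using Ck_on_subset[OF W(1), of U] by simp
    have TW: "heis_T W p = - (real (Suc j) * kbump j p) * (32 * snd (snd p))"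
      unfolding W_def partial_deriv_eqI[OF kbump_has_derivative[OF j2]] by simp
    note RU = gR[unfolded One_nat_def]
    have TF: "heis_T F p = W p * heis_T (heis_rot g) p + heis_T W p * heis_rot g p"
      unfolding F_def [abs_def] by (rule partial_deriv_mult[OF WU RU p])
    have D: "Ck_on (Suc 0) (partial_deriv (1, 0, 0) g) U" "Ck_on (Suc 0) (partial_deriv (0, 1, 0) g) U" "Ck_on (Suc 0) (heis_T g) U"
      using Ck_on_partial[OF g2] by (auto simp: Basis_heis simp del: Ck_on.simps)
    define x where "x = fst p" define y where "y = fst (snd p)"
    have D1: "Ck_on (Suc 0) (\<lambda>p. fst (snd p) / 2) U" "Ck_on (Suc 0) (\<lambda>p. fst p / 2) U"
      "Ck_on (Suc 0) (\<lambda>p. fst (snd p)) U" "Ck_on (Suc 0) (\<lambda>p. fst p) U"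
      unfolding divide_inverse by (intro Ck_on_mult Ck_on_coord Ck_on_const U(1))+
    have z: "heis_T (\<lambda>p. fst (snd p) / 2) p = 0" "heis_T (\<lambda>p. fst p / 2) p = 0"
      "heis_T (\<lambda>p. fst (snd p)) p = 0" "heis_T (\<lambda>p. fst p) p = 0"
      by (simp_all add: partial_deriv_def)
    have sub: "heis_T (\<lambda>p. f p - g p) p = heis_T f p - heis_T g p" 
      and add: "heis_T (\<lambda>p. f p + g p) p = heis_T f p + heis_T g p" 
      if fg: "Ck_on (Suc 0) f U" "Ck_on (Suc 0) g U" for f g
    proof -
      obtain f' where f: "(f has_derivative f') (at p)" using Ck_on_has_derivative_ex[OF fg(1) p] .
      obtain g' where g: "(g has_derivative g') (at p)" using Ck_on_has_derivative_ex[OF fg(2) p] .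
      show "heis_T (\<lambda>p. f p - g p) p = heis_T f p - heis_T g p" "heis_T (\<lambda>p. f p + g p) p = heis_T f p + heis_T g p"
        unfolding partial_deriv_eqI[OF has_derivative_diff[OF f g]] partial_deriv_eqI[OF has_derivative_add[OF f g]]
          partial_deriv_eqI[OF f] partial_deriv_eqI[OF g] by simp_all
    qed
    note m = Ck_on_mult[OF U(1)]
    have TX: "heis_T (heis_X g) p = heis_T (partial_deriv (1, 0, 0) g) p - y / 2 * heis_T (heis_T g) p"
      unfolding heis_X_def' sub[OF D(1) m[OF D1(1) D(3)]] partial_deriv_mult[OF D1(1) D(3) p] z by (simp add: y_def)
    have TY: "heis_T (heis_Y g) p = heis_T (partial_deriv (0, 1, 0) g) p + x / 2 * heis_T (heis_T g) p"
      unfolding heis_Y_def' add[OF D(2) m[OF D1(2) D(3)]] partial_deriv_mult[OF D1(2) D(3) p] z by (simp add: x_def)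
    have TR: "heis_T (heis_rot g) p = x * heis_T (partial_deriv (0, 1, 0) g) p - y * heis_T (partial_deriv (1, 0, 0) g) p"
      unfolding heis_rot_def [abs_def] sub[OF m[OF D1(4) D(2)] m[OF D1(3) D(1)]]
        partial_deriv_mult[OF D1(4) D(2) p] partial_deriv_mult[OF D1(3) D(1) p] z by (simp add: x_def y_def)
    have eq: "heis_comm g p = - heis_rot (heis_T g) p - heis_T (heis_rot g) p"
      unfolding heis_comm_def TX TY TR x_def[symmetric] y_def[symmetric]
      by (simp add: heis_X_def' heis_Y_def' heis_rot_def x_def[symmetric] y_def[symmetric] algebra_simps power2_eq_square)
    show ?thesis unfolding TF TW eq by (simp add: V_def algebra_simps)
  next
    case False
    then show ?thesis using W(2) V0 partial_deriv_outside[OF compact_gauge_cball F0 False] by simp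
  qed
  then have "(\<integral>p. W p * heis_comm g p \<partial>lborel) =
    - (\<integral>p. W p * heis_rot (heis_T g) p \<partial>lborel) - (\<integral>p. heis_T F p \<partial>lborel) - 32 * real (Suc j) * (\<integral>p. V p * heis_rot g p \<partial>lborel)"
    using iT V(2) iF(2) by simp
  also have "(\<integral>p. W p * heis_rot (heis_T g) p \<partial>lborel) = 0"
    by (rule integral_heis_rot[OF W _ U gT]) (assumption, unfold W_def, rule heis_rot_kbump(1)[OF j2])
  finally show ?thesis using iF V(1) by (simp add: W_def)
qed

section \<open>The sub-Laplacian acting on the left factor of a product\<close>

lemma heis_mult_right_has_derivative:
  "((\<lambda>q. heis_mult q p) has_derivative
    (\<lambda>h. (fst h, fst (snd h), snd (snd h) + (1/2) * (fst h * fst (snd p) - fst (snd h) * fst p)))) (at q)"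
  unfolding heis_mult_def by (auto intro!: derivative_eq_intros)

lemma heis_T_eqI: "(f has_derivative f') (at p) \<Longrightarrow> heis_T f p = f' (0, 0, 1)"
  by (rule partial_deriv_eqI)

text \<open>When q moves in the direction of X, the point \<open>heis_mult q p\<close> moves along X
  at that point plus y times the central direction, and along Y minus x times it when q moves along
  Y. The excess measures how far right translations fail to preserve left-invariant fields.\<close>

lemma heis_X_right_mult:
  assumes "Ck_on (Suc k) f S" "heis_mult q p \<in> S"
  shows "heis_X (\<lambda>q. f (heis_mult q p)) q = heis_X f (heis_mult q p) + fst (snd p) * heis_T f (heis_mult q p)"
    and "heis_Y (\<lambda>q. f (heis_mult q p)) q = heis_Y f (heis_mult q p) - fst p * heis_T f (heis_mult q p)"
proof -
  obtain f' where f: "(f has_derivative f') (at (heis_mult q p))" using Ck_on_has_derivative_ex[OF assms] .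
  interpret bounded_linear f' using f by (rule has_derivative_bounded_linear)
  obtain a b c x y z where qp: "q = (a, b, c)" "p = (x, y, z)" by (cases q; cases p)
  note c = has_derivative_compose[OF heis_mult_right_has_derivative f]
  have "heis_X (\<lambda>q. f (heis_mult q p)) q = f' (1, 0, - b / 2 + (1 / 2) * y)"
    unfolding heis_X_eqI[OF c] by (simp add: qp)
  also have "\<dots> = f' ((1, 0, - (b + y) / 2) + y *\<^sub>R (0, 0, 1))" by (simp add: field_simps)
  also have "\<dots> = heis_X f (heis_mult q p) + y * heis_T f (heis_mult q p)"
    unfolding add scaleR heis_X_eqI[OF f] heis_T_eqI[OF f] by (simp add: qp)
  finally show "heis_X (\<lambda>q. f (heis_mult q p)) q = heis_X f (heis_mult q p) + fst (snd p) * heis_T f (heis_mult q p)"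
    by (simp add: qp)
  have "heis_Y (\<lambda>q. f (heis_mult q p)) q = f' (0, 1, a / 2 - (1 / 2) * x)"
    unfolding heis_Y_eqI[OF c] by (simp add: qp)
  also have "\<dots> = f' ((0, 1, (a + x) / 2) + (- x) *\<^sub>R (0, 0, 1))" by (simp add: field_simps)
  also have "\<dots> = heis_Y f (heis_mult q p) - x * heis_T f (heis_mult q p)"
    unfolding add scaleR heis_Y_eqI[OF f] heis_T_eqI[OF f] by (simp add: qp)
  finally show "heis_Y (\<lambda>q. f (heis_mult q p)) q = heis_Y f (heis_mult q p) - fst p * heis_T f (heis_mult q p)"
    by (simp add: qp)
qed

lemma Ck_on_heis_right_mult:
  assumes "open S" "(\<lambda>q. heis_mult q p) ` S \<subseteq> T" "Ck_on k f T"
  shows "Ck_on k (\<lambda>q. f (heis_mult q p)) S"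
proof (rule Ck_on_heis_compose[OF assms(1) _ _ _ assms(2,3)])
qed (unfold heis_mult_def fst_conv snd_conv,
    (intro Ck_on_add Ck_on_diff Ck_on_mult Ck_on_const Ck_on_coord assms(1))+)

text \<open>Expansion of (X + y T)^2 + (Y - x T)^2, where x and y belong to the fixed
  \<open>p\<close> and are constants for differentiation in \<open>q\<close>. X T and T X remain
  separate terms, as in \<open>heis_comm\<close>.\<close>

lemma heis_laplacian_right_mult:
  assumes S: "open S" "Ck_on 2 f S" "heis_mult q p \<in> S"
  shows "heis_laplacian (\<lambda>q. f (heis_mult q p)) q = heis_laplacian f (heis_mult q p) +
    (fst (snd p) * (heis_X (heis_T f) (heis_mult q p) + heis_T (heis_X f) (heis_mult q p))
     - fst p * (heis_Y (heis_T f) (heis_mult q p) + heis_T (heis_Y f) (heis_mult q p))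
     + ((fst p)\<^sup>2 + (fst (snd p))\<^sup>2) * heis_T (heis_T f) (heis_mult q p))"
proof -
  define x where "x = fst p" define y where "y = fst (snd p)"
  define R where "R = (\<lambda>q. heis_mult q p)"
  have f: "Ck_on (Suc 1) f S" using S by (simp_all add: numeral_2_eq_2)
  have L: "open (R -` S)" "q \<in> R -` S"
    using S by (auto simp: R_def intro!: open_vimage continuous_intros)
  have c: "Ck_on (Suc 0) (heis_X f) S" "Ck_on (Suc 0) (heis_Y f) S" "Ck_on (Suc 0) (heis_T f) S"
    using S(1) f by (auto intro: Ck_on_heis_X Ck_on_heis_Y Ck_on_heis_T simp del: Ck_on.simps)
  have cR: "Ck_on (Suc 0) (\<lambda>q. h (R q)) (R -` S)" if "Ck_on (Suc 0) h S" for h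
    unfolding R_def by (rule Ck_on_heis_right_mult[OF L(1)[unfolded R_def] _ that]) blast
  note m = heis_X_mult[OF Ck_on_const cR L(2)]
  have cm: "Ck_on (Suc 0) (\<lambda>q. k * h (R q)) (R -` S)" if "Ck_on (Suc 0) h S" for h k
    by (rule Ck_on_mult[OF L(1) Ck_on_const cR[OF that]])
  have X: "heis_X (heis_X (\<lambda>q. f (R q))) q = heis_X (\<lambda>q. heis_X f (R q) + y * heis_T f (R q)) q"
    using heis_X_right_mult[OF f] by (intro heis_X_cong[OF L]) (auto simp: R_def y_def)
  have Y: "heis_Y (heis_Y (\<lambda>q. f (R q))) q = heis_Y (\<lambda>q. heis_Y f (R q) + (- x) * heis_T f (R q)) q"
    using heis_X_right_mult[OF f] by (intro heis_Y_cong[OF L]) (auto simp: R_def x_def)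
  have "heis_X (\<lambda>q. heis_X f (R q) + y * heis_T f (R q)) q =
     heis_X (\<lambda>q. heis_X f (R q)) q + y * heis_X (\<lambda>q. heis_T f (R q)) q"
    unfolding heis_X_add(1)[OF cR[OF c(1)] cm[OF c(3)] L(2)] m(1)[OF c(3)] by (simp add: heis_XY_const)
  also have "\<dots> = heis_X (heis_X f) (R q) + y * heis_T (heis_X f) (R q) + y * (heis_X (heis_T f) (R q) + y * heis_T (heis_T f) (R q))"
    using heis_X_right_mult(1)[OF c(1) S(3)] heis_X_right_mult(1)[OF c(3) S(3)] by (simp add: R_def y_def)
  finally have X': "heis_X (heis_X (\<lambda>q. f (R q))) q = \<dots>" unfolding X .
  have "heis_Y (\<lambda>q. heis_Y f (R q) + (- x) * heis_T f (R q)) q =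
     heis_Y (\<lambda>q. heis_Y f (R q)) q + (- x) * heis_Y (\<lambda>q. heis_T f (R q)) q"
    unfolding heis_X_add(2)[OF cR[OF c(2)] cm[OF c(3)] L(2)] m(2)[OF c(3)] by (simp add: heis_XY_const)
  also have "\<dots> = heis_Y (heis_Y f) (R q) - x * heis_T (heis_Y f) (R q) - x * (heis_Y (heis_T f) (R q) - x * heis_T (heis_T f) (R q))"
    using heis_X_right_mult(2)[OF c(2) S(3)] heis_X_right_mult(2)[OF c(3) S(3)] by (simp add: R_def x_def)
  finally have Y': "heis_Y (heis_Y (\<lambda>q. f (R q))) q = \<dots>" unfolding Y .
  have "heis_laplacian (\<lambda>q. f (R q)) q = heis_laplacian f (R q) +
    (y * (heis_X (heis_T f) (R q) + heis_T (heis_X f) (R q))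
     - x * (heis_Y (heis_T f) (R q) + heis_T (heis_Y f) (R q)) + (x\<^sup>2 + y\<^sup>2) * heis_T (heis_T f) (R q))"
    unfolding heis_laplacian_def X' Y' by (simp add: algebra_simps power2_eq_square)
  then show ?thesis by (simp add: R_def x_def y_def)
qed

lemma heis_T_mult_dil:
  assumes "Ck_on (Suc k) f S" "heis_mult q (heis_dil t p) \<in> S"
  shows "heis_T (\<lambda>p. f (heis_mult q (heis_dil t p))) p = t\<^sup>2 * heis_T f (heis_mult q (heis_dil t p))"
proof -
  obtain f' where f: "(f has_derivative f') (at (heis_mult q (heis_dil t p)))" using Ck_on_has_derivative_ex[OF assms] .
  interpret bounded_linear f' using f by (rule has_derivative_bounded_linear)
  have "heis_T (\<lambda>p. f (heis_mult q (heis_dil t p))) p = f' (t\<^sup>2 *\<^sub>R (0, 0, 1))"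
    unfolding heis_T_eqI[OF has_derivative_compose[OF has_derivative_compose[OF heis_dil_has_derivative heis_mult_has_derivative] f]]
    by simp
  then show ?thesis unfolding scaleR heis_T_eqI[OF f] by simp
qed

text \<open>The coordinates of the dilated point carry a factor t, while X T and T T of the
  pulled-back function scale by t^3 and t^4; division by t^2 matches the two. The excess thus
  becomes \<open>heis_comm\<close> in the variable \<open>p\<close>, whose integral against
  \<open>kbump (Suc j)\<close> is zero.\<close>

lemma heis_laplacian_right_mult_dil:
  assumes S: "open S" "Ck_on 2 f S" "heis_mult q (heis_dil t p) \<in> S" and t: "t \<noteq> 0"
  shows "heis_laplacian (\<lambda>q. f (heis_mult q (heis_dil t p))) q = heis_laplacian f (heis_mult q (heis_dil t p)) +
    heis_comm (\<lambda>p. f (heis_mult q (heis_dil t p))) p / t\<^sup>2"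
proof -
  define L where "L = (\<lambda>p. heis_mult q (heis_dil t p))"
  have f: "Ck_on (Suc 1) f S" using S by (simp_all add: numeral_2_eq_2)
  have L: "open (L -` S)" "p \<in> L -` S"
    using S by (auto simp: L_def intro!: open_vimage continuous_intros)
  have c: "Ck_on (Suc 0) (heis_X f) S" "Ck_on (Suc 0) (heis_Y f) S" "Ck_on (Suc 0) (heis_T f) S"
    using S(1) f by (auto intro: Ck_on_heis_X Ck_on_heis_Y Ck_on_heis_T simp del: Ck_on.simps)
  have cL: "Ck_on (Suc 0) (\<lambda>p. h (L p)) (L -` S)" if "Ck_on (Suc 0) h S" for h
    unfolding L_def by (rule Ck_on_heis_mult_dil[OF L(1)[unfolded L_def] _ that]) blast
  note m = heis_X_mult[OF Ck_on_const cL L(2)] partial_deriv_mult[OF Ck_on_const cL L(2), where b="(0, 0, 1)"]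
  have z: "heis_T (\<lambda>_. k) p = 0" for k by (simp add: partial_deriv_def)
  have XT: "heis_X (heis_T (\<lambda>p. f (L p))) p = heis_X (\<lambda>p. t\<^sup>2 * heis_T f (L p)) p"
    using heis_T_mult_dil[OF f] by (intro heis_X_cong[OF L]) (auto simp: L_def)
  have YT: "heis_Y (heis_T (\<lambda>p. f (L p))) p = heis_Y (\<lambda>p. t\<^sup>2 * heis_T f (L p)) p"
    using heis_T_mult_dil[OF f] by (intro heis_Y_cong[OF L]) (auto simp: L_def)
  have TT: "heis_T (heis_T (\<lambda>p. f (L p))) p = heis_T (\<lambda>p. t\<^sup>2 * heis_T f (L p)) p"
    using heis_T_mult_dil[OF f] by (intro partial_deriv_cong[OF L]) (auto simp: L_def)
  have TX: "heis_T (heis_X (\<lambda>p. f (L p))) p = heis_T (\<lambda>p. t * heis_X f (L p)) p"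
    using heis_X_mult_dil[OF f] by (intro partial_deriv_cong[OF L]) (auto simp: L_def)
  have TY: "heis_T (heis_Y (\<lambda>p. f (L p))) p = heis_T (\<lambda>p. t * heis_Y f (L p)) p"
    using heis_X_mult_dil[OF f] by (intro partial_deriv_cong[OF L]) (auto simp: L_def)
  have l: "heis_X (\<lambda>p. h (L p)) p = t * heis_X h (L p)" "heis_Y (\<lambda>p. h (L p)) p = t * heis_Y h (L p)"
    "heis_T (\<lambda>p. h (L p)) p = t\<^sup>2 * heis_T h (L p)" if "Ck_on (Suc 0) h S" for h
    using heis_X_mult_dil[OF that S(3)] heis_T_mult_dil[OF that S(3)] by (simp_all add: L_def)
  have "heis_comm (\<lambda>p. f (L p)) p = fst (snd p) * (t\<^sup>2 * (t * heis_X (heis_T f) (L p)) + t * (t\<^sup>2 * heis_T (heis_X f) (L p)))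
     - fst p * (t\<^sup>2 * (t * heis_Y (heis_T f) (L p)) + t * (t\<^sup>2 * heis_T (heis_Y f) (L p)))
     + ((fst p)\<^sup>2 + (fst (snd p))\<^sup>2) * (t\<^sup>2 * (t\<^sup>2 * heis_T (heis_T f) (L p)))"
    unfolding heis_comm_def XT YT TT TX TY using m[OF c(1)] m[OF c(2)] m[OF c(3)] l[OF c(1)] l[OF c(2)] l[OF c(3)]
    by (simp add: heis_XY_const z)
  then have "heis_comm (\<lambda>p. f (L p)) p / t\<^sup>2 = (t * fst (snd p)) * (heis_X (heis_T f) (L p) + heis_T (heis_X f) (L p))
     - (t * fst p) * (heis_Y (heis_T f) (L p) + heis_T (heis_Y f) (L p))
     + ((t * fst p)\<^sup>2 + (t * fst (snd p))\<^sup>2) * heis_T (heis_T f) (L p)"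
    using t by (simp add: field_simps power2_eq_square)
  then show ?thesis
    using heis_laplacian_right_mult[OF S] by (simp add: L_def heis_dil_def')
qed

text \<open>Differentiation under the integral sign for the horizontal fields. The last two claims
  keep joint regularity in parameter and integration variable, so that the lemma applies to its own
  output and yields second derivatives.\<close>

lemma heis_XY_parametric:
  fixes F :: "heis \<times> 'b::euclidean_space \<Rightarrow> real"
  assumes pi: "parametric_integral U V C w B" and F: "Ck_on (Suc k) F V"
  shows "q \<in> U \<Longrightarrow> heis_X (\<lambda>q. \<integral>b. w b * F (q, b) \<partial>lborel) q = (\<integral>b. w b * heis_X (\<lambda>q. F (q, b)) q \<partial>lborel)"
    and "q \<in> U \<Longrightarrow> heis_Y (\<lambda>q. \<integral>b. w b * F (q, b) \<partial>lborel) q = (\<integral>b. w b * heis_Y (\<lambda>q. F (q, b)) q \<partial>lborel)"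
    and "Ck_on k (\<lambda>x. heis_X (\<lambda>q. F (q, snd x)) (fst x)) V"
    and "Ck_on k (\<lambda>x. heis_Y (\<lambda>q. F (q, snd x)) (fst x)) V"
proof -
  interpret parametric_integral U V C w B by (rule pi)
  have F1: "Ck_on 1 F V" using F by (rule Ck_on_mono) simp
  have d: "partial_deriv c (\<lambda>q. F (q, b)) q = partial_deriv (c, 0) F (q, b)" for c q b
    by (simp add: partial_deriv_def)
  have B: "((1, 0, 0), 0) \<in> (Basis :: (heis \<times> 'b) set)" "((0, 1, 0), 0) \<in> (Basis :: (heis \<times> 'b) set)"
    "((0, 0, 1), 0) \<in> (Basis :: (heis \<times> 'b) set)" by (auto simp: Basis_prod_def zero_prod_def)
  have b: "(1, 0, 0) \<in> (Basis :: heis set)" "(0, 1, 0) \<in> (Basis :: heis set)" "(0, 0, 1) \<in> (Basis :: heis set)"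
    by (auto simp: Basis_heis)
  note P = Ck_on_partial[OF F B(1)] Ck_on_partial[OF F B(2)] Ck_on_partial[OF F B(3)]
  note c = Ck_on_continuous[OF P(1)] Ck_on_continuous[OF P(2)] Ck_on_continuous[OF P(3)]
  have l: "Ck_on k (\<lambda>x::heis \<times> 'b. fst (snd (fst x)) / 2) V" "Ck_on k (\<lambda>x::heis \<times> 'b. fst (fst x) / 2) V"
    by (intro Ck_on_bounded_linear bounded_linear_intros bounded_linear_divide bounded_linear_compose[OF bounded_linear_divide])+
  show "Ck_on k (\<lambda>x. heis_X (\<lambda>q. F (q, snd x)) (fst x)) V" "Ck_on k (\<lambda>x. heis_Y (\<lambda>q. F (q, snd x)) (fst x)) V"
    unfolding heis_X_def' heis_Y_def' d prod.collapse
    by (intro Ck_on_diff Ck_on_add Ck_on_mult V(1) P l)+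
  show "heis_X (\<lambda>q. \<integral>b. w b * F (q, b) \<partial>lborel) q = (\<integral>b. w b * heis_X (\<lambda>q. F (q, b)) q \<partial>lborel)" if q: "q \<in> U"
  proof -
    have "(\<integral>b. w b * heis_X (\<lambda>q. F (q, b)) q \<partial>lborel) = (\<integral>b. w b * partial_deriv ((1, 0, 0), 0) F (q, b)
        - fst (snd q) / 2 * (w b * partial_deriv ((0, 0, 1), 0) F (q, b)) \<partial>lborel)"
      unfolding heis_X_def' d by (simp add: algebra_simps)
    also have "\<dots> = (\<integral>b. w b * partial_deriv ((1, 0, 0), 0) F (q, b) \<partial>lborel)
        - fst (snd q) / 2 * (\<integral>b. w b * partial_deriv ((0, 0, 1), 0) F (q, b) \<partial>lborel)"
      using integrable_section[OF c(1) q] integrable_section[OF c(3) q]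
      by (subst Bochner_Integration.integral_diff) (auto intro: integrable_mult_right)
    finally show ?thesis
      by (simp only: heis_X_def' partial_deriv_parametric_integral[OF pi F1 q b(1)] partial_deriv_parametric_integral[OF pi F1 q b(3)])
  qed
  show "heis_Y (\<lambda>q. \<integral>b. w b * F (q, b) \<partial>lborel) q = (\<integral>b. w b * heis_Y (\<lambda>q. F (q, b)) q \<partial>lborel)" if q: "q \<in> U"
  proof -
    have "(\<integral>b. w b * heis_Y (\<lambda>q. F (q, b)) q \<partial>lborel) = (\<integral>b. w b * partial_deriv ((0, 1, 0), 0) F (q, b)
        + fst q / 2 * (w b * partial_deriv ((0, 0, 1), 0) F (q, b)) \<partial>lborel)"
      unfolding heis_Y_def' d by (simp add: algebra_simps)
    also have "\<dots> = (\<integral>b. w b * partial_deriv ((0, 1, 0), 0) F (q, b) \<partial>lborel)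
        + fst q / 2 * (\<integral>b. w b * partial_deriv ((0, 0, 1), 0) F (q, b) \<partial>lborel)"
      using integrable_section[OF c(2) q] integrable_section[OF c(3) q]
      by (subst Bochner_Integration.integral_add) (auto intro: integrable_mult_right)
    finally show ?thesis
      by (simp only: heis_Y_def' partial_deriv_parametric_integral[OF pi F1 q b(2)] partial_deriv_parametric_integral[OF pi F1 q b(3)])
  qed
qed

lemma heis_laplacian_parametric:
  fixes F :: "heis \<times> 'b::euclidean_space \<Rightarrow> real"
  assumes pi: "parametric_integral U V C w B" and F: "Ck_on 2 F V" and q: "q \<in> U"
  shows "heis_laplacian (\<lambda>q. \<integral>b. w b * F (q, b) \<partial>lborel) q = (\<integral>b. w b * heis_laplacian (\<lambda>q. F (q, b)) q \<partial>lborel)"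
    and "integrable lborel (\<lambda>b. w b * heis_laplacian (\<lambda>q. F (q, b)) q)"
proof -
  interpret parametric_integral U V C w B by (rule pi)
  have F2: "Ck_on (Suc (Suc 0)) F V" using F by (simp only: numeral_2_eq_2)
  note P = heis_XY_parametric[OF pi F2]
  have X: "heis_X (heis_X (\<lambda>q. \<integral>b. w b * F (q, b) \<partial>lborel)) q = (\<integral>b. w b * heis_X (heis_X (\<lambda>q. F (q, b))) q \<partial>lborel)"
  proof -
    have "heis_X (heis_X (\<lambda>q. \<integral>b. w b * F (q, b) \<partial>lborel)) q = heis_X (\<lambda>q. \<integral>b. w b * heis_X (\<lambda>q. F (q, b)) q \<partial>lborel) q"
      by (rule heis_X_cong[OF U q P(1)])
    then show ?thesis using heis_XY_parametric(1)[OF pi P(3) q] by simp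
  qed
  have Y: "heis_Y (heis_Y (\<lambda>q. \<integral>b. w b * F (q, b) \<partial>lborel)) q = (\<integral>b. w b * heis_Y (heis_Y (\<lambda>q. F (q, b))) q \<partial>lborel)"
  proof -
    have "heis_Y (heis_Y (\<lambda>q. \<integral>b. w b * F (q, b) \<partial>lborel)) q = heis_Y (\<lambda>q. \<integral>b. w b * heis_Y (\<lambda>q. F (q, b)) q \<partial>lborel) q"
      by (rule heis_Y_cong[OF U q P(2)])
    then show ?thesis using heis_XY_parametric(2)[OF pi P(4) q] by simp
  qed
  note c = Ck_on_continuous[OF heis_XY_parametric(3)[OF pi P(3)]] Ck_on_continuous[OF heis_XY_parametric(4)[OF pi P(4)]]
  have iX: "integrable lborel (\<lambda>b. w b * heis_X (heis_X (\<lambda>q. F (q, b))) q)"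
    using integrable_section[OF c(1) q] by simp
  have iY: "integrable lborel (\<lambda>b. w b * heis_Y (heis_Y (\<lambda>q. F (q, b))) q)"
    using integrable_section[OF c(2) q] by simp
  show "integrable lborel (\<lambda>b. w b * heis_laplacian (\<lambda>q. F (q, b)) q)"
    unfolding heis_laplacian_def distrib_left using iX iY by (rule Bochner_Integration.integrable_add)
  show "heis_laplacian (\<lambda>q. \<integral>b. w b * F (q, b) \<partial>lborel) q = (\<integral>b. w b * heis_laplacian (\<lambda>q. F (q, b)) q \<partial>lborel)"
    unfolding heis_laplacian_def distrib_left X Y Bochner_Integration.integral_add[OF iX iY] ..
qed

text \<open>The density of \<open>mean_value_has_integral\<close>, written as an unnormalised weight
  on pairs (t, p), so that the sub-Laplacian of the smoothed function becomes the difference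
  evaluated there.\<close>

definition ksmooth :: "nat \<Rightarrow> real \<Rightarrow> real \<times> heis \<Rightarrow> real" where
  "ksmooth j s b = indicator ({0..s} \<times> gauge_cball) b * fst b * kbump (Suc j) (snd b)"

definition heis_smooth :: "nat \<Rightarrow> real \<Rightarrow> (heis \<Rightarrow> real) \<Rightarrow> heis \<Rightarrow> real" where
  "heis_smooth j s h q = (\<integral>b. ksmooth j s b * h (heis_mult q (heis_dil (fst b) (snd b))) \<partial>lborel)"

lemma ksmooth_nonneg: "ksmooth j s b \<ge> 0"
  unfolding ksmooth_def using kbump_nonneg by (auto simp: indicator_def)

lemma ksmooth_outside: "b \<notin> {0..s} \<times> gauge_cball \<Longrightarrow> ksmooth j s b = 0" by (simp add: ksmooth_def)

lemma ksmooth_abs_le: "0 \<le> s \<Longrightarrow> \<bar>ksmooth j s b\<bar> \<le> s"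
  using mult_mono[of "fst b" s "kbump (Suc j) (snd b)" 1] kbump_le_1 kbump_nonneg
  by (cases "b \<in> {0..s} \<times> gauge_cball") (auto simp: ksmooth_def abs_mult)

lemma compact_ksmooth: "compact ({0..s} \<times> gauge_cball :: (real \<times> heis) set)"
  by (intro compact_Times compact_gauge_cball compact_Icc)

lemma ksmooth_measurable: "ksmooth j s \<in> borel_measurable borel"
proof -
  have "(\<lambda>b::real \<times> heis. fst b * kbump (Suc j) (snd b)) \<in> borel_measurable borel"
    by (intro borel_measurable_continuous_onI continuous_intros continuous_on_compose2[OF Ck_on_continuous[OF Ck_on_kbump[of 0 "Suc j"]]]) auto
  moreover have "(\<lambda>b. indicator ({0..s} \<times> gauge_cball) b :: real) \<in> borel_measurable (borel :: (real \<times> heis) measure)"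
    using borel_compact[OF compact_ksmooth] by simp
  ultimately show ?thesis unfolding ksmooth_def [abs_def] mult.assoc by (rule borel_measurable_times[rotated])
qed

text \<open>Applied to a function with \<open>h = M h\<close> for the mean \<open>M\<close> with weight \<open>kmean j\<close> at one fixed
  radius, this produces a genuinely harmonic function.\<close>

lemma heis_smooth_laplacian:
  assumes j: "2 \<le> j" and D: "open D" and h: "Ck_on 2 h D"
    and U: "open U" "\<And>q t p. q \<in> U \<Longrightarrow> t \<in> {0..s} \<Longrightarrow> p \<in> gauge_cball \<Longrightarrow> heis_mult q (heis_dil t p) \<in> D"
    and s: "0 \<le> s" "s < 1"
  shows "Ck_on 2 (heis_smooth j s h) U"
    and "q \<in> U \<Longrightarrow> ball q e \<subseteq> D \<Longrightarrow> s * (3 + norm q) < e \<Longrightarrow> heis_laplacian (heis_smooth j s h) q =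
      (\<integral>p. kmean j p * h (heis_mult q (heis_dil s p)) \<partial>lborel) - (\<integral>p. kmean j p \<partial>lborel) * h q"
proof -
  define F where "F = (\<lambda>(q, t, p). h (heis_mult q (heis_dil t p)))"
  define V where "V = (\<lambda>(q, t, p). heis_mult q (heis_dil t p)) -` D"
  have V: "open V" unfolding V_def case_prod_beta by (intro open_vimage D continuous_intros)
  have F: "Ck_on 2 F V" unfolding F_def
    by (rule Ck_on_heis_mult_dil_joint[OF V h]) (auto simp: V_def)
  have pi: "parametric_integral U V ({0..s} \<times> gauge_cball) (ksmooth j s) s"
    using U V ksmooth_measurable ksmooth_abs_le[OF s(1)] ksmooth_outside compact_ksmooth by unfold_locales (auto simp: V_def)
  have Aeq: "heis_smooth j s h = (\<lambda>q. \<integral>b. ksmooth j s b * F (q, b) \<partial>lborel)"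
    by (auto simp: heis_smooth_def F_def case_prod_beta)
  show "Ck_on 2 (heis_smooth j s h) U" unfolding Aeq by (rule Ck_on_parametric_integral[OF pi F])
  assume q: "q \<in> U" and e: "ball q e \<subseteq> D" "s * (3 + norm q) < e"
  define G where "G b = heis_laplacian (\<lambda>q. F (q, b)) q" for b
  note L = heis_laplacian_parametric[OF pi F q, folded G_def]
  have iG: "integrable (lborel \<Otimes>\<^sub>M lborel) (\<lambda>b. ksmooth j s b * G b)" using L(2) by (simp add: lborel_prod)
  define N where "N t = (\<integral>p. kbump (Suc j) p * heis_laplacian h (heis_mult q (heis_dil t p)) \<partial>lborel)" for t
  \<comment> \<open>For fixed t > 0 the sub-Laplacian in \<open>q\<close> equals that of
    \<open>h\<close> at the moved point plus the \<open>heis_comm\<close> excess, which integrates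
    to zero over \<open>p\<close>.\<close>
  have inner: "(\<integral>p. ksmooth j s (t, p) * G (t, p) \<partial>lborel) = indicator {0..s} t * (t * N t)" for t
  proof (cases "t \<in> {0..s} \<and> t \<noteq> 0")
    case True
    define W where "W = (\<lambda>p. heis_mult q (heis_dil t p)) -` D"
    define g where "g p = h (heis_mult q (heis_dil t p))" for p
    have W: "open W" "gauge_cball \<subseteq> W"
    proof -
      show "open W" using open_heis_mult_dil_vimage[OF D] by (simp add: W_def)
      show "gauge_cball \<subseteq> W" using U(2)[OF q] True by (auto simp: W_def)
    qed
    have g: "Ck_on 2 g W" unfolding g_def [abs_def]
      by (rule Ck_on_heis_mult_dil[OF W(1) _ h]) (auto simp: W_def)
    have g2: "Ck_on (Suc (Suc 0)) g W" and h2: "Ck_on (Suc (Suc 0)) h D" using g h by (simp_all only: numeral_2_eq_2)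
    have pt: "ksmooth j s (t, p) * G (t, p) = t * (kbump (Suc j) p * heis_laplacian h (heis_mult q (heis_dil t p)))
       + (1 / t) * (kbump (Suc j) p * heis_comm g p)" for p
    proof (cases "p \<in> gauge_cball")
      case True': True
      then have "heis_mult q (heis_dil t p) \<in> D" using W by (auto simp: W_def)
      then have eq: "G (t, p) = heis_laplacian h (heis_mult q (heis_dil t p)) + heis_comm g p / t\<^sup>2"
        using heis_laplacian_right_mult_dil[OF D h] True unfolding G_def F_def g_def [abs_def] by simp
      show ?thesis unfolding eq using True True' by (simp add: ksmooth_def field_simps power2_eq_square)
    qed (simp add: ksmooth_def kbump_outside)
    have c1: "continuous_on gauge_cball (\<lambda>p. heis_laplacian h (heis_mult q (heis_dil t p)))"
      by (rule continuous_on_compose2[OF Ck_on_continuous[OF Ck_on_heis_laplacian[OF D h2]]])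
        (use W(2) in \<open>auto simp: W_def intro!: continuous_intros\<close>)
    have c2: "continuous_on gauge_cball (heis_comm g)"
    proof -
      have "Ck_on 0 (heis_comm g) W" unfolding heis_comm_def [abs_def]
        by (intro Ck_on_add Ck_on_diff Ck_on_mult Ck_on_power Ck_on_coord W(1) Ck_on_heis_X Ck_on_heis_Y Ck_on_heis_T g2)
      then show ?thesis using W(2) Ck_on_continuous continuous_on_subset by blast
    qed
    have i1: "integrable lborel (\<lambda>p. kbump (Suc j) p * heis_laplacian h (heis_mult q (heis_dil t p)))"
      by (rule integrable_mult_support[OF compact_gauge_cball kbump_measurable kbump_abs_le _ c1]) (simp add: kbump_outside)
    have i2: "integrable lborel (\<lambda>p. kbump (Suc j) p * heis_comm g p)"
      by (rule integrable_mult_support[OF compact_gauge_cball kbump_measurable kbump_abs_le _ c2]) (simp add: kbump_outside)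
    have "(\<integral>p. ksmooth j s (t, p) * G (t, p) \<partial>lborel) = t * N t + (1 / t) * (\<integral>p. kbump (Suc j) p * heis_comm g p \<partial>lborel)"
      unfolding pt Bochner_Integration.integral_add[OF integrable_mult_right[OF i1] integrable_mult_right[OF i2]]
      by (simp only: integral_mult_right_zero N_def)
    then show ?thesis using integral_heis_comm[OF j W g] True by simp
  next
    case False
    then show ?thesis by (auto simp: ksmooth_def indicator_def)
  qed
  have "heis_laplacian (heis_smooth j s h) q = (\<integral>b. ksmooth j s b * G b \<partial>(lborel \<Otimes>\<^sub>M lborel))"
    unfolding Aeq L(1) by (simp add: lborel_prod)
  also have "\<dots> = (\<integral>t. indicator {0..s} t * (t * N t) \<partial>lborel)"
    using lborel_pair.integral_fst'[OF iG] by (simp only: inner)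
  finally have 1: "heis_laplacian (heis_smooth j s h) q = (\<integral>t. indicator {0..s} t * (t * N t) \<partial>lborel)" .
  have "integrable lborel (\<lambda>t. indicator {0..s} t * (t * N t))"
    using lborel_pair.integrable_fst'[OF iG] by (simp only: inner)
  then have "((\<lambda>t. indicator {0..s} t * (t * N t)) has_integral (\<integral>t. indicator {0..s} t * (t * N t) \<partial>lborel)) UNIV"
    by (rule has_integral_integral_lborel)
  moreover have "(\<lambda>t. indicator {0..s} t * (t * N t)) = (\<lambda>t. if t \<in> {0..s} then t * N t else 0)"
    by (auto simp: indicator_def)
  ultimately have "((\<lambda>t. t * N t) has_integral (\<integral>t. indicator {0..s} t * (t * N t) \<partial>lborel)) {0..s}"
    by (simp only: has_integral_restrict_UNIV)
  \<comment> \<open>The integrand over {0..s} is that of the mean value formula, so the value is the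
    difference given there.\<close>
  from has_integral_unique[OF this mean_value_has_integral[OF j D e(1) h s e(2), folded N_def]]
  show "heis_laplacian (heis_smooth j s h) q = (\<integral>p. kmean j p * h (heis_mult q (heis_dil s p)) \<partial>lborel) - (\<integral>p. kmean j p \<partial>lborel) * h q"
    unfolding 1 .
qed

text \<open>A change of variables transfers the parameter \<open>q\<close> from \<open>u\<close> to
  the kernel, so all regularity comes from \<open>kmean j\<close> while \<open>u\<close> may be a
  rough bounded function.\<close>

lemma Ck_on_kernel_mean:
  assumes k: "k < j" and s: "s \<noteq> 0" and u: "u \<in> borel_measurable borel" "\<And>p. \<bar>u p\<bar> \<le> B"
    and C: "compact C" "\<And>p. p \<notin> C \<Longrightarrow> u p = 0"
  shows "Ck_on k (\<lambda>q. \<integral>p. kmean j p * u (heis_mult q (heis_dil s p)) \<partial>lborel) UNIV"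
proof -
  define F where "F = (\<lambda>x. kmean j (heis_dil (1 / s) (heis_mult (heis_inv (fst x)) (snd x))))"
  have inv: "heis_inv q = (- fst q, - fst (snd q), - snd (snd q))" for q by (cases q) simp
  have l: "Ck_on k (\<lambda>x::heis \<times> heis. fst (fst x)) UNIV" "Ck_on k (\<lambda>x::heis \<times> heis. fst (snd (fst x))) UNIV"
    "Ck_on k (\<lambda>x::heis \<times> heis. snd (snd (fst x))) UNIV" "Ck_on k (\<lambda>x::heis \<times> heis. fst (snd x)) UNIV"
    "Ck_on k (\<lambda>x::heis \<times> heis. fst (snd (snd x))) UNIV" "Ck_on k (\<lambda>x::heis \<times> heis. snd (snd (snd x))) UNIV"
    by (intro Ck_on_bounded_linear bounded_linear_intros)+
  have F: "Ck_on k F UNIV" unfolding F_def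
  proof (rule Ck_on_heis_compose[OF open_UNIV _ _ _ subset_UNIV Ck_on_kmean[OF k]])
  qed (unfold heis_mult_def heis_dil_def' inv fst_conv snd_conv,
    (intro Ck_on_add Ck_on_diff Ck_on_mult Ck_on_power Ck_on_uminus Ck_on_const l open_UNIV)+)
  have pi: "parametric_integral UNIV UNIV C u B"
    using u C by unfold_locales auto
  have "(\<integral>p. kmean j p * u (heis_mult q (heis_dil s p)) \<partial>lborel) = (1 / s ^ 4) * (\<integral>p. u p * F (q, p) \<partial>lborel)" for q
  proof -
    have "(\<lambda>p. F (q, p)) \<in> borel_measurable borel"
      by (rule borel_measurable_continuous_onI,
          rule continuous_on_compose2[OF Ck_on_continuous[OF F], where f="\<lambda>p. (q, p)"])
        (intro continuous_on_Pair continuous_on_const continuous_on_id, simp)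
    then have m: "(\<lambda>p. u p * F (q, p)) \<in> borel_measurable borel" using u(1) by (intro borel_measurable_times)
    from integral_heis_mult_dil[OF m s, of q] s show ?thesis
      by (simp add: F_def heis_dil_dil mult.commute)
  qed
  moreover have "Ck_on k (\<lambda>q. (1 / s ^ 4) * (\<integral>p. u p * F (q, p) \<partial>lborel)) UNIV"
    by (intro Ck_on_mult Ck_on_const open_UNIV Ck_on_parametric_integral[OF pi F])
  ultimately show ?thesis by simp
qed

section \<open>Approximate solution of the Dirichlet problem\<close>

lemma heis_mean_ge:
  assumes j: "2 \<le> j" and D: "open D" "ball q e \<subseteq> D" and h: "Ck_on 2 h D"
    and nn: "\<And>p. p \<in> ball q e \<Longrightarrow> heis_laplacian h p \<ge> 0"
    and s: "0 \<le> s" "s < 1" "s * (3 + norm q) < e"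
  shows "(\<integral>p. kmean j p \<partial>lborel) * h q \<le> (\<integral>p. kmean j p * h (heis_mult q (heis_dil s p)) \<partial>lborel)"
proof -
  have "0 \<le> (\<integral>p. kmean j p * h (heis_mult q (heis_dil s p)) \<partial>lborel) - (\<integral>p. kmean j p \<partial>lborel) * h q"
  proof (rule has_integral_nonneg[OF mean_value_has_integral[OF j D h s]])
    fix t assume t: "t \<in> {0..s}"
    have "t * (3 + norm q) \<le> s * (3 + norm q)" using t by (intro mult_right_mono) auto
    then have t': "\<bar>t\<bar> < 1" "\<bar>t\<bar> * (3 + norm q) < e" using s t by auto
    have nn': "kbump (Suc j) p * heis_laplacian h (heis_mult q (heis_dil t p)) \<ge> 0" for p
    proof (cases "p \<in> gauge_cball")
      case True
      then show ?thesis using heis_mult_dil_in_ball[OF True t'] nn kbump_nonneg by (intro mult_nonneg_nonneg) auto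
    qed (simp add: kbump_outside)
    have "0 \<le> (\<integral>p. kbump (Suc j) p * heis_laplacian h (heis_mult q (heis_dil t p)) \<partial>lborel)"
      by (intro integral_nonneg_AE AE_I2 nn')
    then show "0 \<le> t * (\<integral>p. kbump (Suc j) p * heis_laplacian h (heis_mult q (heis_dil t p)) \<partial>lborel)"
      using t by (intro mult_nonneg_nonneg) auto
  qed
  then show ?thesis by simp
qed

lemma heis_mean_le:
  assumes j: "2 \<le> j" and D: "open D" "ball q e \<subseteq> D" and h: "Ck_on 2 h D"
    and np: "\<And>p. p \<in> ball q e \<Longrightarrow> heis_laplacian h p \<le> 0"
    and s: "0 \<le> s" "s < 1" "s * (3 + norm q) < e"
  shows "(\<integral>p. kmean j p * h (heis_mult q (heis_dil s p)) \<partial>lborel) \<le> (\<integral>p. kmean j p \<partial>lborel) * h q"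
proof -
  have "heis_laplacian (\<lambda>p. - h p) p \<ge> 0" if "p \<in> ball q e" for p
    using heis_laplacian_uminus[OF D(1) h, of p] np[OF that] that D(2) by auto
  from heis_mean_ge[OF j D Ck_on_uminus[OF D(1) h] this s] show ?thesis by simp
qed

lemma heis_mean_eq:
  assumes "2 \<le> j" "open D" "ball q e \<subseteq> D" "Ck_on 2 h D"
    and "\<And>p. p \<in> ball q e \<Longrightarrow> heis_laplacian h p = 0"
    and "0 \<le> s" "s < 1" "s * (3 + norm q) < e"
  shows "(\<integral>p. kmean j p * h (heis_mult q (heis_dil s p)) \<partial>lborel) = (\<integral>p. kmean j p \<partial>lborel) * h q"
  using heis_mean_ge[OF assms(1-4) _ assms(6-8)] heis_mean_le[OF assms(1-4) _ assms(6-8)] assms(5)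
  by (intro antisym) simp_all

lemma ksmooth_integral_pos:
  assumes s: "0 < s" shows "integrable lborel (ksmooth j s)" "(\<integral>b. ksmooth j s b \<partial>lborel) > 0"
proof -
  show i: "integrable lborel (ksmooth j s)"
  proof -
    have "integrable lborel (\<lambda>b. ksmooth j s b * 1)"
      by (rule integrable_mult_support[OF compact_ksmooth[of s] ksmooth_measurable ksmooth_abs_le ksmooth_outside continuous_on_const]) (use s in auto)
    then show ?thesis by simp
  qed
  show "(\<integral>b. ksmooth j s b \<partial>lborel) > 0"
  proof (rule integral_pos_if_pos_on_open[OF i ksmooth_nonneg, of "{0<..<s} \<times> gauge_ball"])
    show "open ({0<..<s} \<times> gauge_ball)" by (intro open_Times open_greaterThanLessThan open_gauge_ball)
    have "(s / 2, (0, 0, 0)) \<in> {0<..<s} \<times> gauge_ball" using s by (simp add: gauge_ball_def)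
    then show "{0<..<s} \<times> gauge_ball \<noteq> {}" by blast
    show "ksmooth j s b > 0" if "b \<in> {0<..<s} \<times> gauge_ball" for b
      using that gauge_ball_subset by (auto simp: ksmooth_def kbump_def gauge_ball_def gauge_cball_def)
  qed
qed

section \<open>Barriers and monotone iteration of the kernel mean\<close>

definition heis_bump :: "heis \<Rightarrow> real \<Rightarrow> heis \<Rightarrow> real" where
  "heis_bump q0 R p = R\<^sup>2 - (dist p q0)\<^sup>2"

lemma heis_bump_eq: "heis_bump q0 R p = R\<^sup>2 - ((fst p - fst q0)\<^sup>2 + (fst (snd p) - fst (snd q0))\<^sup>2 + (snd (snd p) - snd (snd q0))\<^sup>2)"
  by (cases p; cases q0) (simp add: heis_bump_def dist_prod_def dist_real_def add.assoc)

lemma Ck_on_heis_bump: "Ck_on k (heis_bump q0 R) S"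
proof -
  have "Ck_on k (heis_bump q0 R) UNIV" unfolding heis_bump_eq [abs_def]
    by (intro Ck_on_diff Ck_on_add Ck_on_power Ck_on_coord Ck_on_const open_UNIV)
  then show ?thesis by (rule Ck_on_subset) simp
qed

text \<open>The centre \<open>q0\<close> drops out. The value is at most -4 at every point, which
  gives a strict barrier for all boundary points at once, including those where X and Y are both
  tangent to the sphere.\<close>

lemma heis_laplacian_bump: "heis_laplacian (heis_bump q0 R) p = - 4 - ((fst p)\<^sup>2 + (fst (snd p))\<^sup>2) / 2"
proof -
  have d: "(heis_bump q0 R has_derivative (\<lambda>h. - (2 * ((fst p - fst q0) * fst h + (fst (snd p) - fst (snd q0)) * fst (snd h)
     + (snd (snd p) - snd (snd q0)) * snd (snd h))))) (at p)" for p
    unfolding heis_bump_eq [abs_def] by (auto intro!: derivative_eq_intros simp: algebra_simps)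
  have X: "heis_X (heis_bump q0 R) = (\<lambda>p. - 2 * (fst p - fst q0) + fst (snd p) * (snd (snd p) - snd (snd q0)))"
    and Y: "heis_Y (heis_bump q0 R) = (\<lambda>p. - 2 * (fst (snd p) - fst (snd q0)) - fst p * (snd (snd p) - snd (snd q0)))"
    unfolding heis_X_eqI[OF d] heis_Y_eqI[OF d] fun_eq_iff by (simp_all add: field_simps)
  have dX: "((\<lambda>p::heis. - 2 * (fst p - fst q0) + fst (snd p) * (snd (snd p) - snd (snd q0))) has_derivative
     (\<lambda>h. - 2 * fst h + (fst (snd h) * (snd (snd p) - snd (snd q0)) + fst (snd p) * snd (snd h)))) (at p)"
    by (auto intro!: derivative_eq_intros simp: algebra_simps)
  have dY: "((\<lambda>p::heis. - 2 * (fst (snd p) - fst (snd q0)) - fst p * (snd (snd p) - snd (snd q0))) has_derivative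
     (\<lambda>h. - 2 * fst (snd h) - (fst h * (snd (snd p) - snd (snd q0)) + fst p * snd (snd h)))) (at p)"
    by (auto intro!: derivative_eq_intros simp: algebra_simps)
  show ?thesis unfolding heis_laplacian_def X Y heis_X_eqI[OF dX] heis_Y_eqI[OF dY]
    by (simp add: power2_eq_square field_simps)
qed

text \<open>The mean is monotone, raises \<open>lo\<close> and lowers \<open>up\<close>, so iterates
  started at \<open>lo\<close> increase and never exceed \<open>up\<close>. Outside the ball they
  stay frozen at \<open>lo\<close>; the collar of width \<open>\<delta>\<close> contains every point
  that the mean looks at. The exponent 3 is the smallest for which \<open>Ck_on_kernel_mean\<close>
  gives C^2.\<close>

lemma dirichlet_iteration:
  fixes lo up :: "heis \<Rightarrow> real"
  assumes lo: "Ck_on 2 lo UNIV" "\<And>p. p \<in> ball q0 (R + 1) \<Longrightarrow> heis_laplacian lo p \<ge> 0"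
    and up: "Ck_on 2 up UNIV" "\<And>p. p \<in> ball q0 (R + 1) \<Longrightarrow> heis_laplacian up p \<le> 0"
    and \<delta>: "0 < \<delta>" "\<delta> < 1" and le: "\<And>p. p \<in> ball q0 (R + \<delta>) \<Longrightarrow> lo p \<le> up p"
    and s: "0 < s" "s < 1" "\<And>q. q \<in> ball q0 R \<Longrightarrow> s * (3 + norm q) < \<delta>"
  obtains h where "Ck_on 2 h (ball q0 R)" "\<And>p. p \<in> ball q0 (R + \<delta>) \<Longrightarrow> lo p \<le> h p \<and> h p \<le> up p"
    "\<And>q. q \<in> ball q0 R \<Longrightarrow> (\<integral>p. kmean 3 p * h (heis_mult q (heis_dil s p)) \<partial>lborel) = (\<integral>p. kmean 3 p \<partial>lborel) * h q"
proof -
  define I where "I = (\<integral>p. kmean 3 p \<partial>lborel)"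
  have I: "I > 0" unfolding I_def by (rule kmean_integral_pos) simp
  \<comment> \<open>Truncation to this compact set gives bounded iterates with compact support, as
    \<open>Ck_on_kernel_mean\<close> requires; since \<open>\<delta> < 1\<close> it contains the
    collar.\<close>
  define C where "C = cball q0 (R + 1)"
  have C: "compact C" by (simp add: C_def)
  define M where "M u q = (\<integral>p. kmean 3 p * u (heis_mult q (heis_dil s p)) \<partial>lborel) / I" for u q
  define u where "u n = ((\<lambda>v q. if q \<in> ball q0 R then M v q else indicator C q * lo q) ^^ n) (\<lambda>q. indicator C q * lo q)" for n
  have u0: "u 0 q = indicator C q * lo q" for q by (simp add: u_def)
  have uS: "u (Suc n) q = (if q \<in> ball q0 R then M (u n) q else indicator C q * lo q)" for n q by (simp add: u_def)
  have out: "u n q = indicator C q * lo q" if "q \<notin> ball q0 R" for n q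
    using that by (cases n) (simp_all add: u0 uS)
  have near: "heis_mult q (heis_dil s p) \<in> ball q0 (R + \<delta>)" if "q \<in> ball q0 R" "p \<in> gauge_cball" for q p
  proof -
    have "heis_mult q (heis_dil s p) \<in> ball q \<delta>" using heis_mult_dil_in_ball[of p s q \<delta>] that s by auto
    then show ?thesis using that dist_triangle[of q0 "heis_mult q (heis_dil s p)" q] by (simp add: dist_commute)
  qed
  have sub: "ball q0 R \<subseteq> ball q0 (R + \<delta>)" "ball q0 (R + \<delta>) \<subseteq> C" "\<And>q. q \<in> ball q0 R \<Longrightarrow> ball q \<delta> \<subseteq> ball q0 (R + 1)"
  proof -
    show "ball q0 R \<subseteq> ball q0 (R + \<delta>)" "ball q0 (R + \<delta>) \<subseteq> C" using \<delta> by (auto simp: C_def)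
    fix q assume "q \<in> ball q0 R"
    then show "ball q \<delta> \<subseteq> ball q0 (R + 1)"
      using \<delta> dist_triangle[of q0 _ q] by (auto simp: dist_commute) (smt (verit) dist_commute)
  qed
  obtain B where B: "B \<ge> 0" "\<And>p. p \<in> C \<Longrightarrow> \<bar>lo p\<bar> \<le> B \<and> \<bar>up p\<bar> \<le> B"
  proof -
    have "continuous_on C lo" "continuous_on C up"
      using Ck_on_continuous[OF lo(1)] Ck_on_continuous[OF up(1)] continuous_on_subset by blast+
    then obtain a b where a: "\<And>p. p \<in> C \<Longrightarrow> \<bar>lo p\<bar> \<le> a" and b: "b \<ge> 0" "\<And>p. p \<in> C \<Longrightarrow> \<bar>up p\<bar> \<le> b"
      using continuous_on_compact_abs_bound[OF C] by metis
    show thesis by (rule that[of "max a b"]) (use a b in \<open>auto simp: le_max_iff_disj\<close>)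
  qed
  have cn: "continuous_on UNIV lo" "continuous_on UNIV up" using lo(1) up(1) Ck_on_continuous by blast+
  have gen: "integrable lborel (\<lambda>p. kmean 3 p * v (heis_mult q (heis_dil s p)))"
    if v: "v \<in> borel_measurable borel" "\<And>p. p \<in> ball q0 (R + \<delta>) \<Longrightarrow> \<bar>v p\<bar> \<le> B'" and q: "q \<in> ball q0 R" for v B' q
  \<comment> \<open>16 = 4 (3 + 1) is the bound for \<open>kmean 3\<close>.\<close>
  proof (rule integrable_bounded_compact[OF compact_gauge_cball, of _ "16 * B'"])
    show "(\<lambda>p. kmean 3 p * v (heis_mult q (heis_dil s p))) \<in> borel_measurable borel"
      by (rule borel_measurable_times[OF kmean_measurable measurable_compose[OF borel_measurable_heis_mult_dil v(1)]])
    fix p assume "p \<in> gauge_cball"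
    then have "\<bar>v (heis_mult q (heis_dil s p))\<bar> \<le> B'" using v(2) near[OF q] by blast
    then show "\<bar>kmean 3 p * v (heis_mult q (heis_dil s p))\<bar> \<le> 16 * B'"
      unfolding abs_mult using kmean_abs_le[of 3 p] by (intro mult_mono) auto
  qed (simp add: kmean_outside)
  have M_mono: "M v q \<le> M w q" if v: "v \<in> borel_measurable borel" "\<And>p. p \<in> ball q0 (R + \<delta>) \<Longrightarrow> \<bar>v p\<bar> \<le> B1"
    and w: "w \<in> borel_measurable borel" "\<And>p. p \<in> ball q0 (R + \<delta>) \<Longrightarrow> \<bar>w p\<bar> \<le> B2"
    and vw: "\<And>p. p \<in> ball q0 (R + \<delta>) \<Longrightarrow> v p \<le> w p" and q: "q \<in> ball q0 R" for v w B1 B2 q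
  proof -
    have "(\<integral>p. kmean 3 p * v (heis_mult q (heis_dil s p)) \<partial>lborel) \<le> (\<integral>p. kmean 3 p * w (heis_mult q (heis_dil s p)) \<partial>lborel)"
    proof (rule integral_mono[OF gen[OF v q] gen[OF w q]])
      fix p
      show "kmean 3 p * v (heis_mult q (heis_dil s p)) \<le> kmean 3 p * w (heis_mult q (heis_dil s p))"
      proof (cases "p \<in> gauge_cball")
        case True
        then show ?thesis by (intro mult_left_mono vw near[OF q] kmean_nonneg)
      qed (simp add: kmean_outside)
    qed
    then show ?thesis unfolding M_def using I by (simp add: divide_right_mono)
  qed
  have lo_m: "lo \<in> borel_measurable borel" "up \<in> borel_measurable borel" using cn by (auto intro: borel_measurable_continuous_onI)
  have lo_b: "\<And>p. p \<in> ball q0 (R + \<delta>) \<Longrightarrow> \<bar>lo p\<bar> \<le> B" "\<And>p. p \<in> ball q0 (R + \<delta>) \<Longrightarrow> \<bar>up p\<bar> \<le> B"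
    using B(2) sub(2) by blast+
  have M_lo: "lo q \<le> M lo q" and M_up: "M up q \<le> up q" if q: "q \<in> ball q0 R" for q
  proof -
    have "heis_laplacian lo p \<ge> 0" "heis_laplacian up p \<le> 0" if "p \<in> ball q \<delta>" for p
      using lo(2) up(2) sub(3)[OF q] that by blast+
    note m = heis_mean_ge[OF _ open_UNIV subset_UNIV lo(1) this(1) less_imp_le[OF s(1)] s(2) s(3)[OF q], of 3, folded I_def]
      heis_mean_le[OF _ open_UNIV subset_UNIV up(1) this(2) less_imp_le[OF s(1)] s(2) s(3)[OF q], of 3, folded I_def]
    show "lo q \<le> M lo q" "M up q \<le> up q"
      using m I by (simp_all add: M_def pos_le_divide_eq pos_divide_le_eq mult.commute)
  qed
  have Cm: "C \<in> sets borel" using C by (rule borel_compact)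
  have inv: "u n \<in> borel_measurable borel \<and> (\<forall>p. p \<notin> C \<longrightarrow> u n p = 0) \<and> (\<forall>p. \<bar>u n p\<bar> \<le> B) \<and>
     (\<forall>p \<in> ball q0 (R + \<delta>). lo p \<le> u n p \<and> u n p \<le> up p)" for n
  proof (induction n)
    case 0
    have m0: "u 0 \<in> borel_measurable borel"
      unfolding u0 [abs_def] using Cm lo_m(1) by (intro borel_measurable_times borel_measurable_indicator)
    have "u 0 p = 0" if "p \<notin> C" for p using that by (simp add: u0)
    moreover have "\<bar>u 0 p\<bar> \<le> B" for p using B(1) B(2)[of p] by (cases "p \<in> C") (simp_all add: u0)
    moreover have "lo p \<le> u 0 p \<and> u 0 p \<le> up p" if "p \<in> ball q0 (R + \<delta>)" for p
    proof -
      have "p \<in> C" using sub(2) that by blast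
      then show ?thesis using le[OF that] by (simp add: u0)
    qed
    ultimately show ?case using m0 by blast
  next
    case (Suc n)
    then have un: "u n \<in> borel_measurable borel" "\<And>p. p \<notin> C \<Longrightarrow> u n p = 0" "\<And>p. \<bar>u n p\<bar> \<le> B"
      "\<And>p. p \<in> ball q0 (R + \<delta>) \<Longrightarrow> lo p \<le> u n p" "\<And>p. p \<in> ball q0 (R + \<delta>) \<Longrightarrow> u n p \<le> up p" by auto
    have "continuous_on UNIV (\<lambda>q. \<integral>p. kmean 3 p * u n (heis_mult q (heis_dil s p)) \<partial>lborel)"
      using Ck_on_continuous[OF Ck_on_kernel_mean[of 0 3 s "u n" B C]] un s C by auto
    then have "M (u n) \<in> borel_measurable borel"
      unfolding M_def [abs_def] by (intro borel_measurable_divide borel_measurable_const borel_measurable_continuous_onI)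
    then have 1: "u (Suc n) \<in> borel_measurable borel"
      unfolding uS [abs_def] using Cm lo_m(1)
      by (intro measurable_If_set borel_measurable_times borel_measurable_indicator) auto
    have b: "lo p \<le> u (Suc n) p \<and> u (Suc n) p \<le> up p" if p: "p \<in> ball q0 (R + \<delta>)" for p
    proof (cases "p \<in> ball q0 R")
      case True
      have "M lo p \<le> M (u n) p"
        by (rule M_mono[OF lo_m(1) lo_b(1) un(1) un(3) un(4) True])
      moreover have "M (u n) p \<le> M up p"
        by (rule M_mono[OF un(1) un(3) lo_m(2) lo_b(2) un(5) True])
      ultimately show ?thesis using M_lo[OF True] M_up[OF True] True by (simp add: uS)
    next
      case False
      then show ?thesis using p sub(2) le[OF p] by (auto simp: out indicator_def)
    qed
    have "\<bar>u (Suc n) p\<bar> \<le> B" for p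
    proof (cases "p \<in> ball q0 R")
      case True
      then have "p \<in> ball q0 (R + \<delta>)" using sub(1) by blast
      then show ?thesis using b[of p] lo_b[of p] by linarith
    next
      case False
      then show ?thesis using B by (auto simp: out indicator_def)
    qed
    moreover have "u (Suc n) p = 0" if "p \<notin> C" for p
    proof -
      have "p \<notin> ball q0 R" using that sub(1,2) by blast
      then show ?thesis using that out[of p "Suc n"] by simp
    qed
    ultimately show ?case using 1 b by blast
  qed
  then have um: "\<And>n. u n \<in> borel_measurable borel" and uC: "\<And>n p. p \<notin> C \<Longrightarrow> u n p = 0" and uB: "\<And>n p. \<bar>u n p\<bar> \<le> B"
    and ulo: "\<And>n p. p \<in> ball q0 (R + \<delta>) \<Longrightarrow> lo p \<le> u n p" and uup: "\<And>n p. p \<in> ball q0 (R + \<delta>) \<Longrightarrow> u n p \<le> up p"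
    by blast+
  have mono: "u n q \<le> u (Suc n) q" for n q
  proof (induction n arbitrary: q)
    case 0
    show ?case
    proof (cases "q \<in> ball q0 R")
      case True
      then have "q \<in> ball q0 (R + \<delta>)" using sub(1) by blast
      then show ?thesis using ulo[of q "Suc 0"] sub(2) by (auto simp: u0)
    qed (simp add: out)
  next
    case (Suc n)
    show ?case
    proof (cases "q \<in> ball q0 R")
      case True
      have "M (u n) q \<le> M (u (Suc n)) q"
        by (rule M_mono[OF um uB um uB Suc True])
      then show ?thesis using True uS by simp
    qed (simp add: out)
  qed
  define h where "h q = lim (\<lambda>n. u n q)" for q
  have lim: "(\<lambda>n. u n q) \<longlonglongrightarrow> h q" for q
  proof -
    have "incseq (\<lambda>n. u n q)" using mono by (intro incseq_SucI)
    moreover have "\<And>n. u n q \<le> B" using uB abs_le_D1 by blast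
    ultimately have "convergent (\<lambda>n. u n q)" using incseq_convergent unfolding convergent_def by metis
    then show ?thesis by (simp add: h_def convergent_LIMSEQ_iff)
  qed
  have hmeas: "h \<in> borel_measurable borel" using borel_measurable_LIMSEQ_real[OF lim um] .
  have hC: "h p = 0" if "p \<notin> C" for p using lim[of p] uC[OF that] LIMSEQ_unique[OF _ tendsto_const] by simp
  have hbd: "\<bar>h p\<bar> \<le> B" for p
    using LIMSEQ_le_const2[OF tendsto_rabs[OF lim[of p]]] uB by blast
  have hM: "M h q = h q" if q: "q \<in> ball q0 R" for q
  proof -
    have "(\<lambda>n. \<integral>p. kmean 3 p * u n (heis_mult q (heis_dil s p)) \<partial>lborel) \<longlonglongrightarrow> (\<integral>p. kmean 3 p * h (heis_mult q (heis_dil s p)) \<partial>lborel)"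
    proof (rule integral_dominated_convergence[where w="\<lambda>p. kmean 3 p * B"])
      show "integrable lborel (\<lambda>p. kmean 3 p * B)" using gen[of "\<lambda>_. B" B q] q B by simp
      show "AE p in lborel. (\<lambda>n. kmean 3 p * u n (heis_mult q (heis_dil s p))) \<longlonglongrightarrow> kmean 3 p * h (heis_mult q (heis_dil s p))"
        by (intro AE_I2 tendsto_mult tendsto_const lim)
      show "AE p in lborel. norm (kmean 3 p * u n (heis_mult q (heis_dil s p))) \<le> kmean 3 p * B" for n
        unfolding real_norm_def abs_mult abs_of_nonneg[OF kmean_nonneg]
        by (intro AE_I2 mult_left_mono uB kmean_nonneg)
    qed (use gen[OF um uB q] gen[OF hmeas hbd q] in auto)
    then have "(\<lambda>n. M (u n) q) \<longlonglongrightarrow> M h q" unfolding M_def using I by (intro tendsto_divide tendsto_const) auto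
    moreover have "(\<lambda>n. M (u n) q) \<longlonglongrightarrow> h q" using LIMSEQ_Suc[OF lim[of q]] q by (simp add: uS)
    ultimately show ?thesis by (rule LIMSEQ_unique)
  qed
  show thesis
  proof (rule that)
    \<comment> \<open>The fixed-point equation regularises: on the ball \<open>h\<close> equals a
      kernel mean of itself, and for that its boundedness, measurability and compact support
      suffice.\<close>
    have "Ck_on 2 (\<lambda>q. (1 / I) * (\<integral>p. kmean 3 p * h (heis_mult q (heis_dil s p)) \<partial>lborel)) UNIV"
      using s C hC by (intro Ck_on_mult Ck_on_const open_UNIV Ck_on_kernel_mean[OF _ _ hmeas hbd C]) auto
    then have "Ck_on 2 (\<lambda>q. (1 / I) * (\<integral>p. kmean 3 p * h (heis_mult q (heis_dil s p)) \<partial>lborel)) (ball q0 R)"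
      by (rule Ck_on_subset) simp
    then show "Ck_on 2 h (ball q0 R)"
      by (rule Ck_on_cong[OF open_ball]) (use hM in \<open>simp add: M_def\<close>)
    show "lo p \<le> h p \<and> h p \<le> up p" if "p \<in> ball q0 (R + \<delta>)" for p
      using LIMSEQ_le_const[OF lim[of p], of "lo p"] LIMSEQ_le_const2[OF lim[of p], of "up p"] ulo[OF that] uup[OF that] by blast
    show "(\<integral>p. kmean 3 p * h (heis_mult q (heis_dil s p)) \<partial>lborel) = (\<integral>p. kmean 3 p \<partial>lborel) * h q" if "q \<in> ball q0 R" for q
      using hM[OF that] I by (simp add: M_def I_def[symmetric] field_simps)
  qed
qed

lemma heis_smooth_bounds:
  assumes s: "0 < s" and c: "continuous_on ({0..s} \<times> gauge_cball) (\<lambda>b. h (heis_mult q (heis_dil (fst b) (snd b))))"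
    and b: "\<And>b. b \<in> {0..s} \<times> gauge_cball \<Longrightarrow> \<bar>h (heis_mult q (heis_dil (fst b) (snd b))) - c\<bar> \<le> \<epsilon>"
  shows "\<bar>heis_smooth j s h q - c * (\<integral>b. ksmooth j s b \<partial>lborel)\<bar> \<le> \<epsilon> * (\<integral>b. ksmooth j s b \<partial>lborel)"
proof -
  have i: "integrable lborel (\<lambda>b. ksmooth j s b * h (heis_mult q (heis_dil (fst b) (snd b))))"
    by (rule integrable_mult_support[OF compact_ksmooth[of s] ksmooth_measurable ksmooth_abs_le ksmooth_outside c]) (use s in auto)
  note iA = ksmooth_integral_pos(1)[OF s, of j]
  have "heis_smooth j s h q - c * (\<integral>b. ksmooth j s b \<partial>lborel) =
      (\<integral>b. ksmooth j s b * (h (heis_mult q (heis_dil (fst b) (snd b))) - c) \<partial>lborel)"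
    unfolding heis_smooth_def right_diff_distrib using i iA by simp
  also have "\<bar>\<dots>\<bar> \<le> (\<integral>b. \<bar>ksmooth j s b * (h (heis_mult q (heis_dil (fst b) (snd b))) - c)\<bar> \<partial>lborel)"
    by (rule integral_abs_bound)
  also have "\<dots> \<le> (\<integral>b. \<epsilon> * ksmooth j s b \<partial>lborel)"
  proof (rule integral_mono)
    show "integrable lborel (\<lambda>b. \<bar>ksmooth j s b * (h (heis_mult q (heis_dil (fst b) (snd b))) - c)\<bar>)"
      unfolding right_diff_distrib using i iA by (intro integrable_abs Bochner_Integration.integrable_diff) auto
    show "integrable lborel (\<lambda>b. \<epsilon> * ksmooth j s b)" using iA by simp
    fix x
    show "\<bar>ksmooth j s x * (h (heis_mult q (heis_dil (fst x) (snd x))) - c)\<bar> \<le> \<epsilon> * ksmooth j s x"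
    proof (cases "x \<in> {0..s} \<times> gauge_cball")
      case True
      have "ksmooth j s x * \<bar>h (heis_mult q (heis_dil (fst x) (snd x))) - c\<bar> \<le> ksmooth j s x * \<epsilon>"
        by (rule mult_left_mono[OF b[OF True] ksmooth_nonneg])
      then show ?thesis by (simp add: abs_mult ksmooth_nonneg mult.commute)
    qed (simp add: ksmooth_outside)
  qed
  finally show ?thesis by simp
qed

text \<open>Since \<open>f \<mp> C (R\<^sup>2 - |p - q0|\<^sup>2)\<close> is sub- resp. superharmonic for large \<open>C\<close>, iterating the mean
  operator at a fixed small radius from below converges to a fixed point \<open>h\<close> squeezed between the
  two barriers; smoothing \<open>h\<close> yields a harmonic function that is close to \<open>f\<close> near the boundary.\<close>

lemma dirichlet_approx:
  assumes f: "Ck_on 2 f UNIV" and R: "R > 0" and \<epsilon>: "\<epsilon> > 0"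
  obtains R1 H U where "R / 2 \<le> R1" "R1 < R" "open U" "cball q0 R1 \<subseteq> U" "U \<subseteq> ball q0 R" "Ck_on 2 H U"
    "\<And>q. q \<in> U \<Longrightarrow> heis_laplacian H q = 0" "\<And>q. q \<in> sphere q0 R1 \<Longrightarrow> \<bar>H q - f q\<bar> \<le> \<epsilon>"
proof -
  let ?C = "cball q0 (R + 1)"
  have f2: "Ck_on (Suc (Suc 0)) f UNIV" using f by (simp only: numeral_2_eq_2)
  obtain K where K: "\<And>p. p \<in> ?C \<Longrightarrow> \<bar>heis_laplacian f p\<bar> \<le> K"
    using continuous_on_compact_abs_bound[OF compact_cball
        continuous_on_subset[OF Ck_on_continuous[OF Ck_on_heis_laplacian[OF open_UNIV f2]] subset_UNIV]] by blast
  define C where "C = max 1 K"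
  have C: "C \<ge> 1" "K \<le> C" by (auto simp: C_def)
  define \<psi> where "\<psi> = heis_bump q0 R"
  have c\<psi>: "continuous_on UNIV \<psi>" unfolding \<psi>_def by (rule Ck_on_continuous[OF Ck_on_heis_bump])
  have cf: "continuous_on UNIV f" using f by (rule Ck_on_continuous)
  \<comment> \<open>On the sphere of radius R1 = R - \<open>\<eta>\<close> the barrier is (R - R1)
    (R + R1), at most 2 R \<open>\<eta>\<close>; this choice makes C \<open>\<psi>\<close> at most
    \<open>\<epsilon> / 4\<close> there.\<close>
  define \<eta> where "\<eta> = min (R / 2) (\<epsilon> / (8 * C * R))"
  have \<eta>: "\<eta> > 0" "\<eta> \<le> R / 2" "C * (2 * R * \<eta>) \<le> \<epsilon> / 4"
  proof -
    show "\<eta> > 0" "\<eta> \<le> R / 2" using R \<epsilon> C by (auto simp: \<eta>_def)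
    have "C * (2 * R * \<eta>) \<le> C * (2 * R * (\<epsilon> / (8 * C * R)))"
      using R C by (intro mult_left_mono) (auto simp: \<eta>_def)
    then show "C * (2 * R * \<eta>) \<le> \<epsilon> / 4" using R C by simp
  qed
  define R1 where "R1 = R - \<eta>"
  have R1: "R / 2 \<le> R1" "R1 < R" using \<eta> by (auto simp: R1_def)
  have uf: "uniformly_continuous_on ?C f" "uniformly_continuous_on ?C \<psi>"
    using cf c\<psi> by (auto intro!: compact_uniformly_continuous intro: continuous_on_subset)
  obtain d1 where d1: "d1 > 0" "\<And>x y. x \<in> ?C \<Longrightarrow> y \<in> ?C \<Longrightarrow> dist y x < d1 \<Longrightarrow> dist (f y) (f x) < \<epsilon> / 4"
    using uf(1) \<epsilon> unfolding uniformly_continuous_on_def by (metis divide_pos_pos zero_less_numeral)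
  have "\<epsilon> / (8 * C) > 0" using \<epsilon> C by simp
  then obtain d2 where d2: "d2 > 0" "\<And>x y. x \<in> ?C \<Longrightarrow> y \<in> ?C \<Longrightarrow> dist y x < d2 \<Longrightarrow> dist (\<psi> y) (\<psi> x) < \<epsilon> / (8 * C)"
    using uf(2) unfolding uniformly_continuous_on_def by meson
  \<comment> \<open>The bounds serve, in order: the width limit of
    \<open>dirichlet_iteration\<close>, the inclusion of the sphere of radius \<open>R1\<close> in
    \<open>U\<close>, small oscillation of \<open>f\<close> and of the barrier over balls of radius
    \<open>\<delta>\<close>, and C \<open>\<psi>\<close> above - \<open>\<epsilon> / 8\<close> on
    the collar.\<close>
  define \<delta> where "\<delta> = min (1/2) (min (\<eta> / 2) (min d1 (min d2 (\<epsilon> / (8 * C * (2 * R + 1))))))"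
  have \<delta>: "\<delta> > 0" "\<delta> < 1" "\<delta> \<le> \<eta> / 2" "\<delta> \<le> d1" "\<delta> \<le> d2" "C * (2 * R + 1) * \<delta> \<le> \<epsilon> / 8"
  proof -
    have "8 * C * (2 * R + 1) > 0" using C(1) R by (intro mult_pos_pos) auto
    then have "\<epsilon> / (8 * C * (2 * R + 1)) > 0" using \<epsilon> by (rule divide_pos_pos[rotated])
    then show "\<delta> > 0" "\<delta> < 1" "\<delta> \<le> \<eta> / 2" "\<delta> \<le> d1" "\<delta> \<le> d2"
      using \<eta>(1) d1(1) d2(1) by (simp_all add: \<delta>_def min_less_iff_disj min_le_iff_disj)
    have "C * (2 * R + 1) * \<delta> \<le> C * (2 * R + 1) * (\<epsilon> / (8 * C * (2 * R + 1)))"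
      using C R by (intro mult_left_mono) (auto simp: \<delta>_def)
    also have "\<dots> = \<epsilon> / 8"
    proof -
      have "C * (2 * R + 1) \<noteq> 0" using C R by auto
      then have "m * (\<epsilon> / (8 * m)) = \<epsilon> / 8" if "m = C * (2 * R + 1)" for m using that by simp
      then show ?thesis by (simp only: mult.assoc)
    qed
    finally show "C * (2 * R + 1) * \<delta> \<le> \<epsilon> / 8" .
  qed
  define k where "k = 3 + norm q0 + R"
  have k: "k > 0" using R norm_ge_zero[of q0] unfolding k_def by linarith
  define s where "s = \<delta> / (2 * (1 + k))"
  have s: "0 < s" "s < 1" "s * k < \<delta>"
  proof -
    show "0 < s" using \<delta> k by (simp add: s_def)
    show "s < 1" using \<delta> k by (simp add: s_def)
    have "s * k = \<delta> * (k / (2 * (1 + k)))" by (simp add: s_def)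
    also have "\<dots> < \<delta> * 1" using \<delta> k by (intro mult_strict_left_mono) auto
    finally show "s * k < \<delta>" by simp
  qed
  have sq: "s * (3 + norm q) < \<delta>" if "q \<in> ball q0 R" for q
  proof -
    have "norm q \<le> norm q0 + dist q0 q" by (metis dist_commute dist_norm norm_triangle_sub add.commute)
    then have "s * (3 + norm q) \<le> s * k" using that s by (intro mult_left_mono) (auto simp: k_def)
    then show ?thesis using s(3) by (rule le_less_trans)
  qed
  define lo where "lo p = f p - C * \<psi> p" for p
  \<comment> \<open>Outside the ball the barrier is negative; the extra
    \<open>\<epsilon> / 4\<close> keeps \<open>up\<close> above \<open>lo\<close> on the
    collar.\<close>
  define up where "up p = f p + C * \<psi> p + \<epsilon> / 4" for p
  have C\<psi>: "Ck_on 2 (\<lambda>p. C * \<psi> p) UNIV" unfolding \<psi>_def by (intro Ck_on_mult Ck_on_const Ck_on_heis_bump open_UNIV)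
  have L\<psi>: "heis_laplacian (\<lambda>p. C * \<psi> p) p \<le> - C" for p
  proof -
    have "heis_laplacian (\<lambda>p. C * \<psi> p) p = C * (- 4 - ((fst p)\<^sup>2 + (fst (snd p))\<^sup>2) / 2)"
      using heis_laplacian_cmult[OF open_UNIV Ck_on_heis_bump UNIV_I] by (simp add: \<psi>_def heis_laplacian_bump)
    also have "\<dots> \<le> C * (-1)"
    proof (rule mult_left_mono)
      have "- 4 - x / 2 \<le> - 1" if "x \<ge> 0" for x :: real using that by linarith
      then show "- 4 - ((fst p)\<^sup>2 + (fst (snd p))\<^sup>2) / 2 \<le> - 1" by (simp only: sum_power2_ge_zero)
    qed (use C in simp)
    finally show ?thesis by simp
  qed
  have lo2: "Ck_on 2 lo UNIV" unfolding lo_def [abs_def] by (rule Ck_on_diff[OF open_UNIV f C\<psi>])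
  have upa: "Ck_on 2 (\<lambda>p. f p + C * \<psi> p) UNIV" by (rule Ck_on_add[OF open_UNIV f C\<psi>])
  have up2: "Ck_on 2 up UNIV" unfolding up_def [abs_def] by (rule Ck_on_add[OF open_UNIV upa Ck_on_const])
  have Lc: "heis_laplacian (\<lambda>_. c) p = 0" for c p
    unfolding heis_laplacian_def by (simp add: heis_XY_const [abs_def])
  have Llo: "heis_laplacian lo p \<ge> 0" if "p \<in> ball q0 (R + 1)" for p
    unfolding lo_def [abs_def] heis_laplacian_diff[OF open_UNIV f C\<psi> UNIV_I] using K[of p] that L\<psi>[of p] C by auto
  have Lup: "heis_laplacian up p \<le> 0" if "p \<in> ball q0 (R + 1)" for p
    unfolding up_def [abs_def] heis_laplacian_add[OF open_UNIV upa Ck_on_const UNIV_I] heis_laplacian_add[OF open_UNIV f C\<psi> UNIV_I] Lc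
    using K[of p] that L\<psi>[of p] C by auto
  have le: "lo p \<le> up p" if "p \<in> ball q0 (R + \<delta>)" for p
  proof -
    have "(dist p q0)\<^sup>2 \<le> (R + \<delta>)\<^sup>2" using that by (intro power_mono) (auto simp: dist_commute)
    also have "(R + \<delta>)\<^sup>2 = R\<^sup>2 + (2 * R + \<delta>) * \<delta>" by (simp add: power2_eq_square algebra_simps)
    also have "(2 * R + \<delta>) * \<delta> \<le> (2 * R + 1) * \<delta>" using \<delta> by (intro mult_right_mono) auto
    finally have "\<psi> p \<ge> - ((2 * R + 1) * \<delta>)" by (simp add: \<psi>_def heis_bump_def)
    then have "C * \<psi> p \<ge> C * (- ((2 * R + 1) * \<delta>))" using C by (intro mult_left_mono) auto
    then have "C * \<psi> p \<ge> - (\<epsilon> / 8)" using \<delta>(6) by (simp add: mult.assoc)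
    then show ?thesis by (simp add: lo_def up_def)
  qed
  obtain h where h: "Ck_on 2 h (ball q0 R)" "\<And>p. p \<in> ball q0 (R + \<delta>) \<Longrightarrow> lo p \<le> h p \<and> h p \<le> up p"
    "\<And>q. q \<in> ball q0 R \<Longrightarrow> (\<integral>p. kmean 3 p * h (heis_mult q (heis_dil s p)) \<partial>lborel) = (\<integral>p. kmean 3 p \<partial>lborel) * h q"
    by (rule dirichlet_iteration[OF lo2 Llo up2 Lup \<delta>(1,2) le s(1,2) sq that])
  \<comment> \<open>Smoothing looks at points within \<open>\<delta>\<close>, and these must stay
    where \<open>h\<close> is C^2.\<close>
  define U where "U = ball q0 (R - \<delta>)"
  have UR: "U \<subseteq> ball q0 R" using \<delta> by (auto simp: U_def)
  have ball: "ball q \<delta> \<subseteq> ball q0 R" if "q \<in> U" for q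
  proof
    fix p assume "p \<in> ball q \<delta>"
    then show "p \<in> ball q0 R" using that dist_triangle[of q0 p q] by (simp add: U_def)
  qed
  have near: "heis_mult q (heis_dil t p) \<in> ball q \<delta>" if "q \<in> U" "t \<in> {0..s}" "p \<in> gauge_cball" for q t p
  proof (rule heis_mult_dil_in_ball[OF that(3)])
    have "t * (3 + norm q) \<le> s * (3 + norm q)" using that by (intro mult_right_mono) auto
    then show "\<bar>t\<bar> < 1" "\<bar>t\<bar> * (3 + norm q) < \<delta>" using that sq[of q] UR s by auto
  qed
  have nearR: "heis_mult q (heis_dil t p) \<in> ball q0 R" if "q \<in> U" "t \<in> {0..s}" "p \<in> gauge_cball" for q t p
    using near[OF that] ball[OF that(1)] by blast
  have oU: "open U" by (simp add: U_def)
  have j: "(2::nat) \<le> 3" by simp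
  have S: "heis_laplacian (heis_smooth 3 s h) q = (\<integral>p. kmean 3 p * h (heis_mult q (heis_dil s p)) \<partial>lborel) - (\<integral>p. kmean 3 p \<partial>lborel) * h q"
    if "q \<in> U" "ball q e \<subseteq> ball q0 R" "s * (3 + norm q) < e" for q e
    using heis_smooth_laplacian(2)[OF j open_ball h(1) oU _ less_imp_le[OF s(1)] s(2)] nearR that by blast
  define IA where "IA = (\<integral>b. ksmooth 3 s b \<partial>lborel)"
  have IA: "IA > 0" unfolding IA_def by (rule ksmooth_integral_pos[OF s(1)])
  define H where "H q = (1 / IA) * heis_smooth 3 s h q" for q
  have cS: "Ck_on 2 (heis_smooth 3 s h) U"
    using heis_smooth_laplacian(1)[OF j open_ball h(1) oU _ less_imp_le[OF s(1)] s(2)] nearR by blast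
  show thesis
  proof (rule that[OF R1 oU _ UR])
    show "cball q0 R1 \<subseteq> U" using \<delta>(3) \<eta> by (auto simp: U_def R1_def)
    show "Ck_on 2 H U" unfolding H_def [abs_def] by (intro Ck_on_mult Ck_on_const cS oU)
    show "heis_laplacian H q = 0" if "q \<in> U" for q
    proof -
      have qR: "q \<in> ball q0 R" using that UR by blast
      have "heis_laplacian (heis_smooth 3 s h) q = 0"
        using S[OF that ball[OF that] sq[OF qR]] h(3)[OF qR] by simp
      then show ?thesis unfolding H_def [abs_def] heis_laplacian_cmult[OF oU cS that] by simp
    qed
    fix q assume q: "q \<in> sphere q0 R1"
    have qU: "q \<in> U" using q \<delta>(3) \<eta> by (auto simp: U_def R1_def)
    have qC: "q \<in> ?C" using q R1 by auto
    have "\<psi> q = (R - R1) * (R + R1)" using q by (simp add: \<psi>_def heis_bump_def dist_commute power2_eq_square algebra_simps)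
    also have "\<dots> \<le> \<eta> * (2 * R)" using \<eta> R1 R by (intro mult_mono) (auto simp: R1_def)
    finally have "C * \<psi> q \<le> C * (\<eta> * (2 * R))" using C by (intro mult_left_mono) auto
    also have "\<dots> \<le> \<epsilon> / 4" using \<eta>(3) by (simp add: mult_ac)
    finally have \<psi>q: "C * \<psi> q \<le> \<epsilon> / 4" .
    have dev: "\<bar>h x - f q\<bar> \<le> \<epsilon>" if x: "x \<in> ball q \<delta>" for x
    proof -
      have xR: "x \<in> ball q0 R" using ball[OF qU] x by blast
      then have xC: "x \<in> ?C" and x\<delta>: "x \<in> ball q0 (R + \<delta>)" using \<delta> by auto
      have "dist (f x) (f q) < \<epsilon> / 4" using d1(2)[OF qC xC] x \<delta>(4) by (simp add: dist_commute)
      then have 1: "\<bar>f x - f q\<bar> < \<epsilon> / 4" by (simp add: dist_real_def)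
      have "dist (\<psi> x) (\<psi> q) < \<epsilon> / (8 * C)" using d2(2)[OF qC xC] x \<delta>(5) by (simp add: dist_commute)
      then have "\<psi> x \<le> \<psi> q + \<epsilon> / (8 * C)" by (simp add: dist_real_def)
      then have "C * \<psi> x \<le> C * (\<psi> q + \<epsilon> / (8 * C))" using C by (intro mult_left_mono) auto
      also have "\<dots> = C * \<psi> q + \<epsilon> / 8" using C by (simp add: distrib_left)
      finally have 2: "C * \<psi> x \<le> \<epsilon> / 4 + \<epsilon> / 8" using \<psi>q by linarith
      \<comment> \<open>Error budget in units of \<open>\<epsilon>\<close>: 1/4 for the oscillation
        of \<open>f\<close>, 3/8 for the barrier, 1/4 for the shift in \<open>up\<close>.\<close>
      have "lo x \<le> h x" "h x \<le> up x" using h(2)[OF x\<delta>] by auto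
      then show ?thesis using 1 2 \<epsilon> unfolding lo_def up_def by linarith
    qed
    have "\<bar>heis_smooth 3 s h q - f q * IA\<bar> \<le> \<epsilon> * IA"
      unfolding IA_def
    proof (rule heis_smooth_bounds[OF s(1)])
      show "continuous_on ({0..s} \<times> gauge_cball) (\<lambda>b. h (heis_mult q (heis_dil (fst b) (snd b))))"
        by (rule continuous_on_compose2[OF Ck_on_continuous[OF h(1)]]) (use nearR[OF qU] in \<open>auto intro!: continuous_intros\<close>)
      show "\<bar>h (heis_mult q (heis_dil (fst b) (snd b))) - f q\<bar> \<le> \<epsilon>" if "b \<in> {0..s} \<times> gauge_cball" for b
        using that near[OF qU] by (intro dev) auto
    qed
    moreover have "H q - f q = (heis_smooth 3 s h q - f q * IA) / IA" using IA by (simp add: H_def field_simps)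
    ultimately show "\<bar>H q - f q\<bar> \<le> \<epsilon>" using IA by (simp add: abs_divide divide_le_eq)
  qed
qed

section \<open>Smooth majorants of continuous functions\<close>

text \<open>The cube of a positive part is C^2, and the squared distance is used because it is a
  polynomial.\<close>

definition bump :: "'a::euclidean_space \<Rightarrow> real \<Rightarrow> 'a \<Rightarrow> real" where
  "bump a r p = max 0 (1 - ((p - a) \<bullet> (p - a)) / r\<^sup>2) ^ 3"

lemma Ck_on_dist2: "Ck_on k (\<lambda>p::'a::euclidean_space. (p - a) \<bullet> (p - a)) S"
proof -
  have "Ck_on k (\<lambda>p. \<Sum>b\<in>Basis. (p \<bullet> b - a \<bullet> b) * (p \<bullet> b - a \<bullet> b)) UNIV"
    by (intro Ck_on_sum Ck_on_mult Ck_on_diff Ck_on_inner Ck_on_const open_UNIV)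
  moreover have "(\<lambda>p. \<Sum>b\<in>Basis. (p \<bullet> b - a \<bullet> b) * (p \<bullet> b - a \<bullet> b)) = (\<lambda>p. (p - a) \<bullet> (p - a))"
    by (subst euclidean_inner) (simp add: inner_diff_left)
  ultimately have "Ck_on k (\<lambda>p. (p - a) \<bullet> (p - a)) UNIV" by (simp only:)
  then show ?thesis by (rule Ck_on_subset) simp
qed

lemma Ck_on_bump: "Ck_on 2 (bump a r) UNIV"
  unfolding bump_def [abs_def] divide_inverse
  by (intro Ck_on_max0_power Ck_on_diff Ck_on_mult Ck_on_const Ck_on_dist2 open_UNIV) simp

lemma inner_diff_eq_dist: "(p - a) \<bullet> (p - a) = (dist p a)\<^sup>2"
  by (simp add: dist_norm power2_norm_eq_inner)

lemma bump_nonneg: "bump a r p \<ge> 0" by (simp add: bump_def)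

lemma bump_le_1: "bump a r p \<le> 1"
  unfolding bump_def inner_diff_eq_dist by (intro power_le_one) auto

lemma bump_outside: "0 < r \<Longrightarrow> p \<notin> ball a r \<Longrightarrow> bump a r p = 0"
proof -
  assume "0 < r" "p \<notin> ball a r"
  then have "r\<^sup>2 \<le> (dist p a)\<^sup>2" by (intro power_mono) (auto simp: dist_commute)
  then show ?thesis using \<open>0 < r\<close> by (simp add: bump_def inner_diff_eq_dist le_divide_eq max_def)
qed

text \<open>This is 1 - (1 - x)^3 <= 3 x with x the squared relative distance. The deviation from 1
  is quadratic; the cutoff in \<open>viscosity_touch_above\<close> squares it to reach fourth
  order.\<close>

lemma bump_ge:
  assumes r: "0 < r"
  shows "1 - bump a r p \<le> 3 * (dist p a)\<^sup>2 / r\<^sup>2"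
proof -
  define x where "x = (dist p a)\<^sup>2 / r\<^sup>2"
  have x: "x \<ge> 0" by (simp add: x_def)
  have "1 - max 0 (1 - x) ^ 3 \<le> 3 * x"
  proof (cases "x \<le> 1")
    case True
    have "1 - (1 - x) ^ 3 = 3 * x - x\<^sup>2 * (3 - x)" by (simp add: power3_eq_cube power2_eq_square algebra_simps)
    moreover have "x\<^sup>2 * (3 - x) \<ge> 0" using True by (intro mult_nonneg_nonneg) auto
    ultimately show ?thesis using True by (simp add: max_absorb2)
  next
    case False
    then show ?thesis by (simp add: max_def)
  qed
  then show ?thesis by (simp add: bump_def inner_diff_eq_dist x_def)
qed

lemma bump_half: "0 < r \<Longrightarrow> p \<in> ball a (r / 2) \<Longrightarrow> bump a r p \<ge> 1 / 4"
proof -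
  assume r: "0 < r" and p: "p \<in> ball a (r / 2)"
  then have "(dist p a)\<^sup>2 \<le> (r / 2)\<^sup>2" by (intro power_mono) (auto simp: dist_commute)
  then have "3 * (dist p a)\<^sup>2 / r\<^sup>2 \<le> 3 / 4" using r by (simp add: divide_le_eq power_divide)
  then show ?thesis using bump_ge[OF r, of a p] by linarith
qed

text \<open>Finitely many half-radius balls cover \<open>A\<close>, and on each its bump is at least
  1/4, whence the factor 4. A lower bound on \<open>A\<close> is all that a majorant asks
  for.\<close>

lemma Ck_bump_exists:
  fixes A :: "'a::euclidean_space set"
  assumes A: "compact A" and W: "open W" "A \<subseteq> W"
  obtains b where "Ck_on 2 b UNIV" "\<And>p. b p \<ge> 0" "\<And>p. p \<in> A \<Longrightarrow> b p \<ge> 1" "\<And>p. p \<notin> W \<Longrightarrow> b p = 0"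
proof -
  have "\<exists>r>0. ball a r \<subseteq> W" if "a \<in> A" for a using that W open_contains_ball by blast
  then obtain r where r: "\<And>a. a \<in> A \<Longrightarrow> r a > 0" "\<And>a. a \<in> A \<Longrightarrow> ball a (r a) \<subseteq> W" by metis
  have "A \<subseteq> (\<Union>a\<in>A. ball a (r a / 2))" using r by force
  then obtain T where T: "T \<subseteq> A" "finite T" "A \<subseteq> (\<Union>a\<in>T. ball a (r a / 2))"
    using compactE_image[OF A, of A "\<lambda>a. ball a (r a / 2)"] by auto
  define b where "b p = 4 * (\<Sum>a\<in>T. bump a (r a) p)" for p
  show thesis
  proof (rule that)
    show "Ck_on 2 b UNIV" unfolding b_def [abs_def]
      by (intro Ck_on_mult Ck_on_sum Ck_on_const Ck_on_bump open_UNIV)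
    show "b p \<ge> 0" for p unfolding b_def by (intro mult_nonneg_nonneg sum_nonneg bump_nonneg) simp
    show "b p \<ge> 1" if "p \<in> A" for p
    proof -
      obtain a where a: "a \<in> T" "p \<in> ball a (r a / 2)" using T(3) \<open>p \<in> A\<close> by blast
      have "bump a (r a) p \<ge> 1 / 4" using a T(1) r(1) by (intro bump_half) auto
      moreover have "bump a (r a) p \<le> (\<Sum>a\<in>T. bump a (r a) p)"
        using T(2) a(1) by (intro member_le_sum bump_nonneg)
      ultimately show ?thesis unfolding b_def by linarith
    qed
    show "b p = 0" if "p \<notin> W" for p
    proof -
      have "bump a (r a) p = 0" if "a \<in> T" for a
        using that T(1) r \<open>p \<notin> W\<close> by (intro bump_outside) blast+
      then show ?thesis by (simp add: b_def)
    qed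
  qed
qed

text \<open>A continuous \<open>v\<close> may be unbounded near the boundary of \<open>D\<close>,
  yet test functions must lie above it on all of \<open>D\<close>. The majorant sums multiples of
  bumps over the shells of a compact exhaustion; the n-th bump vanishes on \<open>C (n - 2)\<close>,
  so the sum is locally finite.\<close>

lemma Ck_majorant_exists:
  fixes v :: "'a::euclidean_space \<Rightarrow> real"
  assumes D: "open D" and v: "continuous_on D v"
  obtains G where "Ck_on 2 G D" "\<And>p. p \<in> D \<Longrightarrow> v p \<le> G p"
proof -
  obtain C where C: "\<And>n. compact (C n)" "\<And>n. C n \<subseteq> D" "\<And>n. C n \<subseteq> interior (C (Suc n))" "\<Union>(range C) = D"
    using open_Union_compact_subsets[OF D] by metis
  have mono: "C m \<subseteq> C n" if "m \<le> n" for m n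
    using that by (induction rule: dec_induct) (use C(3) interior_subset in blast)+
  \<comment> \<open>Shells covering \<open>D\<close>, followed by neighbourhoods of them that avoid
    \<open>C (n - 2)\<close>; the case distinctions guard against truncated subtraction.\<close>
  define A where "A n = C n - (if n = 0 then {} else interior (C (n - 1)))" for n
  define W where "W n = - (if n < 2 then {} else C (n - 2))" for n
  have A: "compact (A n)" for n unfolding A_def by (intro compact_diff C(1)) auto
  have W: "open (W n)" for n unfolding W_def using C(1) by (auto intro: compact_imp_closed open_Compl)
  have AW: "A n \<subseteq> W n" for n
  proof (cases "n < 2")
    case False
    then have "C (n - 2) \<subseteq> interior (C (n - 1))" using C(3)[of "n - 2"] by (simp add: Suc_diff_le numeral_2_eq_2 Suc_diff_Suc)
    then show ?thesis using False by (auto simp: A_def W_def)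
  qed (simp add: W_def)
  have "\<exists>b. Ck_on 2 b UNIV \<and> (\<forall>p. b p \<ge> 0) \<and> (\<forall>p\<in>A n. b p \<ge> (1::real)) \<and> (\<forall>p. p \<notin> W n \<longrightarrow> b p = 0)" for n
    using Ck_bump_exists[OF A W AW] by metis
  then obtain b where b: "\<And>n. Ck_on 2 (b n) UNIV" "\<And>n p. b n p \<ge> 0" "\<And>n p. p \<in> A n \<Longrightarrow> b n p \<ge> (1::real)"
    "\<And>n p. p \<notin> W n \<Longrightarrow> b n p = 0" by metis
  have "\<exists>M\<ge>0. \<forall>p\<in>C n. \<bar>v p\<bar> \<le> M" for n
    using continuous_on_compact_abs_bound[OF C(1) continuous_on_subset[OF v C(2)]] by metis
  then obtain M where M: "\<And>n. M n \<ge> 0" "\<And>n p. p \<in> C n \<Longrightarrow> \<bar>v p\<bar> \<le> M n" by metis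
  define N where "N p = (LEAST n. p \<in> C n)" for p
  have N: "p \<in> C (N p)" "\<And>k. p \<in> C k \<Longrightarrow> N p \<le> k" if pD: "p \<in> D" for p
  proof -
    obtain n where "p \<in> C n" using C(4) pD by blast
    then show "p \<in> C (N p)" unfolding N_def by (rule LeastI)
    show "N p \<le> k" if "p \<in> C k" for k unfolding N_def using that by (rule Least_le)
  qed
  \<comment> \<open>From index \<open>N p + 2\<close> on every bump vanishes at \<open>p\<close>,
    since \<open>p\<close> then lies in \<open>C (n - 2)\<close>. By \<open>Geq\<close> a larger
    cutoff changes nothing, which gives one finite formula on a whole neighbourhood.\<close>
  define G where "G p = (\<Sum>n<N p + 2. M n * b n p)" for p
  have Geq: "G p = (\<Sum>n<k + 2. M n * b n p)" if p: "p \<in> C k" for p k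
  proof -
    have pD: "p \<in> D" using p C(2) by blast
    have "b n p = 0" if "n \<in> {..<k + 2} - {..<N p + 2}" for n
    proof -
      have "N p \<le> n - 2" using that by auto
      then have "p \<in> C (n - 2)" using mono N(1)[OF pD] by blast
      then show ?thesis using that by (intro b(4)) (auto simp: W_def)
    qed
    then show ?thesis unfolding G_def using N(2)[OF pD p] by (intro sum.mono_neutral_left) auto
  qed
  show thesis
  proof (rule that)
    show "Ck_on 2 G D"
    proof (rule Ck_on_local)
      fix p assume "p \<in> D"
      then have "p \<in> interior (C (Suc (N p)))" using N(1) C(3) by blast
      moreover have "Ck_on 2 G (interior (C (Suc (N p))))"
      proof (rule Ck_on_cong[OF open_interior])
        show "Ck_on 2 (\<lambda>q. \<Sum>n<Suc (N p) + 2. M n * b n q) (interior (C (Suc (N p))))"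
          using b(1) by (intro Ck_on_sum Ck_on_mult Ck_on_const open_interior) (rule Ck_on_subset, blast, simp)
        show "(\<Sum>n<Suc (N p) + 2. M n * b n q) = G q" if "q \<in> interior (C (Suc (N p)))" for q
          using Geq[of q "Suc (N p)"] interior_subset that by (metis subsetD)
      qed
      ultimately show "\<exists>U. open U \<and> p \<in> U \<and> Ck_on 2 G U" by blast
    qed
    fix p assume p: "p \<in> D"
    have "p \<in> A (N p)"
    proof -
      have "p \<notin> interior (C (N p - 1))" if "N p \<noteq> 0"
        using N(2)[OF p, of "N p - 1"] interior_subset that by (metis Suc_pred' not_gr0 not_less_eq_eq order_refl subsetD)
      then show ?thesis using N(1)[OF p] by (simp add: A_def)
    qed
    then have "v p \<le> M (N p) * b (N p) p"
      using M(2)[OF N(1)[OF p]] b(3) M(1) mult_left_mono[of 1 "b (N p) p" "M (N p)"] by fastforce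
    also have "\<dots> \<le> G p" unfolding G_def using M(1) b(2) by (intro member_le_sum) auto
    finally show "v p \<le> G p" .
  qed
qed

text \<open>On the gauge ball of radius r the Euclidean distance to \<open>q\<close> is O(r), so the
  average of \<open>u\<close> is O(r^4), and the limit in \<open>heis_avg_tendsto\<close> must be 0.
  This replaces any computation of second derivatives.\<close>

lemma heis_laplacian_eq_0_if_quartic:
  assumes D: "open D" "q \<in> D" and u: "Ck_on 2 u D" and b: "\<And>p. p \<in> D \<Longrightarrow> \<bar>u p\<bar> \<le> K * dist p q ^ 4"
  shows "heis_laplacian u q = 0"
proof -
  have u0: "u q = 0" using b[OF D(2)] by simp
  define c where "c = 3 + norm q"
  have c: "c > 0" unfolding c_def using norm_ge_zero[of q] by linarith
  define B where "B = \<bar>K\<bar> * c ^ 4"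
  have "((\<lambda>r. B * r\<^sup>2) \<longlongrightarrow> B * 0\<^sup>2) (at_right 0)" by (intro tendsto_intros)
  then have z: "((\<lambda>r. B * r\<^sup>2) \<longlongrightarrow> 0) (at_right 0)" by simp
  have "\<forall>\<^sub>F r in at_right 0. norm ((heis_avg u r q - u q) / r\<^sup>2) \<le> B * r\<^sup>2"
    using eventually_heis_ball_subset[OF D]
  proof eventually_elim
    case (elim r)
    then obtain e where r: "0 < r" "r \<le> 1" "cball q e \<subseteq> D" "heis_ball q r \<subseteq> cball q e" by blast
    have cu: "continuous_on (cball q e) u" using Ck_on_continuous[OF u] r continuous_on_subset by blast
    have bd: "\<bar>u p\<bar> \<le> B * r ^ 4" if "p \<in> heis_ball q r" for p
    proof -
      have "p \<in> D" using that r by blast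
      have "dist p q \<le> r * c" using heis_ball_subset_cball[OF r(1,2), of q] that by (auto simp: c_def dist_commute)
      then have "dist p q ^ 4 \<le> (r * c) ^ 4" by (intro power_mono) auto
      then have "\<bar>K\<bar> * dist p q ^ 4 \<le> \<bar>K\<bar> * (r * c) ^ 4" by (intro mult_left_mono) auto
      moreover have "K * dist p q ^ 4 \<le> \<bar>K\<bar> * dist p q ^ 4" by (intro mult_right_mono) auto
      ultimately show ?thesis using b[OF \<open>p \<in> D\<close>] by (simp add: B_def power_mult_distrib mult_ac)
    qed
    have const: "heis_avg (\<lambda>_. k) r q = k" for k
    proof -
      have "(\<lambda>p. indicator gauge_ball p * k) = (\<lambda>p::heis. k * indicator gauge_ball p)" by auto
      then show ?thesis
        using heis_avg_eq(1)[of q e "\<lambda>_. k" r] r(1,4) by (simp only: integral_mult_right_zero gauge_ball_integral continuous_on_const) simp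
    qed
    have "heis_avg u r q \<le> B * r ^ 4"
      using heis_avg_mono[OF cu continuous_on_const r(4,1), of "B * r ^ 4"] bd const by (simp add: abs_le_iff)
    moreover have "- (B * r ^ 4) \<le> heis_avg u r q"
      using heis_avg_mono[OF continuous_on_const cu r(4,1), of "- (B * r ^ 4)"] bd const by (simp add: abs_le_iff minus_le_iff)
    ultimately have "\<bar>heis_avg u r q\<bar> \<le> B * r ^ 4" by linarith
    also have "\<dots> = B * r\<^sup>2 * r\<^sup>2" by (simp add: power2_eq_square power4_eq_xxxx)
    finally show ?case using r(1) by (simp add: u0 divide_le_eq)
  qed
  from Lim_null_comparison[OF this z] heis_avg_tendsto[OF D u]
  have "heis_laplacian u q / (3 * pi) = 0"
    using tendsto_unique[of "at_right (0::real)"] by (metis trivial_limit_at_right_real)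
  then show ?thesis by simp
qed

section \<open>Viscosity solutions\<close>

lemma heis_avg_uminus: "heis_avg (\<lambda>p. - f p) r q = - heis_avg f r q"
  by (simp add: heis_avg_def set_lebesgue_integral_def)

text \<open>Negation exchanges touching from below with touching from above, so one-sided results
  for \<open>v\<close> also apply to \<open>- v\<close>.\<close>

lemma viscosity_mvp_at_uminus:
  assumes D: "open D" and v: "viscosity_mvp_at D v q"
  shows "viscosity_mvp_at D (\<lambda>p. - v p) q"
  unfolding viscosity_mvp_at_def
proof (intro conjI allI impI)
  fix \<phi> assume \<phi>: "Ck_on 2 \<phi> D \<and> \<phi> q = - v q \<and> (\<forall>p\<in>D - {q}. \<phi> p < - v p)"
  have "v p < - \<phi> p" if "p \<in> D - {q}" for p using \<phi> that by (metis less_minus_iff)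
  then have "Ck_on 2 (\<lambda>p. - \<phi> p) D \<and> - \<phi> q = v q \<and> (\<forall>p\<in>D - {q}. - \<phi> p > v p)"
    using \<phi> Ck_on_uminus[OF D] by simp
  then obtain g where "g \<in> o[at_right 0](\<lambda>r::real. r\<^sup>2)" "\<forall>\<^sub>F r in at_right 0. heis_avg (\<lambda>p. - \<phi> p) r q - - \<phi> q \<ge> g r"
    using v unfolding viscosity_mvp_at_def by blast
  then show "\<exists>g \<in> o[at_right 0](\<lambda>r::real. r\<^sup>2). \<forall>\<^sub>F r in at_right 0. heis_avg \<phi> r q - \<phi> q \<le> g r"
    by (intro bexI[of _ "\<lambda>r. - g r"]) (auto simp: heis_avg_uminus elim!: eventually_mono)
next
  fix \<phi> assume \<phi>: "Ck_on 2 \<phi> D \<and> \<phi> q = - v q \<and> (\<forall>p\<in>D - {q}. \<phi> p > - v p)"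
  have "- \<phi> p < v p" if "p \<in> D - {q}" for p using \<phi> that by (metis minus_less_iff)
  then have "Ck_on 2 (\<lambda>p. - \<phi> p) D \<and> - \<phi> q = v q \<and> (\<forall>p\<in>D - {q}. - \<phi> p < v p)"
    using \<phi> Ck_on_uminus[OF D] by simp
  then obtain g where "g \<in> o[at_right 0](\<lambda>r::real. r\<^sup>2)" "\<forall>\<^sub>F r in at_right 0. heis_avg (\<lambda>p. - \<phi> p) r q - - \<phi> q \<le> g r"
    using v unfolding viscosity_mvp_at_def by blast
  then show "\<exists>g \<in> o[at_right 0](\<lambda>r::real. r\<^sup>2). \<forall>\<^sub>F r in at_right 0. heis_avg \<phi> r q - \<phi> q \<ge> g r"
    by (intro bexI[of _ "\<lambda>r. - g r"]) (auto simp: heis_avg_uminus elim!: eventually_mono)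
qed

text \<open>The definition of the viscosity property quantifies over test functions that touch \<open>v\<close>
  strictly and globally on \<open>D\<close>. A local test function is extended by a \<open>C\<^sup>2\<close> majorant of \<open>v\<close>, with
  a cutoff that deviates from 1 only to fourth order at \<open>q\<close>.\<close>

lemma viscosity_touch_above:
  assumes D: "open D" "q \<in> D" and v: "continuous_on D v" and visc: "viscosity_mvp_at D v q"
    and r: "r > 0" "ball q r \<subseteq> D" and \<phi>: "Ck_on 2 \<phi> (ball q r)" "\<phi> q = v q" "\<And>p. p \<in> ball q r \<Longrightarrow> v p \<le> \<phi> p"
  shows "heis_laplacian \<phi> q \<ge> 0"
proof -
  obtain G where G: "Ck_on 2 G D" "\<And>p. p \<in> D \<Longrightarrow> v p \<le> G p" using Ck_majorant_exists[OF D(1) v] by blast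
  define \<rho> where "\<rho> = r / 2"
  have \<rho>: "\<rho> > 0" "cball q \<rho> \<subseteq> ball q r" using r by (auto simp: \<rho>_def)
  define \<beta> where "\<beta> = bump q \<rho>"
  \<comment> \<open>1 - \<open>cut\<close> is the square of the quadratic deviation 1 -
    \<open>\<beta>\<close>, hence of fourth order at \<open>q\<close>.\<close>
  define cut where "cut p = 1 - (1 - \<beta> p) ^ 2" for p
  \<comment> \<open>Fourth power of the distance: it makes the contact strict and leaves the
    sub-Laplacian at \<open>q\<close> unchanged.\<close>
  define \<tau> where "\<tau> p = ((p - q) \<bullet> (p - q)) ^ 2" for p :: heis
  have \<beta>: "Ck_on 2 \<beta> UNIV" unfolding \<beta>_def by (rule Ck_on_bump)
  have cut: "Ck_on 2 cut UNIV" "Ck_on 2 (\<lambda>p. 1 - cut p) UNIV"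
    unfolding cut_def [abs_def] by (intro Ck_on_diff Ck_on_power Ck_on_const open_UNIV \<beta>)+
  have \<tau>: "Ck_on 2 \<tau> UNIV" unfolding \<tau>_def [abs_def] by (intro Ck_on_power Ck_on_dist2 open_UNIV)
  have \<beta>01: "0 \<le> \<beta> p" "\<beta> p \<le> 1" for p by (simp_all add: \<beta>_def bump_nonneg bump_le_1)
  have cut01: "0 \<le> cut p" "cut p \<le> 1" for p
    using \<beta>01[of p] power_le_one[of "1 - \<beta> p" 2] by (simp_all add: cut_def)
  have cut0: "cut p = 0" if "p \<notin> cball q \<rho>" for p
    using bump_outside[OF \<rho>(1), of p q] that by (simp add: cut_def \<beta>_def)
  have cutle: "1 - cut p \<le> 9 / \<rho> ^ 4 * dist p q ^ 4" for p
  proof -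
    have "(1 - \<beta> p) ^ 2 \<le> (3 * (dist p q)\<^sup>2 / \<rho>\<^sup>2) ^ 2"
      using bump_ge[OF \<rho>(1), of q p] \<beta>01[of p] by (intro power_mono) (auto simp: \<beta>_def)
    also have "\<dots> = 9 / \<rho> ^ 4 * dist p q ^ 4" by (simp add: power_divide power_mult_distrib power2_eq_square power4_eq_xxxx)
    finally show ?thesis by (simp add: cut_def)
  qed
  have \<tau>eq: "\<tau> p = dist p q ^ 4" for p by (simp add: \<tau>_def inner_diff_eq_dist)
  define \<Phi> where "\<Phi> p = cut p * \<phi> p + (1 - cut p) * G p + \<tau> p" for p
  have \<Phi>: "Ck_on 2 \<Phi> D"
  proof -
    have "Ck_on 2 (\<lambda>p. cut p * \<phi> p) D"
      by (rule Ck_on_mult_support[OF closed_cball \<rho>(2) open_ball D(1) _ \<phi>(1) cut0]) (rule Ck_on_subset[OF cut(1)], simp)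
    moreover have "Ck_on 2 (\<lambda>p. (1 - cut p) * G p) D"
      by (rule Ck_on_mult[OF D(1) Ck_on_subset[OF cut(2)] G(1)]) simp
    moreover have "Ck_on 2 \<tau> D" by (rule Ck_on_subset[OF \<tau>]) simp
    ultimately show ?thesis unfolding \<Phi>_def [abs_def] by (intro Ck_on_add D(1))
  qed
  have cutq: "cut q = 1" by (simp add: cut_def \<beta>_def bump_def)
  have \<Phi>q: "\<Phi> q = v q" by (simp add: \<Phi>_def cutq \<tau>_def \<phi>(2))
  have \<Phi>gt: "\<Phi> p > v p" if p: "p \<in> D - {q}" for p
  proof -
    have "cut p * \<phi> p \<ge> cut p * v p"
    proof (cases "p \<in> cball q \<rho>")
      case True
      then have "p \<in> ball q r" using \<rho>(2) by blast
      then show ?thesis using \<phi>(3) cut01 by (intro mult_left_mono) auto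
    qed (simp add: cut0)
    moreover have "(1 - cut p) * G p \<ge> (1 - cut p) * v p"
      using G(2) p cut01 by (intro mult_left_mono) auto
    moreover have "\<tau> p > 0" using p by (simp add: \<tau>eq)
    moreover have "cut p * v p + (1 - cut p) * v p = v p" by (simp add: algebra_simps)
    ultimately show ?thesis unfolding \<Phi>_def by linarith
  qed
  obtain g where g: "g \<in> o[at_right 0](\<lambda>r::real. r\<^sup>2)" "\<forall>\<^sub>F r in at_right 0. heis_avg \<Phi> r q - \<Phi> q \<ge> g r"
    using visc \<Phi> \<Phi>q \<Phi>gt unfolding viscosity_mvp_at_def by blast
  have "heis_laplacian \<Phi> q / (3 * pi) \<ge> 0"
  proof (rule tendsto_le[OF _ heis_avg_tendsto[OF D \<Phi>] smalloD_tendsto[OF g(1)]])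
    show "\<forall>\<^sub>F r in at_right 0. g r / r\<^sup>2 \<le> (heis_avg \<Phi> r q - \<Phi> q) / r\<^sup>2"
      using g(2) by eventually_elim (simp add: divide_right_mono)
  qed simp
  then have L: "heis_laplacian \<Phi> q \<ge> 0" using pi_gt_zero by (simp add: zero_le_divide_iff)
  \<comment> \<open>Near \<open>q\<close> both the mixing with \<open>G\<close> and the added
    \<open>\<tau>\<close> are of fourth order, so \<open>\<Phi>\<close> and \<open>\<phi>\<close>
    have the same sub-Laplacian at \<open>q\<close>.\<close>
  define u where "u p = \<Phi> p - \<phi> p" for p
  have bb: "ball q \<rho> \<subseteq> ball q r" using \<rho>(2) ball_subset_cball by blast
  have \<Phi>b: "Ck_on 2 \<Phi> (ball q \<rho>)" by (rule Ck_on_subset[OF \<Phi> order_trans[OF bb r(2)]])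
  have \<phi>b: "Ck_on 2 \<phi> (ball q \<rho>)" by (rule Ck_on_subset[OF \<phi>(1) bb])
  have ub: "Ck_on 2 u (ball q \<rho>)" unfolding u_def [abs_def] by (rule Ck_on_diff[OF open_ball \<Phi>b \<phi>b])
  have "continuous_on (cball q \<rho>) (\<lambda>p. G p - \<phi> p)"
    using Ck_on_continuous[OF G(1)] Ck_on_continuous[OF \<phi>(1)] \<rho>(2) r(2)
    by (intro continuous_intros) (meson continuous_on_subset order_trans)+
  then obtain B where B: "B \<ge> 0" "\<And>p. p \<in> cball q \<rho> \<Longrightarrow> \<bar>G p - \<phi> p\<bar> \<le> B"
    using continuous_on_compact_abs_bound[OF compact_cball] by blast
  have "heis_laplacian u q = 0"
  proof (rule heis_laplacian_eq_0_if_quartic[OF open_ball _ ub])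
    show "q \<in> ball q \<rho>" using \<rho> by simp
    show "\<bar>u p\<bar> \<le> (9 / \<rho> ^ 4 * B + 1) * dist p q ^ 4" if "p \<in> ball q \<rho>" for p
    proof -
      have "u p = (1 - cut p) * (G p - \<phi> p) + dist p q ^ 4"
        by (simp add: u_def \<Phi>_def \<tau>eq algebra_simps)
      moreover have "\<bar>(1 - cut p) * (G p - \<phi> p)\<bar> \<le> (9 / \<rho> ^ 4 * dist p q ^ 4) * B"
        unfolding abs_mult using cut01[of p] cutle[of p] B that by (intro mult_mono) auto
      moreover have "\<bar>dist p q ^ 4\<bar> = dist p q ^ 4" by simp
      ultimately have "\<bar>u p\<bar> \<le> (9 / \<rho> ^ 4 * dist p q ^ 4) * B + dist p q ^ 4" by linarith
      then show ?thesis by (simp add: algebra_simps)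
    qed
  qed
  moreover have "heis_laplacian u q = heis_laplacian \<Phi> q - heis_laplacian \<phi> q"
    unfolding u_def [abs_def] by (rule heis_laplacian_diff[OF open_ball \<Phi>b \<phi>b]) (use \<rho> in simp)
  ultimately show ?thesis using L by simp
qed

text \<open>A small multiple of the barrier is subtracted from v - H. Since the barrier vanishes on
  the sphere, a maximum above \<open>\<epsilon>\<close> lies inside, and there \<open>v\<close> is
  touched from above by \<open>H\<close> plus that multiple plus a constant, whose sub-Laplacian is
  negative; this contradicts \<open>viscosity_touch_above\<close>.\<close>

lemma viscosity_le_harmonic:
  assumes D: "open D" and v: "continuous_on D v" and visc: "\<And>q. q \<in> D \<Longrightarrow> viscosity_mvp_at D v q"
    and R: "0 < R" "cball q0 R \<subseteq> D" and U: "open U" "cball q0 R \<subseteq> U" and H: "Ck_on 2 H U"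
    "\<And>q. q \<in> U \<Longrightarrow> heis_laplacian H q = 0" and bd: "\<And>q. q \<in> sphere q0 R \<Longrightarrow> v q - H q \<le> \<epsilon>"
    and p: "p \<in> cball q0 R"
  shows "v p - H p \<le> \<epsilon>"
proof (rule ccontr)
  assume neg: "\<not> v p - H p \<le> \<epsilon>"
  define \<psi> where "\<psi> = heis_bump q0 R"
  have \<psi>b: "0 \<le> \<psi> x" "\<psi> x \<le> R\<^sup>2" if "x \<in> cball q0 R" for x
  proof -
    have "(dist x q0)\<^sup>2 \<le> R\<^sup>2" using that by (intro power_mono) (auto simp: dist_commute)
    then show "0 \<le> \<psi> x" "\<psi> x \<le> R\<^sup>2" by (simp_all add: \<psi>_def heis_bump_def)
  qed
  \<comment> \<open>The barrier is at most R^2, so this multiple uses up at most half of the excess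
    of v - H over \<open>\<epsilon>\<close> at \<open>p\<close>.\<close>
  define \<eta> where "\<eta> = (v p - H p - \<epsilon>) / (2 * R\<^sup>2)"
  have \<eta>: "\<eta> > 0" using neg R by (simp add: \<eta>_def)
  have "\<eta> * \<psi> p \<le> \<eta> * R\<^sup>2" using \<psi>b[OF p] \<eta> by (intro mult_left_mono) auto
  also have "\<dots> = (v p - H p - \<epsilon>) / 2" using R by (simp add: \<eta>_def)
  finally have pg: "v p - H p - \<eta> * \<psi> p > \<epsilon>" using neg by (simp add: field_simps)
  have "continuous_on (cball q0 R) (\<lambda>x. v x - H x - \<eta> * \<psi> x)"
    using continuous_on_subset[OF v R(2)] continuous_on_subset[OF Ck_on_continuous[OF H(1)] U(2)]
      continuous_on_subset[OF Ck_on_continuous[OF Ck_on_heis_bump[of 0 q0 R UNIV]], of "cball q0 R"]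
    unfolding \<psi>_def by (intro continuous_on_diff continuous_on_mult_left) simp_all
  then obtain q where q: "q \<in> cball q0 R" "\<And>x. x \<in> cball q0 R \<Longrightarrow> v x - H x - \<eta> * \<psi> x \<le> v q - H q - \<eta> * \<psi> q"
    using continuous_attains_sup[OF compact_cball, of q0 R "\<lambda>x. v x - H x - \<eta> * \<psi> x"] p by blast
  define m where "m = v q - H q - \<eta> * \<psi> q"
  have m: "m > \<epsilon>" using q(2)[OF p] pg by (simp add: m_def)
  have "q \<in> ball q0 R"
  proof (rule ccontr)
    assume "q \<notin> ball q0 R"
    then have s: "q \<in> sphere q0 R" using q(1) by auto
    then have "\<psi> q = 0" by (simp add: \<psi>_def heis_bump_def dist_commute)
    then show False using bd[OF s] m by (simp add: m_def)
  qed
  then obtain r where r: "r > 0" "ball q r \<subseteq> ball q0 R" using open_ball open_contains_ball by blast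
  have qU: "q \<in> U" and qD: "q \<in> D" using q(1) U R by auto
  have \<psi>C: "Ck_on 2 (\<lambda>x. \<eta> * \<psi> x) U" unfolding \<psi>_def by (intro Ck_on_mult Ck_on_const Ck_on_heis_bump U(1))
  define \<phi> where "\<phi> x = (H x + \<eta> * \<psi> x) + m" for x
  have s1: "Ck_on 2 (\<lambda>x. H x + \<eta> * \<psi> x) U" by (rule Ck_on_add[OF U(1) H(1) \<psi>C])
  have \<phi>C: "Ck_on 2 \<phi> U" unfolding \<phi>_def [abs_def] by (rule Ck_on_add[OF U(1) s1 Ck_on_const])
  have "heis_laplacian \<phi> q \<ge> 0"
  proof (rule viscosity_touch_above[OF D qD v visc[OF qD] r(1)])
    show "ball q r \<subseteq> D" using r(2) R(2) ball_subset_cball by blast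
    show "Ck_on 2 \<phi> (ball q r)" using r(2) U(2) ball_subset_cball by (intro Ck_on_subset[OF \<phi>C]) blast
    show "\<phi> q = v q" by (simp add: \<phi>_def m_def)
    show "v x \<le> \<phi> x" if "x \<in> ball q r" for x
    proof -
      have "x \<in> cball q0 R" using that r(2) ball_subset_cball by blast
      from q(2)[OF this] show ?thesis by (simp add: \<phi>_def m_def)
    qed
  qed
  moreover have "heis_laplacian \<phi> q = 0 + \<eta> * (- 4 - ((fst q)\<^sup>2 + (fst (snd q))\<^sup>2) / 2) + 0"
  proof -
    have "heis_laplacian (\<lambda>_. m) q = 0" unfolding heis_laplacian_def by (simp add: heis_XY_const [abs_def])
    moreover have "heis_laplacian (\<lambda>x. \<eta> * \<psi> x) q = \<eta> * (- 4 - ((fst q)\<^sup>2 + (fst (snd q))\<^sup>2) / 2)"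
      unfolding \<psi>_def heis_laplacian_cmult[OF U(1) Ck_on_heis_bump qU] heis_laplacian_bump ..
    ultimately show ?thesis
      unfolding \<phi>_def [abs_def] heis_laplacian_add[OF U(1) s1 Ck_on_const qU] heis_laplacian_add[OF U(1) H(1) \<psi>C qU]
      using H(2)[OF qU] by simp
  qed
  moreover have "\<eta> * (- 4 - ((fst q)\<^sup>2 + (fst (snd q))\<^sup>2) / 2) < 0"
  proof (rule mult_pos_neg[OF \<eta>])
    have "- 4 - x / 2 < 0" if "x \<ge> 0" for x :: real using that by linarith
    then show "- 4 - ((fst q)\<^sup>2 + (fst (snd q))\<^sup>2) / 2 < 0" by (simp only: sum_power2_ge_zero)
  qed
  ultimately show False by linarith
qed

lemma viscosity_dist_harmonic:
  assumes D: "open D" and v: "continuous_on D v" and visc: "\<And>q. q \<in> D \<Longrightarrow> viscosity_mvp_at D v q"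
    and R: "0 < R" "cball q0 R \<subseteq> D" and U: "open U" "cball q0 R \<subseteq> U" and H: "Ck_on 2 H U"
    "\<And>q. q \<in> U \<Longrightarrow> heis_laplacian H q = 0" and bd: "\<And>q. q \<in> sphere q0 R \<Longrightarrow> \<bar>v q - H q\<bar> \<le> \<epsilon>"
    and p: "p \<in> cball q0 R"
  shows "\<bar>v p - H p\<bar> \<le> \<epsilon>"
proof -
  have 1: "v p - H p \<le> \<epsilon>"
    by (rule viscosity_le_harmonic[OF D v visc R U H _ p]) (use bd in \<open>auto simp: abs_le_iff\<close>)
  have H': "heis_laplacian (\<lambda>p. - H p) q = 0" if "q \<in> U" for q
    using heis_laplacian_uminus[OF U(1) H(1) that] H(2)[OF that] by simp
  have "- v p - - H p \<le> \<epsilon>"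
    by (rule viscosity_le_harmonic[OF D continuous_on_minus[OF v] viscosity_mvp_at_uminus[OF D visc] R U Ck_on_uminus[OF U(1) H(1)] H' _ p])
      (use bd in \<open>auto simp: abs_le_iff\<close>)
  with 1 show ?thesis by (simp add: abs_le_iff)
qed

text \<open>Polynomial approximation provides data that are C^2 on the whole space, as
  \<open>dirichlet_approx\<close> requires. A uniform error passes to the mean with the mass of the
  kernel as factor, and it can be made arbitrarily small. The truncation \<open>V\<close> is the
  form in which \<open>Ck_on_kernel_mean\<close> will be applied.\<close>

lemma viscosity_mean_value:
  assumes D: "open D" and v: "continuous_on D v" and visc: "\<And>q. q \<in> D \<Longrightarrow> viscosity_mvp_at D v q"
    and R: "0 < R" "cball q0 R \<subseteq> D" and q: "q \<in> ball q0 (R / 4)"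
    and j: "2 \<le> j" and s: "0 < s" "s < 1" "s * (3 + norm q) < R / 4"
    and V: "V = (\<lambda>p. indicator (cball q0 R) p * v p)"
  shows "(\<integral>p. kmean j p * V (heis_mult q (heis_dil s p)) \<partial>lborel) = (\<integral>p. kmean j p \<partial>lborel) * V q"
proof -
  define I where "I = (\<integral>p. kmean j p \<partial>lborel)"
  have j0: "0 < j" using j by simp
  have I: "I > 0" unfolding I_def by (rule kmean_integral_pos[OF j0])
  have vC: "continuous_on (cball q0 R) v" using v R(2) continuous_on_subset by blast
  \<comment> \<open>The mean at \<open>q\<close> sees points within R/4 of \<open>q\<close>, hence
    within R/2 of \<open>q0\<close>; as \<open>R / 2 \<le> R1\<close> in
    \<open>dirichlet_approx\<close>, the comparison with \<open>H\<close> covers all of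
    them.\<close>
  have ball: "ball q (R / 4) \<subseteq> ball q0 (R / 2)"
  proof
    fix x assume "x \<in> ball q (R / 4)"
    then show "x \<in> ball q0 (R / 2)" using q dist_triangle[of q0 x q] by simp
  qed
  have near: "heis_mult q (heis_dil s p) \<in> ball q (R / 4)" if "p \<in> gauge_cball" for p
    using heis_mult_dil_in_ball[OF that, of s q "R / 4"] s by simp
  have near': "heis_mult q (heis_dil s p) \<in> ball q0 (R / 2)" if "p \<in> gauge_cball" for p
    using near[OF that] ball by blast
  have Vv: "V x = v x" if "x \<in> ball q0 (R / 2)" for x using that R by (simp add: V)
  have cV: "continuous_on gauge_cball (\<lambda>p. v (heis_mult q (heis_dil s p)))"
  proof (rule continuous_on_compose2[OF vC])
    show "continuous_on gauge_cball (\<lambda>p. heis_mult q (heis_dil s p))" by (intro continuous_intros)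
    show "(\<lambda>p. heis_mult q (heis_dil s p)) ` gauge_cball \<subseteq> cball q0 R" using near' R by fastforce
  qed
  note iK = integrable_mult_support[OF compact_gauge_cball kmean_measurable kmean_abs_le[OF j0] kmean_outside[OF j0]]
  have VvI: "(\<integral>p. kmean j p * V (heis_mult q (heis_dil s p)) \<partial>lborel) = (\<integral>p. kmean j p * v (heis_mult q (heis_dil s p)) \<partial>lborel)"
  proof (rule Bochner_Integration.integral_cong[OF refl])
    show "kmean j p * V (heis_mult q (heis_dil s p)) = kmean j p * v (heis_mult q (heis_dil s p))" for p
      using Vv[OF near'] kmean_outside[OF j0, of p] by (cases "p \<in> gauge_cball") auto
  qed
  have est: "\<bar>(\<integral>p. kmean j p * v (heis_mult q (heis_dil s p)) \<partial>lborel) - I * v q\<bar> \<le> (4 * I) * \<epsilon>" if \<epsilon>: "\<epsilon> > 0" for \<epsilon>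
  proof -
    obtain f where f: "real_polynomial_function f" "\<And>x. x \<in> cball q0 R \<Longrightarrow> \<bar>v x - f x\<bar> < \<epsilon>"
      using Stone_Weierstrass_real_polynomial_function[OF compact_cball vC \<epsilon>] by blast
    obtain R1 H U where H: "R / 2 \<le> R1" "R1 < R" "open U" "cball q0 R1 \<subseteq> U" "U \<subseteq> ball q0 R" "Ck_on 2 H U"
      "\<And>q. q \<in> U \<Longrightarrow> heis_laplacian H q = 0" "\<And>q. q \<in> sphere q0 R1 \<Longrightarrow> \<bar>H q - f q\<bar> \<le> \<epsilon>"
      by (rule dirichlet_approx[OF real_polynomial_function_Ck_on[OF f(1)] R(1) \<epsilon>, of q0]) blast
    have R1: "R1 > 0" "cball q0 R1 \<subseteq> D" using H(1,2) R by auto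
    \<comment> \<open>One \<open>\<epsilon>\<close> from the polynomial and one from the approximate
      boundary values. Comparison carries 2 \<open>\<epsilon>\<close> inside, where it counts twice:
      in the mean and in the value at \<open>q\<close>.\<close>
    have bd: "\<bar>v x - H x\<bar> \<le> 2 * \<epsilon>" if "x \<in> sphere q0 R1" for x
      using H(8)[OF that] f(2)[of x] that H(2) by auto
    have vH: "\<bar>v x - H x\<bar> \<le> 2 * \<epsilon>" if "x \<in> ball q0 (R / 2)" for x
      by (rule viscosity_dist_harmonic[OF D v visc R1 H(3,4,6,7) bd]) (use that H(1) in auto)
    have HU: "ball q (R / 4) \<subseteq> U" using ball H(1,4) by fastforce
    have "0 \<le> s" using s by simp
    have mH: "(\<integral>p. kmean j p * H (heis_mult q (heis_dil s p)) \<partial>lborel) = I * H q"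
      unfolding I_def using HU H(7) by (intro heis_mean_eq[OF j H(3) HU H(6) _ \<open>0 \<le> s\<close> s(2,3)]) blast
    have cH: "continuous_on gauge_cball (\<lambda>p. H (heis_mult q (heis_dil s p)))"
    proof (rule continuous_on_compose2[OF Ck_on_continuous[OF H(6)]])
      show "continuous_on gauge_cball (\<lambda>p. heis_mult q (heis_dil s p))" by (intro continuous_intros)
      show "(\<lambda>p. heis_mult q (heis_dil s p)) ` gauge_cball \<subseteq> U" using near HU by blast
    qed
    have i: "integrable lborel (\<lambda>p. kmean j p * v (heis_mult q (heis_dil s p)))" "integrable lborel (\<lambda>p. kmean j p * H (heis_mult q (heis_dil s p)))"
      "integrable lborel (\<lambda>p. kmean j p * 1)"
      by (rule iK; (assumption | rule cV cH continuous_on_const))+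
    have "(\<integral>p. kmean j p * v (heis_mult q (heis_dil s p)) \<partial>lborel) - I * H q
       = (\<integral>p. kmean j p * (v (heis_mult q (heis_dil s p)) - H (heis_mult q (heis_dil s p))) \<partial>lborel)"
      unfolding mH[symmetric] right_diff_distrib using i(1,2) by simp
    also have "\<bar>\<dots>\<bar> \<le> (\<integral>p. \<bar>kmean j p * (v (heis_mult q (heis_dil s p)) - H (heis_mult q (heis_dil s p)))\<bar> \<partial>lborel)"
      by (rule integral_abs_bound)
    also have "\<dots> \<le> (\<integral>p. (2 * \<epsilon>) * (kmean j p * 1) \<partial>lborel)"
    proof (rule integral_mono)
      show "integrable lborel (\<lambda>p. \<bar>kmean j p * (v (heis_mult q (heis_dil s p)) - H (heis_mult q (heis_dil s p)))\<bar>)"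
        unfolding right_diff_distrib using i(1,2) by (intro integrable_abs Bochner_Integration.integrable_diff)
      show "integrable lborel (\<lambda>p. (2 * \<epsilon>) * (kmean j p * 1))" using i(3) by (rule integrable_mult_right)
      fix p
      show "\<bar>kmean j p * (v (heis_mult q (heis_dil s p)) - H (heis_mult q (heis_dil s p)))\<bar> \<le> (2 * \<epsilon>) * (kmean j p * 1)"
      proof (cases "p \<in> gauge_cball")
        case True
        have "kmean j p * \<bar>v (heis_mult q (heis_dil s p)) - H (heis_mult q (heis_dil s p))\<bar> \<le> kmean j p * (2 * \<epsilon>)"
          by (rule mult_left_mono[OF vH[OF near'[OF True]] kmean_nonneg])
        then show ?thesis by (simp only: abs_mult abs_of_nonneg[OF kmean_nonneg] mult.commute mult_1_right)
      qed (simp add: kmean_outside[OF j0])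
    qed
    finally have 1: "\<bar>(\<integral>p. kmean j p * v (heis_mult q (heis_dil s p)) \<partial>lborel) - I * H q\<bar> \<le> 2 * \<epsilon> * I"
      by (simp add: I_def)
    have "q \<in> ball q0 (R / 2)" using q R by simp
    then have "\<bar>I * (v q - H q)\<bar> \<le> I * (2 * \<epsilon>)" unfolding abs_mult using vH I by (intro mult_mono) auto
    then have "\<bar>I * v q - I * H q\<bar> \<le> 2 * \<epsilon> * I" by (simp add: algebra_simps)
    with 1 have "\<bar>(\<integral>p. kmean j p * v (heis_mult q (heis_dil s p)) \<partial>lborel) - I * v q\<bar> \<le> 2 * \<epsilon> * I + 2 * \<epsilon> * I" by linarith
    then show ?thesis by (simp add: mult_ac)
  qed
  have "\<bar>(\<integral>p. kmean j p * v (heis_mult q (heis_dil s p)) \<partial>lborel) - I * v q\<bar> \<le> 0"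
  proof (rule field_le_epsilon)
    fix e :: real assume "0 < e"
    then have "\<bar>(\<integral>p. kmean j p * v (heis_mult q (heis_dil s p)) \<partial>lborel) - I * v q\<bar> \<le> (4 * I) * (e / (4 * I))"
      using I by (intro est) simp
    then show "\<bar>(\<integral>p. kmean j p * v (heis_mult q (heis_dil s p)) \<partial>lborel) - I * v q\<bar> \<le> 0 + e" using I by simp
  qed
  then show ?thesis using Vv[of q] q R by (simp add: VvI I_def)
qed

lemma viscosity_smooth_harmonic:
  assumes D: "open D" and v: "continuous_on D v" and visc: "\<And>q. q \<in> D \<Longrightarrow> viscosity_mvp_at D v q"
  shows "Cinf_on v D" "\<And>q. q \<in> D \<Longrightarrow> heis_laplacian v q = 0"
proof -
  have Ck: "Ck_on k v D" for k
  proof (rule Ck_on_local)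
    fix q0 assume "q0 \<in> D"
    then obtain R where R: "R > 0" "cball q0 R \<subseteq> D" using D open_contains_cball by blast
    define V where "V = (\<lambda>p. indicator (cball q0 R) p * v p)"
    \<comment> \<open>Large enough both for C^k kernels, \<open>k < j\<close>, and for the mean
      value property, \<open>2 \<le> j\<close>.\<close>
    define j where "j = k + 2"
    define c where "c = 3 + norm q0 + R"
    have c: "c > 0" using R norm_ge_zero[of q0] unfolding c_def by linarith
    define s where "s = min (1/2) (R / (8 * c))"
    have s: "0 < s" "s < 1" "s * c < R / 4"
    proof -
      show "0 < s" "s < 1" using R c by (auto simp: s_def)
      have "s * c \<le> (R / (8 * c)) * c" using c by (intro mult_right_mono) (auto simp: s_def)
      then show "s * c < R / 4" using R c by simp
    qed
    have sq: "s * (3 + norm q) < R / 4" if "q \<in> ball q0 (R / 4)" for q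
    proof -
      have "norm q \<le> norm q0 + dist q0 q" by (metis dist_commute dist_norm norm_triangle_sub add.commute)
      moreover have "dist q0 q < R" using that R by simp
      ultimately have "s * (3 + norm q) \<le> s * c" using s by (intro mult_left_mono) (auto simp: c_def)
      then show ?thesis using s(3) by (rule le_less_trans)
    qed
    have vC: "continuous_on (cball q0 R) v" using v R(2) continuous_on_subset by blast
    obtain B where B: "B \<ge> 0" "\<And>x. x \<in> cball q0 R \<Longrightarrow> \<bar>v x\<bar> \<le> B"
      using continuous_on_compact_abs_bound[OF compact_cball vC] by blast
    have Vm: "V \<in> borel_measurable borel"
      unfolding V_def using borel_measurable_continuous_on_indicator[OF _ vC] by simp
    have Vb: "\<bar>V p\<bar> \<le> B" for p using B by (cases "p \<in> cball q0 R") (simp_all add: V_def)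
    have V0: "V p = 0" if "p \<notin> cball q0 R" for p using that by (simp add: V_def)
    define I where "I = (\<integral>p. kmean j p \<partial>lborel)"
    have I: "I > 0" unfolding I_def by (rule kmean_integral_pos) (simp add: j_def)
    have "Ck_on k (\<lambda>q. (1 / I) * (\<integral>p. kmean j p * V (heis_mult q (heis_dil s p)) \<partial>lborel)) UNIV"
      using s(1) by (intro Ck_on_mult Ck_on_const open_UNIV Ck_on_kernel_mean[OF _ _ Vm Vb compact_cball V0]) (auto simp: j_def)
    then have "Ck_on k (\<lambda>q. (1 / I) * (\<integral>p. kmean j p * V (heis_mult q (heis_dil s p)) \<partial>lborel)) (ball q0 (R / 4))"
      by (rule Ck_on_subset) simp
    then have "Ck_on k v (ball q0 (R / 4))"
    proof (rule Ck_on_cong[OF open_ball])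
      fix q assume q: "q \<in> ball q0 (R / 4)"
      have "2 \<le> j" by (simp add: j_def)
      from viscosity_mean_value[OF D v visc R q this s(1,2) sq[OF q] V_def]
      have "(\<integral>p. kmean j p * V (heis_mult q (heis_dil s p)) \<partial>lborel) = I * V q" by (simp add: I_def)
      moreover have "V q = v q" using q R by (simp add: V_def)
      ultimately show "(1 / I) * (\<integral>p. kmean j p * V (heis_mult q (heis_dil s p)) \<partial>lborel) = v q" using I by simp
    qed
    then show "\<exists>U. open U \<and> q0 \<in> U \<and> Ck_on k v U" using R by (intro exI[of _ "ball q0 (R / 4)"]) auto
  qed
  then show "Cinf_on v D" by (simp add: Cinf_on_def)
  show "heis_laplacian v q = 0" if q: "q \<in> D" for q
  proof -
    obtain r where r: "r > 0" "ball q r \<subseteq> D" using D q open_contains_ball by blast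
    have C2: "Ck_on 2 v (ball q r)" by (rule Ck_on_subset[OF Ck r(2)])
    \<comment> \<open>\<open>viscosity_touch_above\<close> admits contact on a whole ball, so
      \<open>v\<close>, now known to be C^2, is its own test function; the same holds for
      \<open>- v\<close>.\<close>
    have "heis_laplacian v q \<ge> 0"
      by (rule viscosity_touch_above[OF D q v visc[OF q] r C2]) auto
    moreover have "heis_laplacian (\<lambda>p. - v p) q \<ge> 0"
      by (rule viscosity_touch_above[OF D q continuous_on_minus[OF v] viscosity_mvp_at_uminus[OF D visc[OF q]] r Ck_on_uminus[OF open_ball C2]]) auto
    ultimately show ?thesis using heis_laplacian_uminus[OF D Ck q] by simp
  qed
qed

text \<open>The error function is that of \<open>v\<close> itself, which is o(r^2) because the
  second-order limit vanishes. Averages over small balls inside \<open>D\<close> are monotone, which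
  compares every touching function with it.\<close>

lemma harmonic_viscosity_mvp:
  assumes D: "open D" "q \<in> D" and v: "Ck_on 2 v D" "heis_laplacian v q = 0"
  shows "viscosity_mvp_at D v q"
proof -
  define g where "g r = heis_avg v r q - v q" for r
  have "((\<lambda>r. g r / r\<^sup>2) \<longlongrightarrow> 0) (at_right 0)"
    using heis_avg_tendsto[OF D v(1)] v(2) by (simp add: g_def)
  then have g: "g \<in> o[at_right 0](\<lambda>r::real. r\<^sup>2)"
    by (rule smalloI_tendsto) (auto simp: eventually_at_filter)
  have mono: "\<forall>\<^sub>F r in at_right 0. heis_avg f r q \<le> heis_avg h r q"
    if f: "Ck_on 2 f D" and h: "Ck_on 2 h D" and fh: "\<And>p. p \<in> D \<Longrightarrow> f p \<le> h p" for f h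
    using eventually_heis_ball_subset[OF D]
  proof eventually_elim
    case (elim r)
    then obtain e where r: "0 < r" "cball q e \<subseteq> D" "heis_ball q r \<subseteq> cball q e" by blast
    show ?case
      by (rule heis_avg_mono[OF continuous_on_subset[OF Ck_on_continuous[OF f] r(2)] continuous_on_subset[OF Ck_on_continuous[OF h] r(2)] r(3,1)])
        (use fh r in blast)
  qed
  show ?thesis
    unfolding viscosity_mvp_at_def
  proof (intro conjI allI impI)
    fix \<phi> assume \<phi>: "Ck_on 2 \<phi> D \<and> \<phi> q = v q \<and> (\<forall>p\<in>D - {q}. \<phi> p < v p)"
    then have "\<forall>\<^sub>F r in at_right 0. heis_avg \<phi> r q \<le> heis_avg v r q"
      by (intro mono v(1)) (auto simp: less_imp_le, metis DiffI order.order_iff_strict singletonD)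
    then have "\<forall>\<^sub>F r in at_right 0. heis_avg \<phi> r q - \<phi> q \<le> g r"
      by eventually_elim (use \<phi> in \<open>simp add: g_def\<close>)
    with g show "\<exists>g\<in>o[at_right 0](\<lambda>r::real. r\<^sup>2). \<forall>\<^sub>F r in at_right 0. heis_avg \<phi> r q - \<phi> q \<le> g r" by blast
  next
    fix \<phi> assume \<phi>: "Ck_on 2 \<phi> D \<and> \<phi> q = v q \<and> (\<forall>p\<in>D - {q}. \<phi> p > v p)"
    then have "\<forall>\<^sub>F r in at_right 0. heis_avg v r q \<le> heis_avg \<phi> r q"
      by (intro mono v(1)) (auto simp: less_imp_le, metis DiffI order.order_iff_strict singletonD)
    then have "\<forall>\<^sub>F r in at_right 0. heis_avg \<phi> r q - \<phi> q \<ge> g r"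
      by eventually_elim (use \<phi> in \<open>simp add: g_def\<close>)
    with g show "\<exists>g\<in>o[at_right 0](\<lambda>r::real. r\<^sup>2). \<forall>\<^sub>F r in at_right 0. heis_avg \<phi> r q - \<phi> q \<ge> g r" by blast
  qed
qed

theorem proposition2p5:
  shows "(\<forall>(v :: heis \<Rightarrow> real) (q :: heis). Ck_on 2 v UNIV \<longrightarrow>
            (\<lambda>r::real. heis_avg v r q - (v q + r\<^sup>2 / (3 * pi) * heis_laplacian v q))
               \<in> o[at_right 0](\<lambda>r. r\<^sup>2)
          \<and> ((\<exists>r0>0. \<forall>r\<in>{0<..<r0}. v q = heis_avg v r q) \<longrightarrow> heis_laplacian v q = 0))
       \<and> (\<forall>(D :: heis set) (v :: heis \<Rightarrow> real). open D \<and> continuous_on D v \<longrightarrow>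
            ((\<forall>q\<in>D. viscosity_mvp_at D v q) \<longleftrightarrow>
             Cinf_on v D \<and> (\<forall>q\<in>D. heis_laplacian v q = 0)))"
proof (intro conjI allI impI)
  fix v :: "heis \<Rightarrow> real" and q assume v: "Ck_on 2 v UNIV"
  note T = heis_avg_tendsto[OF open_UNIV UNIV_I v, of q]
  have "((\<lambda>r. (heis_avg v r q - v q) / r\<^sup>2 - heis_laplacian v q / (3 * pi)) \<longlongrightarrow>
      heis_laplacian v q / (3 * pi) - heis_laplacian v q / (3 * pi)) (at_right 0)"
    by (intro tendsto_diff T tendsto_const)
  moreover have "\<forall>\<^sub>F r in at_right 0. (heis_avg v r q - v q) / r\<^sup>2 - heis_laplacian v q / (3 * pi) =
      (heis_avg v r q - (v q + r\<^sup>2 / (3 * pi) * heis_laplacian v q)) / r\<^sup>2"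
    unfolding eventually_at_filter by (intro always_eventually allI impI) (simp add: field_simps)
  ultimately have "((\<lambda>r. (heis_avg v r q - (v q + r\<^sup>2 / (3 * pi) * heis_laplacian v q)) / r\<^sup>2) \<longlongrightarrow> 0) (at_right 0)"
    by (simp add: Lim_transform_eventually)
  then show "(\<lambda>r::real. heis_avg v r q - (v q + r\<^sup>2 / (3 * pi) * heis_laplacian v q)) \<in> o[at_right 0](\<lambda>r. r\<^sup>2)"
    by (rule smalloI_tendsto) (auto simp: eventually_at_filter)
  assume "\<exists>r0>0. \<forall>r\<in>{0<..<r0}. v q = heis_avg v r q"
  then obtain r0 where r0: "r0 > 0" "\<And>r. r \<in> {0<..<r0} \<Longrightarrow> v q = heis_avg v r q" by blast
  have "\<forall>\<^sub>F r in at_right 0. (heis_avg v r q - v q) / r\<^sup>2 = 0"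
    using eventually_at_right_real[OF r0(1)] by eventually_elim (use r0(2) in force)
  then have "((\<lambda>r. (heis_avg v r q - v q) / r\<^sup>2) \<longlongrightarrow> 0) (at_right 0)" by (rule tendsto_eventually)
  from tendsto_unique[OF _ T this] show "heis_laplacian v q = 0" by simp
next
  fix D :: "heis set" and v :: "heis \<Rightarrow> real" assume Dv: "open D \<and> continuous_on D v"
  show "(\<forall>q\<in>D. viscosity_mvp_at D v q) \<longleftrightarrow> Cinf_on v D \<and> (\<forall>q\<in>D. heis_laplacian v q = 0)"
    using viscosity_smooth_harmonic[of D v] harmonic_viscosity_mvp[of D _ v] Dv unfolding Cinf_on_def by blast
qed

end
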